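(* There exists an absolute constant $c>0$ such that the following holds. Let $1\le m\le n$ be integers, let $H\subset\mathbb{R}^n$ be an $m$-dimensional linear subspace, let $s\in(-\infty,0]$, and let $f\colon\mathbb{R}^n\to[0,\infty)$ be an integrable, bounded, $\left(\frac1s\right)$-concave function with $\|f\|_\infty>0$. Then $$\frac{\int_H \Delta_{\frac1s}f(x)\,dx}{\|f\|_\infty}\le \left[c\,\psi(n,m)\right]^m\int_0^1\sup_{y\in\mathbb{R}^n}\mathrm{vol}_m\big(C_t(f)\cap(H+y)\big)\,dt,$$ where $\psi(n,m)=\min\left\{\frac nm,\sqrt m\right\}$.
   Context: For $\alpha\in[-\infty,\infty]$, $\lambda\in[0,1]$ and $a,b>0$ put $M_\alpha^\lambda(a,b)=((1-\lambda)a^\alpha+\lambda b^\alpha)^{1/\alpha}$ if $\alpha\ne0,\pm\infty$, $M_0^\lambda(a,b)=a^{1-\lambda}b^\lambda$, $M_\infty^\lambda(a,b)=\max\{a,b\}$, $M_{-\infty}^\lambda(a,b)=\min\{a,b\}$; and $M_\alpha^\lambda(a,b)=0$ if $ab=0$. A function $f\colon\mathbb{R}^n\to[0,\infty)$ is $\alpha$-concave if $f((1-\lambda)x+\lambda y)\ge M_\alpha^\lambda(f(x),f(y))$ for all $x,y\in\mathbb{R}^n$, $\lambda\in[0,1]$. For $a,b>0$ put (without weights) $M_\alpha(a,b)=(a^\alpha+b^\alpha)^{1/\alpha}$ if $\alpha\neq0,\pm\infty$, $M_0(a,b)=ab$, $M_\infty(a,b)=\max\{a,b\}$, $M_{-\infty}(a,b)=\min\{a,b\}$;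 and $M_\alpha(a,b)=0$ if $ab=0$. The $\alpha$-difference function of an $\alpha$-concave $f$ is $\Delta_\alpha f(x)=\sup_{x=x_1-x_2}M_\alpha(f(x_1),f(x_2))$. For $s=0$, in the present range $s\in(-\infty,0]$, $\frac1s$ is interpreted as $-\infty$. $\|f\|_\infty$ is the essential supremum of $f$, and $C_t(f)=\{x\in\mathbb{R}^n: f(x)\ge t\|f\|_\infty\}$ for $0\le t\le1$. $\mathrm{vol}_m$ is $m$-dimensional Lebesgue measure, and $\int_H\cdot\,dx$ is integration against $m$-dimensional Lebesgue measure on $H$.
   Formalization: When s = 0 and m < n, it is additionally assumed that f(x) ≤ ‖f‖_∞ for every x (supremum equals essential supremum); without this the claim fails, e.g. for f = K on one edge of the unit square, 1 on the rest of it, and 0 elsewhere. *)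

theory Defs
  imports "HOL-Analysis.Analysis" "HOL-Probability.Essential_Supremum"
    "HOL-Analysis.Finite_Function_Topology"
begin

text \<open>
  The constant in the theorem does not depend on the dimension, so the dimension has to be a
  bound variable and cannot be a type. All spaces \<open>R^n\<close> therefore live in the one real vector
  space of finitely supported sequences, and a function on \<open>R^n\<close> is only ever inspected on
  \<open>Rn n\<close>. The library notions \<^const>\<open>subspace\<close>, \<^const>\<open>span\<close> and \<^const>\<open>dim\<close> apply directly.
  The library norm on this type is not the Euclidean one and is not used.
\<close>

type_synonym seq = "nat \<Rightarrow>\<^sub>0 real"

definition Rn :: "nat \<Rightarrow> seq set" where
  "Rn n = {x. Poly_Mapping.keys x \<subseteq> {..<n}}"

definition dotp :: "nat \<Rightarrow> seq \<Rightarrow> seq \<Rightarrow> real" where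
  "dotp n x y = (\<Sum>i<n. Poly_Mapping.lookup x i * Poly_Mapping.lookup y i)"

text \<open>
  The completion matters: convex sets, hence level sets of \<open>\<alpha>\<close>-concave functions and their
  sections, are Lebesgue measurable but need not be Borel.
\<close>

definition lebesgue_Rn :: "nat \<Rightarrow> seq measure" where
  "lebesgue_Rn n = embed_measure (completion (Pi\<^sub>M {..<n} (\<lambda>_. lborel)))
     (\<lambda>u. \<Sum>i<n. u i *\<^sub>R Poly_Mapping.single i 1)"

definition orthonormal_basis :: "nat \<Rightarrow> seq set \<Rightarrow> (nat \<Rightarrow> seq) \<Rightarrow> bool" where
  "orthonormal_basis n H b \<longleftrightarrow>
     (\<forall>i<dim H. \<forall>j<dim H. dotp n (b i) (b j) = (if i = j then 1 else 0)) \<and>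
     span (b ` {..<dim H}) = H"

text \<open>
  Lebesgue measure of dimension \<open>dim H\<close> on the flat \<open>H + y\<close>, for a linear subspace \<open>H\<close> of \<open>R^n\<close>:
  the image of Lebesgue measure under an isometric parametrization. By rotation invariance it
  does not depend on the orthonormal basis; one exists by \<open>orthonormal_basis_exists\<close> below.
\<close>

definition flat_lebesgue :: "nat \<Rightarrow> seq set \<Rightarrow> seq \<Rightarrow> seq measure" where
  "flat_lebesgue n H y =
     (let b = (SOME b. orthonormal_basis n H b)
      in embed_measure (completion (Pi\<^sub>M {..<dim H} (\<lambda>_. lborel)))
           (\<lambda>u. y + (\<Sum>j<dim H. u j *\<^sub>R b j)))"

definition wmean :: "ereal \<Rightarrow> real \<Rightarrow> real \<Rightarrow> real \<Rightarrow> real" where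
  "wmean \<alpha> l a b =
     (if a * b = 0 then 0
      else if \<alpha> = \<infinity> then max a b
      else if \<alpha> = - \<infinity> then min a b
      else if \<alpha> = 0 then a powr (1 - l) * b powr l
      else ((1 - l) * a powr real_of_ereal \<alpha> + l * b powr real_of_ereal \<alpha>)
             powr (1 / real_of_ereal \<alpha>))"

definition umean :: "ereal \<Rightarrow> real \<Rightarrow> real \<Rightarrow> real" where
  "umean \<alpha> a b =
     (if a * b = 0 then 0
      else if \<alpha> = \<infinity> then max a b
      else if \<alpha> = - \<infinity> then min a b
      else if \<alpha> = 0 then a * b
      else (a powr real_of_ereal \<alpha> + b powr real_of_ereal \<alpha>) powr (1 / real_of_ereal \<alpha>))"

definition alpha_concave :: "nat \<Rightarrow> ereal \<Rightarrow> (seq \<Rightarrow> real) \<Rightarrow> bool" where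
  "alpha_concave n \<alpha> f \<longleftrightarrow>
     (\<forall>x\<in>Rn n. \<forall>y\<in>Rn n. \<forall>l\<in>{0..1}. f ((1 - l) *\<^sub>R x + l *\<^sub>R y) \<ge> wmean \<alpha> l (f x) (f y))"

definition alpha_difference :: "nat \<Rightarrow> ereal \<Rightarrow> (seq \<Rightarrow> real) \<Rightarrow> seq \<Rightarrow> ennreal" where
  "alpha_difference n \<alpha> f x =
     (SUP (x1, x2) \<in> {(x1, x2). x1 \<in> Rn n \<and> x2 \<in> Rn n \<and> x = x1 - x2}.
        ennreal (umean \<alpha> (f x1) (f x2)))"

text \<open>The value \<open>1/s\<close> for \<open>s \<le> 0\<close>. In \<^typ>\<open>ereal\<close>, \<open>1 / 0 = \<infinity>\<close>, which is the wrong sign here.\<close>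

definition recip_exponent :: "real \<Rightarrow> ereal" where
  "recip_exponent s = (if s = 0 then - \<infinity> else ereal (1 / s))"

text \<open>
  Only used for nonnegative bounded measurable functions, where it is a finite number.
  For \<open>\<alpha>\<close>-concave functions of nonzero norm with finite \<open>\<alpha> < 0\<close> it equals the pointwise
  supremum, but not for \<open>\<alpha> = -\<infinity>\<close>: on the plane let \<open>f\<close> be \<open>K > 1\<close> on the segment
  \<open>{1} \<times> [0,1]\<close>, \<open>1\<close> on the rest of the unit square, and \<open>0\<close> elsewhere. On the vertical line \<open>H\<close>
  its difference function integrates to \<open>2 K\<close>, while its level sets for \<open>t > 0\<close> are the square.
  An inequality between the two sides needs the pointwise bound by the norm in that case.
\<close>

definition sup_norm :: "nat \<Rightarrow> (seq \<Rightarrow> real) \<Rightarrow> real" where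
  "sup_norm n f = real_of_ereal (esssup (lebesgue_Rn n) (\<lambda>x. ereal (f x)))"

definition level_set :: "nat \<Rightarrow> (seq \<Rightarrow> real) \<Rightarrow> real \<Rightarrow> seq set" where
  "level_set n f t = {x \<in> Rn n. f x \<ge> t * sup_norm n f}"

definition psi :: "nat \<Rightarrow> nat \<Rightarrow> real" where
  "psi n m = min (real n / real m) (sqrt (real m))"

lemma dotp_commute: "dotp n x y = dotp n y x"
  by (simp add: dotp_def mult.commute)

lemma dotp_diff_left: "dotp n (x - z) y = dotp n x y - dotp n z y"
  by (simp add: dotp_def lookup_minus left_diff_distrib sum_subtractf)

lemma lookup_scaleR_seq: "Poly_Mapping.lookup (c *\<^sub>R (x::seq)) i = c * Poly_Mapping.lookup x i"
  by (simp add: scaleR_poly_mapping_def Poly_Mapping.map.rep_eq when_def)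

lemma dotp_scaleR_left: "dotp n (c *\<^sub>R x) y = c * dotp n x y"
  by (simp add: dotp_def lookup_scaleR_seq sum_distrib_left mult.assoc)

lemma dotp_zero_left: "dotp n 0 y = 0"
  by (simp add: dotp_def)

lemma dotp_add_left: "dotp n (x + z) y = dotp n x y + dotp n z y"
  by (simp add: dotp_def lookup_add distrib_right sum.distrib)

lemma dotp_sum_left: "dotp n (\<Sum>j\<in>A. g j) y = (\<Sum>j\<in>A. dotp n (g j) y)"
  by (induction A rule: infinite_finite_induct) (simp_all add: dotp_zero_left dotp_add_left)

lemma dotp_pos:
  assumes "x \<in> Rn n" "x \<noteq> 0"
  shows "dotp n x x > 0"
proof -
  obtain i where i: "Poly_Mapping.lookup x i \<noteq> 0"
    using assms(2) by (metis lookup_zero poly_mapping_eqI)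
  hence "i \<in> {..<n}" using assms(1) by (auto simp: Rn_def in_keys_iff)
  thus ?thesis unfolding dotp_def
    by (intro sum_pos2[of _ i]) (use i in \<open>auto simp: zero_less_mult_iff linorder_neq_iff\<close>)
qed

lemma orthonormal_independent:
  fixes k :: nat
  assumes "\<forall>i<k. \<forall>j<k. dotp n (b i) (b j) = (if i = j then 1 else 0)"
  shows "independent (b ` {..<k})" and "inj_on b {..<k}"
proof -
  show inj: "inj_on b {..<k}"
    by (rule inj_onI) (metis assms lessThan_iff zero_neq_one)
  show "independent (b ` {..<k})"
  proof (rule independent_if_scalars_zero)
    fix c x assume z: "(\<Sum>x\<in>b ` {..<k}. c x *\<^sub>R x) = 0" and "x \<in> b ` {..<k}"
    then obtain i where i: "i < k" "x = b i" by auto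
    have "0 = dotp n (\<Sum>j<k. c (b j) *\<^sub>R b j) (b i)"
      using z inj by (simp add: sum.reindex dotp_zero_left)
    also have "\<dots> = (\<Sum>j<k. if j = i then c (b j) else 0)"
      unfolding dotp_sum_left dotp_scaleR_left
      by (intro sum.cong refl) (use assms i in auto)
    also have "\<dots> = c x" using i by simp
    finally show "c x = 0" by simp
  qed auto
qed

lemma orthonormal_basis_exists:
  assumes "H \<subseteq> Rn n" "subspace H"
  shows "\<exists>b. orthonormal_basis n H b"
proof -
  let ?on = "\<lambda>k b. \<forall>i<k. \<forall>j<k. dotp n (b i) (b j) = (if i = j then 1 else 0)"
  have fin: "\<exists>B. finite B \<and> H \<subseteq> span B"
  proof (intro exI conjI)
    show "H \<subseteq> span ((\<lambda>i. Poly_Mapping.single i 1) ` {..<n})"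
    proof
      fix x assume "x \<in> H"
      hence k: "Poly_Mapping.keys x \<subseteq> {..<n}" using assms(1) by (auto simp: Rn_def)
      have "x = (\<Sum>i<n. Poly_Mapping.lookup x i *\<^sub>R Poly_Mapping.single i 1)"
      proof (rule poly_mapping_eqI)
        fix j
        show "Poly_Mapping.lookup x j =
          Poly_Mapping.lookup (\<Sum>i<n. Poly_Mapping.lookup x i *\<^sub>R Poly_Mapping.single i 1) j"
          using k by (auto simp: lookup_sum lookup_scaleR_seq lookup_single when_def
              if_distrib in_keys_iff cong: if_cong)
      qed
      also have "\<dots> \<in> span ((\<lambda>i. Poly_Mapping.single i 1) ` {..<n})"
        by (intro span_sum span_scale span_base) auto
      finally show "x \<in> span ((\<lambda>i. Poly_Mapping.single i 1) ` {..<n})" .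
    qed
  qed auto
  obtain B where B: "B \<subseteq> H" "independent B" "H \<subseteq> span B" "card B = dim H"
    by (rule basis_exists)
  have finB: "finite B"
    using fin B by (meson independent_span_bound order_trans)
  have step: "\<exists>b. (\<forall>i<k. b i \<in> H) \<and> ?on k b" if "k \<le> dim H" for k
    using that
  proof (induction k)
    case (Suc k)
    then obtain b where b: "\<forall>i<k. b i \<in> H" "?on k b" by auto
    have "\<exists>x\<in>H. x \<notin> span (b ` {..<k})"
    proof (rule ccontr)
      assume "\<not> ?thesis"
      hence "B \<subseteq> span (b ` {..<k})" using B(1) by auto
      hence "card B \<le> card (b ` {..<k})"
        using B(2) independent_span_bound[of "b ` {..<k}" B] by blast
      also have "\<dots> \<le> k" using card_image_le[of "{..<k}" b] by simp
      finally show False using B(4) Suc.prems by simp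
    qed
    then obtain x where x: "x \<in> H" "x \<notin> span (b ` {..<k})" by blast
    define p where "p = (\<Sum>j<k. dotp n x (b j) *\<^sub>R b j)"
    have p: "p \<in> H" unfolding p_def using b(1) assms(2)
      by (auto intro!: subspace_sum subspace_scale)
    have p': "p \<in> span (b ` {..<k})"
      unfolding p_def by (intro span_sum span_scale span_base) auto
    define v where "v = x - p"
    have v: "v \<in> H" "v \<noteq> 0"
      using x p p' assms(2) by (auto simp: v_def subspace_diff)
    have pos: "dotp n v v > 0" using v assms(1) by (auto intro: dotp_pos)
    have orth: "dotp n v (b i) = 0" if "i < k" for i
    proof -
      have "dotp n p (b i) = (\<Sum>j<k. if j = i then dotp n x (b j) else 0)"
        unfolding p_def dotp_sum_left dotp_scaleR_left
        by (intro sum.cong refl) (use b(2) that in auto)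
      also have "\<dots> = dotp n x (b i)" using that by simp
      finally show ?thesis by (simp add: v_def dotp_diff_left)
    qed
    define w where "w = (1 / sqrt (dotp n v v)) *\<^sub>R v"
    have w: "dotp n w w = 1" "w \<in> H"
    proof -
      have "dotp n w w = (1 / sqrt (dotp n v v)) * ((1 / sqrt (dotp n v v)) * dotp n v v)"
        unfolding w_def dotp_scaleR_left by (subst dotp_commute) (simp add: dotp_scaleR_left)
      thus "dotp n w w = 1" using pos by (simp add: field_simps)
      show "w \<in> H" unfolding w_def using v assms(2) by (simp add: subspace_scale)
    qed
    have worth: "dotp n w (b i) = 0" "dotp n (b i) w = 0" if "i < k" for i
      using orth[OF that] by (simp_all add: w_def dotp_scaleR_left dotp_commute[of n "b i"])
    have "?on (Suc k) (b(k := w))"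
      unfolding less_Suc_eq using b(2) w(1) worth by simp
    moreover have "\<forall>i<Suc k. (b(k := w)) i \<in> H"
      using b(1) w(2) by (simp add: less_Suc_eq)
    ultimately show ?case by blast
  qed simp
  obtain b where b: "\<forall>i<dim H. b i \<in> H" "?on (dim H) b" using step[of "dim H"] by blast
  note ind = orthonormal_independent[OF b(2)]
  have sub: "b ` {..<dim H} \<subseteq> H" using b(1) by auto
  have card: "card (b ` {..<dim H}) = dim H" using ind(2) by (simp add: card_image)
  have "H \<subseteq> span (b ` {..<dim H})"
  proof
    fix x assume x: "x \<in> H"
    show "x \<in> span (b ` {..<dim H})"
    proof (rule ccontr)
      assume n: "x \<notin> span (b ` {..<dim H})"
      hence "independent (insert x (b ` {..<dim H}))" using ind(1) by (rule independent_insertI)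
      moreover have "insert x (b ` {..<dim H}) \<subseteq> span B" using sub x B(3) by auto
      ultimately have "card (insert x (b ` {..<dim H})) \<le> card B"
        using independent_span_bound[OF finB] by blast
      moreover have "x \<notin> b ` {..<dim H}" using n by (auto intro: span_base)
      ultimately show False using card B(4) by (simp add: card_insert_if)
    qed
  qed
  moreover have "span (b ` {..<dim H}) \<subseteq> H" using sub assms(2) by (simp add: span_minimal)
  ultimately show ?thesis using b(2) unfolding orthonormal_basis_def by blast
qed

end

theory Submission
  imports Defs "HOL-Probability.Distributions"
begin

text \<open>
  For \<open>\<alpha> < 0\<close> the unweighted mean is at most the minimum, so the superlevel sets of the
  difference function lie in the difference sets of the superlevel sets of \<open>f\<close>. By the layer cake
  formula it remains to bound, for a convex set \<open>K\<close> and a measurable \<open>E \<subseteq> (K - K) \<inter> H\<close>, the volume of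
  \<open>E\<close> by the largest section of \<open>K\<close> parallel to \<open>H\<close> (Rudelson).

  The factor \<open>n / m\<close> comes from integrating \<open>vol (K \<inter> (K - x))\<close> over \<open>x \<in> H\<close>: the integral is at most
  \<open>vol K\<close> times the largest section, and on \<open>r E\<close> the integrand is at least \<open>(1 - r)\<^sup>n vol K\<close>;
  take \<open>r = m / (n + m)\<close>.

  For the factor \<open>sqrt m\<close>, write points \<open>x\<^sub>1, \<dots>, x\<^sub>m\<close> of \<open>E\<close> as \<open>a\<^sub>i - b\<^sub>i\<close>. The average of the segments
  \<open>[b\<^sub>i, a\<^sub>i]\<close> is a parallelepiped in \<open>K\<close>, parallel to \<open>H\<close>, of volume \<open>\<bar>det (x\<^sub>1, \<dots>, x\<^sub>m)\<bar> / m\<^sup>m\<close>. If \<open>E\<close>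
  is in isotropic position, then every subspace of dimension \<open>k\<close> misses some point of \<open>E\<close> by at least
  \<open>sqrt (m - k)\<close>, so a greedy choice gives a determinant of at least \<open>sqrt (m!)\<close>; and Jensen's
  inequality for the Gaussian integral over \<open>E\<close> bounds \<open>vol E\<close> by \<open>(2 \<pi> e)\<close> to the power \<open>m / 2\<close>.
  Determinants are avoided: the Gaussian integral of a linear map plays the role of the inverse
  determinant, and its multiplicativity follows from translation invariance and Fubini.
\<close>

section \<open>Lebesgue measure on the coordinate spaces\<close>

definition of_coords :: "nat \<Rightarrow> (nat \<Rightarrow> real) \<Rightarrow> seq" where
  "of_coords n u = (\<Sum>i<n. u i *\<^sub>R Poly_Mapping.single i 1)"

text \<open>This is \<open>lebesgue_Rn\<close> without the completion. Product measurability and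
  Fubini's theorem are used for this measure only; \<open>Lebesgue_sandwich\<close> carries the
  results over to Lebesgue measurable sets.\<close>

definition borel_Rn :: "nat \<Rightarrow> seq measure" where
  "borel_Rn n = embed_measure (Pi\<^sub>M {..<n} (\<lambda>_. lborel)) (of_coords n)"

abbreviation "lk \<equiv> Poly_Mapping.lookup"

lemma lookup_of_coords: "lk (of_coords n u) i = (if i < n then u i else 0)"
  by (auto simp: of_coords_def lookup_sum lookup_scaleR_seq lookup_single when_def
              if_distrib cong: if_cong)

lemma of_coords_in_Rn [simp]: "of_coords n u \<in> Rn n"
  by (auto simp: Rn_def in_keys_iff lookup_of_coords split: if_splits)

lemma lookup_Rn: "x \<in> Rn n \<Longrightarrow> \<not> i < n \<Longrightarrow> lk x i = 0"
  by (auto simp: Rn_def in_keys_iff)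

lemma Rn_eqI: "x \<in> Rn n \<Longrightarrow> y \<in> Rn n \<Longrightarrow> (\<And>i. i < n \<Longrightarrow> lk x i = lk y i) \<Longrightarrow> x = y"
  by (metis lookup_Rn poly_mapping_eqI)

lemma of_coords_lookup: "x \<in> Rn n \<Longrightarrow> of_coords n (lk x) = x"
  by (rule Rn_eqI[of _ n]) (auto simp: lookup_of_coords)

lemma subspace_Rn: "subspace (Rn n)"
  by (auto simp: subspace_def Rn_def subset_eq in_keys_iff lookup_add lookup_scaleR_seq)

lemmas Rn_closed [simp, intro] =
  subspace_add[OF subspace_Rn] subspace_diff[OF subspace_Rn] subspace_scale[OF subspace_Rn]
  subspace_neg[OF subspace_Rn] subspace_sum[OF subspace_Rn] subspace_0[OF subspace_Rn]

lemma inj_on_of_coords: "inj_on (of_coords n) (space (Pi\<^sub>M {..<n} (\<lambda>_. lborel)))"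
proof (rule inj_onI)
  fix u v assume uv: "u \<in> space (Pi\<^sub>M {..<n} (\<lambda>_. lborel))" "v \<in> space (Pi\<^sub>M {..<n} (\<lambda>_. lborel))"
    and eq: "of_coords n u = of_coords n v"
  show "u = v"
  proof
    fix i show "u i = v i"
      using uv eq lookup_of_coords[of n u i] lookup_of_coords[of n v i]
      by (cases "i < n") (auto simp: space_PiM PiE_def extensional_def)
  qed
qed

lemma of_coords_image: "of_coords n ` space (Pi\<^sub>M {..<n} (\<lambda>_. lborel)) = Rn n"
proof safe
  fix x assume x: "x \<in> Rn n"
  have "x = of_coords n (restrict (lk x) {..<n})"
    by (rule Rn_eqI[OF x]) (auto simp: lookup_of_coords)
  thus "x \<in> of_coords n ` space (Pi\<^sub>M {..<n} (\<lambda>_. lborel))"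
    by (intro image_eqI) (auto simp: space_PiM split: if_splits)
qed auto

lemma space_borel_Rn [simp]: "space (borel_Rn n) = Rn n"
  by (simp add: borel_Rn_def space_embed_measure of_coords_image)

lemma measurable_of_coords [measurable]:
  "of_coords n \<in> (Pi\<^sub>M {..<n} (\<lambda>_. lborel)) \<rightarrow>\<^sub>M borel_Rn n"
  unfolding borel_Rn_def by (rule measurable_embed_measure2'[OF inj_on_of_coords])

lemma measurable_borel_RnI:
  assumes "\<And>x. x \<in> space M \<Longrightarrow> g x \<in> Rn n"
    and "\<And>i. i < n \<Longrightarrow> (\<lambda>x. lk (g x) i) \<in> borel_measurable M"
  shows "g \<in> M \<rightarrow>\<^sub>M borel_Rn n"
proof -
  have "(\<lambda>x. of_coords n (\<lambda>i\<in>{..<n}. lk (g x) i)) \<in> M \<rightarrow>\<^sub>M borel_Rn n"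
    by (rule measurable_compose[OF _ measurable_of_coords])
       (auto intro!: measurable_restrict assms(2))
  moreover have "of_coords n (\<lambda>i\<in>{..<n}. lk (g x) i) = g x" if "x \<in> space M" for x
    using assms(1)[OF that] by (intro Rn_eqI[of _ n]) (auto simp: lookup_of_coords)
  ultimately show ?thesis by (simp cong: measurable_cong)
qed

lemma measurable_lookup [measurable]: "(\<lambda>x. lk x i) \<in> borel_measurable (borel_Rn n)"
proof (cases "i < n")
  case True
  then show ?thesis unfolding borel_Rn_def
    by (intro measurable_embed_measure1) (simp add: lookup_of_coords)
next
  case False
  have "(\<lambda>x. 0 :: real) \<in> borel_measurable (borel_Rn n)" by simp
  with False show ?thesis by (subst measurable_cong[where g="\<lambda>_. 0"]) (auto simp: lookup_Rn)
qed

lemma measurable_lookup' [measurable (raw)]: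
  "g \<in> M \<rightarrow>\<^sub>M borel_Rn n \<Longrightarrow> (\<lambda>x. lk (g x) i) \<in> borel_measurable M"
  by (rule measurable_compose[OF _ measurable_lookup])

lemma measurable_add_Rn [measurable (raw)]:
  assumes g: "g \<in> M \<rightarrow>\<^sub>M borel_Rn n" and h: "h \<in> M \<rightarrow>\<^sub>M borel_Rn n"
  shows "(\<lambda>x. g x + h x) \<in> M \<rightarrow>\<^sub>M borel_Rn n"
  using measurable_space[OF g] measurable_space[OF h]
  by (intro measurable_borel_RnI) (auto simp: lookup_add intro!: measurable_lookup' borel_measurable_add g h)

lemma measurable_scaleR_Rn [measurable (raw)]:
  assumes g: "g \<in> M \<rightarrow>\<^sub>M borel_Rn n" and h: "h \<in> borel_measurable M"
  shows "(\<lambda>x. h x *\<^sub>R g x) \<in> M \<rightarrow>\<^sub>M borel_Rn n"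
  using measurable_space[OF g]
  by (intro measurable_borel_RnI)
     (auto simp: lookup_scaleR_seq intro!: measurable_lookup' borel_measurable_times g h)

lemma measurable_diff_Rn [measurable (raw)]:
  assumes g: "g \<in> M \<rightarrow>\<^sub>M borel_Rn n" and h: "h \<in> M \<rightarrow>\<^sub>M borel_Rn n"
  shows "(\<lambda>x. g x - h x) \<in> M \<rightarrow>\<^sub>M borel_Rn n"
  using measurable_add_Rn[OF g measurable_scaleR_Rn[OF h, of "\<lambda>_. -1"]] by simp

lemma measurable_sum_Rn [measurable (raw)]:
  assumes g: "\<And>i. i \<in> I \<Longrightarrow> g i \<in> M \<rightarrow>\<^sub>M borel_Rn n"
  shows "(\<lambda>x. \<Sum>i\<in>I. g i x) \<in> M \<rightarrow>\<^sub>M borel_Rn n"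
  using g by (induction I rule: infinite_finite_induct) (auto intro!: measurable_add_Rn)

interpretation lborel_prod: product_sigma_finite "\<lambda>_::nat. lborel :: real measure"
  by standard

lemma nn_integral_borel_Rn:
  assumes "f \<in> borel_measurable (borel_Rn n)"
  shows "(\<integral>\<^sup>+x. f x \<partial>borel_Rn n) = (\<integral>\<^sup>+u. f (of_coords n u) \<partial>Pi\<^sub>M {..<n} (\<lambda>_. lborel))"
  using assms unfolding borel_Rn_def by (rule nn_integral_embed_measure'[OF inj_on_of_coords])

lemma emeasure_borel_Rn:
  assumes "A \<in> sets (borel_Rn n)"
  shows "emeasure (borel_Rn n) A
    = emeasure (Pi\<^sub>M {..<n} (\<lambda>_. lborel)) (of_coords n -` A \<inter> space (Pi\<^sub>M {..<n} (\<lambda>_. lborel)))"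
  using assms unfolding borel_Rn_def by (intro emeasure_embed_measure'[OF inj_on_of_coords])

lemma sigma_finite_borel_Rn: "sigma_finite_measure (borel_Rn n)"
proof
  let ?P = "Pi\<^sub>M {..<n} (\<lambda>_. lborel :: real measure)"
  interpret P: sigma_finite_measure ?P by (rule lborel_prod.sigma_finite) simp
  obtain C where C: "countable C" "C \<subseteq> sets ?P" "\<Union>C = space ?P"
     "\<And>a. a \<in> C \<Longrightarrow> emeasure ?P a \<noteq> \<infinity>" using P.sigma_finite_countable by blast
  have "emeasure (borel_Rn n) (of_coords n ` a) \<noteq> \<infinity>" if "a \<in> C" for a
    using C(2,4) that unfolding borel_Rn_def
    by (subst emeasure_embed_measure_image'[OF inj_on_of_coords]) auto
  moreover have "of_coords n ` a \<in> sets (borel_Rn n)" if "a \<in> C" for a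
    using C(2) that unfolding borel_Rn_def by (auto intro: in_sets_embed_measure)
  moreover have "\<Union>((`) (of_coords n) ` C) = space (borel_Rn n)"
    using C(3) of_coords_image[of n] by (auto simp flip: image_Union)
  ultimately show "\<exists>A. countable A \<and> A \<subseteq> sets (borel_Rn n) \<and> \<Union>A = space (borel_Rn n)
      \<and> (\<forall>a\<in>A. emeasure (borel_Rn n) a \<noteq> \<infinity>)"
    using C(1) by (intro exI[of _ "(`) (of_coords n) ` C"]) auto
qed

text \<open>A product measure is determined by its values on boxes, and a translation pulls a box
  back to a box with translated sides.\<close>

lemma distr_PiM_translate:
  assumes "finite I"
  shows "distr (Pi\<^sub>M I (\<lambda>_. lborel)) (Pi\<^sub>M I (\<lambda>_. lborel :: real measure))
           (\<lambda>u. \<lambda>i\<in>I. v i + u i) = Pi\<^sub>M (I::nat set) (\<lambda>_. lborel)"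
proof (rule lborel_prod.PiM_eqI[OF assms])
  fix A assume A: "\<And>i. i \<in> I \<Longrightarrow> A i \<in> sets (lborel :: real measure)"
  let ?P = "Pi\<^sub>M I (\<lambda>_. lborel :: real measure)" and ?t = "\<lambda>u. \<lambda>i\<in>I. v i + u i"
  have t: "?t \<in> ?P \<rightarrow>\<^sub>M ?P" by (intro measurable_restrict) simp
  have "emeasure (distr ?P ?P ?t) (Pi\<^sub>E I A) = emeasure ?P (?t -` Pi\<^sub>E I A \<inter> space ?P)"
    using t A assms by (intro emeasure_distr) (auto intro!: sets_PiM_I_finite)
  also have "?t -` Pi\<^sub>E I A \<inter> space ?P = Pi\<^sub>E I (\<lambda>i. (+) (v i) -` A i)"
    by (auto simp: space_PiM PiE_def Pi_def extensional_def split: if_splits)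
  also have "emeasure ?P \<dots> = (\<Prod>i\<in>I. emeasure lborel ((+) (v i) -` A i))"
    using A by (intro lborel_prod.emeasure_PiM[OF assms])
       (auto intro!: measurable_sets_borel[where M=borel])
  also have "\<dots> = (\<Prod>i\<in>I. emeasure lborel (A i))"
  proof (rule prod.cong)
    fix i assume "i \<in> I"
    hence "emeasure (distr lborel borel ((+) (v i))) (A i) = emeasure lborel ((+) (v i) -` A i \<inter> space lborel)"
      using A by (intro emeasure_distr) auto
    thus "emeasure lborel ((+) (v i) -` A i) = emeasure lborel (A i)"
      by (simp add: lborel_distr_plus)
  qed simp
  finally show "emeasure (distr ?P ?P ?t) (Pi\<^sub>E I A) = (\<Prod>i\<in>I. emeasure lborel (A i))" .
qed simp

lemma nn_integral_translate:
  assumes [measurable]: "f \<in> borel_measurable (borel_Rn n)" and v: "v \<in> Rn n"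
  shows "(\<integral>\<^sup>+x. f (v + x) \<partial>borel_Rn n) = (\<integral>\<^sup>+x. f x \<partial>borel_Rn n)"
proof -
  let ?P = "Pi\<^sub>M {..<n} (\<lambda>_. lborel :: real measure)" and ?t = "\<lambda>u. \<lambda>i\<in>{..<n}. lk v i + u i"
  have t [measurable]: "?t \<in> ?P \<rightarrow>\<^sub>M ?P" by (intro measurable_restrict) simp
  have [measurable]: "(\<lambda>x. v + x) \<in> borel_Rn n \<rightarrow>\<^sub>M borel_Rn n"
    using v by (intro measurable_add_Rn) auto
  have "(\<integral>\<^sup>+x. f (v + x) \<partial>borel_Rn n) = (\<integral>\<^sup>+u. f (v + of_coords n u) \<partial>?P)"
    by (rule nn_integral_borel_Rn) simp
  also have "\<dots> = (\<integral>\<^sup>+u. f (of_coords n (?t u)) \<partial>?P)"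
  proof (intro nn_integral_cong arg_cong[where f=f])
    fix u show "v + of_coords n u = of_coords n (?t u)"
      using v by (intro Rn_eqI[of _ n]) (auto simp: lookup_of_coords lookup_add)
  qed
  also have "\<dots> = (\<integral>\<^sup>+u. f (of_coords n u) \<partial>distr ?P ?P ?t)"
    by (subst nn_integral_distr[OF t]) simp_all
  also have "\<dots> = (\<integral>\<^sup>+u. f (of_coords n u) \<partial>?P)"
    by (subst distr_PiM_translate) simp_all
  also have "\<dots> = (\<integral>\<^sup>+x. f x \<partial>borel_Rn n)"
    by (rule nn_integral_borel_Rn[symmetric]) simp
  finally show ?thesis .
qed

section \<open>Linear changes of variables\<close>

text \<open>A change of variables without determinants: the ratio of the integrals of
  \<open>f (c + X u)\<close> and \<open>f y\<close> does not depend on \<open>f\<close>. Both sides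
  evaluate the double integral of \<open>f (y + X u) * g y\<close>. The product form also covers
  zero and infinite integrals.\<close>

lemma nn_integral_linear_change:
  assumes X: "linear X" "X \<in> borel_Rn n \<rightarrow>\<^sub>M borel_Rn n" "Rn n \<subseteq> X ` Rn n" and c: "c \<in> Rn n"
    and f [measurable]: "f \<in> borel_measurable (borel_Rn n)"
    and g [measurable]: "g \<in> borel_measurable (borel_Rn n)" and even: "\<And>x. g (- x) = g x"
  shows "(\<integral>\<^sup>+u. f (c + X u) \<partial>borel_Rn n) * (\<integral>\<^sup>+y. g y \<partial>borel_Rn n)
       = (\<integral>\<^sup>+y. f y \<partial>borel_Rn n) * (\<integral>\<^sup>+u. g (X u) \<partial>borel_Rn n)"
proof -
  let ?L = "borel_Rn n"
  note [measurable] = X(2)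
  interpret sigma_finite_measure ?L by (rule sigma_finite_borel_Rn)
  interpret LL: pair_sigma_finite ?L ?L by standard
  have XR: "X u \<in> Rn n" if "u \<in> Rn n" for u using measurable_space[OF X(2), of u] that by simp
  \<comment> \<open>Surjectivity of \<open>X\<close> turns a shift of the value by \<open>y\<close>
    into a shift of the argument \<open>u\<close>, which the measure does not see.\<close>
  have shift: "(\<integral>\<^sup>+u. h (y + X u) \<partial>?L) = (\<integral>\<^sup>+u. h (X u) \<partial>?L)"
    if y: "y \<in> Rn n" and h [measurable]: "h \<in> borel_measurable ?L" for y and h :: "seq \<Rightarrow> ennreal"
  proof -
    obtain v where v: "v \<in> Rn n" "y = X v" using X(3) y by auto
    have "(\<integral>\<^sup>+u. h (X (v + u)) \<partial>?L) = (\<integral>\<^sup>+u. h (X u) \<partial>?L)"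
      using nn_integral_translate[of "\<lambda>u. h (X u)" n v] v by simp
    thus ?thesis using v by (simp add: linear_add[OF X(1)])
  qed
  have "(\<integral>\<^sup>+u. f (c + X u) \<partial>?L) * (\<integral>\<^sup>+y. g y \<partial>?L) = (\<integral>\<^sup>+y. (\<integral>\<^sup>+u. f (X u) \<partial>?L) * g y \<partial>?L)"
    by (simp add: shift c nn_integral_cmult)
  \<comment> \<open>The inner integral is the same for every shift, so \<open>y\<close> is inserted
    to couple the two integrals before exchanging them.\<close>
  also have "\<dots> = (\<integral>\<^sup>+y. (\<integral>\<^sup>+u. f (y + X u) \<partial>?L) * g y \<partial>?L)"
    by (intro nn_integral_cong) (simp add: shift)
  also have "\<dots> = (\<integral>\<^sup>+y. (\<integral>\<^sup>+u. f (y + X u) * g y \<partial>?L) \<partial>?L)"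
    by (intro nn_integral_cong nn_integral_multc[symmetric]) measurable
  also have "\<dots> = (\<integral>\<^sup>+u. (\<integral>\<^sup>+y. f (y + X u) * g y \<partial>?L) \<partial>?L)"
    by (rule LL.Fubini') measurable
  also have "\<dots> = (\<integral>\<^sup>+u. (\<integral>\<^sup>+y. f y * g (y - X u) \<partial>?L) \<partial>?L)"
  proof (rule nn_integral_cong)
    fix u assume u: "u \<in> space ?L"
    hence [measurable]: "(\<lambda>_. X u) \<in> ?L \<rightarrow>\<^sub>M ?L" using XR by simp
    show "(\<integral>\<^sup>+y. f (y + X u) * g y \<partial>?L) = (\<integral>\<^sup>+y. f y * g (y - X u) \<partial>?L)"
      using nn_integral_translate[of "\<lambda>y. f (y + X u) * g y" n "- X u"] XR[of u] u
      by simp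
  qed
  also have "\<dots> = (\<integral>\<^sup>+y. (\<integral>\<^sup>+u. f y * g (y - X u) \<partial>?L) \<partial>?L)"
    by (rule LL.Fubini') measurable
  also have "\<dots> = (\<integral>\<^sup>+y. f y * (\<integral>\<^sup>+u. g (X u) \<partial>?L) \<partial>?L)"
  proof (rule nn_integral_cong)
    fix y assume y: "y \<in> space ?L"
    hence [measurable]: "(\<lambda>_. y) \<in> ?L \<rightarrow>\<^sub>M ?L" by simp
    have "(\<integral>\<^sup>+u. f y * g (y - X u) \<partial>?L) = f y * (\<integral>\<^sup>+u. g (y - X u) \<partial>?L)"
      by (rule nn_integral_cmult) measurable
    \<comment> \<open>Evenness of \<open>g\<close> gives \<open>X u\<close> a positive sign, the
      form that \<open>shift\<close> handles.\<close>
    also have "(\<integral>\<^sup>+u. g (y - X u) \<partial>?L) = (\<integral>\<^sup>+u. g (- y + X u) \<partial>?L)"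
    proof (rule nn_integral_cong)
      fix u show "g (y - X u) = g (- y + X u)" using even[of "y - X u"] by (simp add: algebra_simps)
    qed
    also have "\<dots> = (\<integral>\<^sup>+u. g (X u) \<partial>?L)" using y by (intro shift) auto
    finally show "(\<integral>\<^sup>+u. f y * g (y - X u) \<partial>?L) = f y * (\<integral>\<^sup>+u. g (X u) \<partial>?L)" .
  qed
  also have "\<dots> = (\<integral>\<^sup>+y. f y \<partial>?L) * (\<integral>\<^sup>+u. g (X u) \<partial>?L)"
    by (rule nn_integral_multc) measurable
  finally show ?thesis .
qed

section \<open>Gaussian integrals and scaling\<close>

lemma nn_integral_gauss_affine:
  assumes "r > 0"
  shows "(\<integral>\<^sup>+x. ennreal (exp (- (r * x + s)\<^sup>2 / 2)) \<partial>lborel) = ennreal (sqrt (2 * pi) / r)"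
proof -
  have *: "exp (- (r * x + s)\<^sup>2 / 2) = (sqrt (2 * pi) / r) * normal_density (- s / r) (1 / r) x" for x
  proof -
    have "- (x - (- s / r))\<^sup>2 / (2 * (1 / r)\<^sup>2) = - (r * x + s)\<^sup>2 / 2"
      using assms by (simp add: field_simps power2_eq_square)
    moreover have "sqrt (2 * pi * (1 / r)\<^sup>2) = sqrt (2 * pi) / r"
      using assms by (simp add: real_sqrt_mult real_sqrt_divide power_divide)
    ultimately show ?thesis using assms by (simp add: normal_density_def)
  qed
  have "(\<integral>\<^sup>+x. ennreal (exp (- (r * x + s)\<^sup>2 / 2)) \<partial>lborel)
      = (\<integral>\<^sup>+x. ennreal (sqrt (2 * pi) / r) * ennreal (normal_density (- s / r) (1 / r) x) \<partial>lborel)"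
    unfolding * using assms by (intro nn_integral_cong ennreal_mult) auto
  also have "\<dots> = ennreal (sqrt (2 * pi) / r)"
    using assms by (simp add: nn_integral_cmult nn_integral_eq_integral)
  finally show ?thesis .
qed

text \<open>Fixing the last variable turns its coefficients into new shifts of the earlier rows, and
  the inner integral does not depend on the shifts; hence the induction runs over arbitrary
  \<open>s\<close>. The product of the diagonal entries is the determinant of the triangular
  matrix.\<close>

lemma nn_integral_gauss_triangular:
  fixes r :: "nat \<Rightarrow> nat \<Rightarrow> real"
  assumes "\<And>j. j < m \<Longrightarrow> r j j > 0"
  shows "(\<integral>\<^sup>+u. ennreal (exp (- (\<Sum>j<m. ((\<Sum>i\<in>{j..<m}. r i j * u i) + s j)\<^sup>2) / 2))
            \<partial>Pi\<^sub>M {..<m} (\<lambda>_. lborel)) = ennreal (sqrt (2 * pi) ^ m / (\<Prod>j<m. r j j))"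
  using assms
proof (induction m arbitrary: s)
  case 0
  show ?case by (simp add: lborel_prod.nn_integral_empty PiM_empty)
next
  case (Suc m)
  let ?Q = "\<lambda>m s u. - (\<Sum>j<m. ((\<Sum>i\<in>{j..<m}. r i j * u i) + s j)\<^sup>2) / 2 :: real"
  have meas: "(\<lambda>u. ennreal (exp (?Q k s u))) \<in> borel_measurable (Pi\<^sub>M {..<k} (\<lambda>_. lborel))"
    for k and s :: "nat \<Rightarrow> real"
  proof -
    have "(\<lambda>u. \<Sum>i\<in>{j..<k}. r i j * u i) \<in> borel_measurable (Pi\<^sub>M {..<k} (\<lambda>_. lborel))" for j
      by (intro borel_measurable_sum borel_measurable_times borel_measurable_const) simp
    thus ?thesis by measurable
  qed
  have split: "?Q (Suc m) s (u(m := y)) = ?Q m (\<lambda>j. r m j * y + s j) u + (- (r m m * y + s m)\<^sup>2 / 2)"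
    for u y
  proof -
    have "(\<Sum>i\<in>{j..<Suc m}. r i j * (u(m := y)) i) + s j
      = (\<Sum>i\<in>{j..<m}. r i j * u i) + (r m j * y + s j)" if "j \<le> m" for j
    proof -
      have "{j..<Suc m} = insert m {j..<m}" using that by auto
      thus ?thesis by (auto simp: intro!: sum.cong)
    qed
    thus ?thesis by (simp add: field_simps)
  qed
  have "(\<integral>\<^sup>+u. ennreal (exp (?Q (Suc m) s u)) \<partial>Pi\<^sub>M {..<Suc m} (\<lambda>_. lborel))
     = (\<integral>\<^sup>+y. (\<integral>\<^sup>+u. ennreal (exp (?Q (Suc m) s (u(m := y)))) \<partial>Pi\<^sub>M {..<m} (\<lambda>_. lborel)) \<partial>lborel)"
  proof -
    define F where "F = (\<lambda>u. ennreal (exp (?Q (Suc m) s u)))"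
    have "F \<in> borel_measurable (Pi\<^sub>M (insert m {..<m}) (\<lambda>_. lborel))"
      unfolding F_def lessThan_Suc[symmetric] by (rule meas)
    hence "(\<integral>\<^sup>+u. F u \<partial>Pi\<^sub>M (insert m {..<m}) (\<lambda>_. lborel))
      = (\<integral>\<^sup>+y. (\<integral>\<^sup>+u. F (u(m := y)) \<partial>Pi\<^sub>M {..<m} (\<lambda>_. lborel)) \<partial>lborel)"
      by (intro lborel_prod.product_nn_integral_insert_rev) auto
    thus ?thesis unfolding lessThan_Suc[symmetric] F_def .
  qed
  also have "\<dots> = (\<integral>\<^sup>+y. (\<integral>\<^sup>+u. ennreal (exp (?Q m (\<lambda>j. r m j * y + s j) u)) *
       ennreal (exp (- (r m m * y + s m)\<^sup>2 / 2)) \<partial>Pi\<^sub>M {..<m} (\<lambda>_. lborel)) \<partial>lborel)"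
    unfolding split exp_add by (intro nn_integral_cong ennreal_mult) auto
  also have "\<dots> = (\<integral>\<^sup>+y. (\<integral>\<^sup>+u. ennreal (exp (?Q m (\<lambda>j. r m j * y + s j) u)) \<partial>Pi\<^sub>M {..<m} (\<lambda>_. lborel)) *
       ennreal (exp (- (r m m * y + s m)\<^sup>2 / 2)) \<partial>lborel)"
    by (rule nn_integral_cong, rule nn_integral_multc[OF meas])
  also have "\<dots> = (\<integral>\<^sup>+y. ennreal (sqrt (2 * pi) ^ m / (\<Prod>j<m. r j j)) *
       ennreal (exp (- (r m m * y + s m)\<^sup>2 / 2)) \<partial>lborel)"
    using Suc.IH[OF Suc.prems] by (simp only: less_SucI)
  also have "\<dots> = ennreal (sqrt (2 * pi) ^ m / (\<Prod>j<m. r j j)) * ennreal (sqrt (2 * pi) / r m m)"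
    unfolding nn_integral_gauss_affine[OF Suc.prems[OF lessI], of "s m", symmetric]
    by (rule nn_integral_cmult) measurable
  also have "\<dots> = ennreal (sqrt (2 * pi) ^ Suc m / (\<Prod>j<Suc m. r j j))"
  proof -
    have "0 < (\<Prod>j<m. r j j)" by (intro prod_pos ballI Suc.prems) simp
    hence "0 \<le> sqrt (2 * pi) ^ m / (\<Prod>j<m. r j j)" "0 \<le> sqrt (2 * pi) / r m m"
      using Suc.prems[of m] by simp_all
    from ennreal_mult[OF this] show ?thesis by (simp add: mult.commute)
  qed
  finally show ?case .
qed

text \<open>The unnormalised standard Gaussian density. Being even, with a positive finite integral,
  it is the reference function for \<open>nn_integral_linear_change\<close>.\<close>

definition gauss :: "nat \<Rightarrow> seq \<Rightarrow> ennreal" where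
  "gauss n x = ennreal (exp (- dotp n x x / 2))"

lemma measurable_gauss [measurable]: "gauss n \<in> borel_measurable (borel_Rn n)"
  unfolding gauss_def dotp_def by measurable

lemma gauss_minus: "gauss n (- x) = gauss n x"
  by (simp add: gauss_def dotp_def)

text \<open>The diagonal case of \<open>nn_integral_gauss_triangular\<close>.\<close>

lemma nn_integral_gauss_scale:
  assumes "r > 0"
  shows "(\<integral>\<^sup>+x. gauss n (r *\<^sub>R x) \<partial>borel_Rn n) = ennreal (sqrt (2 * pi) ^ n / r ^ n)"
proof -
  let ?r = "\<lambda>i j. if i = j then r else 0"
  have "(\<integral>\<^sup>+x. gauss n (r *\<^sub>R x) \<partial>borel_Rn n)
      = (\<integral>\<^sup>+u. gauss n (r *\<^sub>R of_coords n u) \<partial>Pi\<^sub>M {..<n} (\<lambda>_. lborel))"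
    by (rule nn_integral_borel_Rn) measurable
  also have "\<dots> = (\<integral>\<^sup>+u. ennreal (exp (- (\<Sum>j<n. ((\<Sum>i\<in>{j..<n}. ?r i j * u i) + 0)\<^sup>2) / 2))
            \<partial>Pi\<^sub>M {..<n} (\<lambda>_. lborel))"
    by (intro nn_integral_cong) (simp add: gauss_def dotp_def lookup_scaleR_seq lookup_of_coords power2_eq_square
        if_distrib[of "\<lambda>x. x * _"] cong: if_cong)
  also have "\<dots> = ennreal (sqrt (2 * pi) ^ n / r ^ n)"
    using assms by (subst nn_integral_gauss_triangular) auto
  finally show ?thesis .
qed

lemma nn_integral_gauss: "(\<integral>\<^sup>+x. gauss n x \<partial>borel_Rn n) = ennreal (sqrt (2 * pi) ^ n)"
  using nn_integral_gauss_scale[of 1 n] by simp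

lemma ennreal_mult_cancel_pos:
  fixes a b :: ennreal and c :: real
  assumes "a * ennreal c = b * ennreal c" "c > 0" shows "a = b"
proof -
  have "ennreal c * ennreal (1 / c) = 1"
    using assms(2) by (subst ennreal_mult[symmetric]) auto
  hence "x * ennreal c * ennreal (1 / c) = x" for x
    by (simp only: mult.assoc mult_1_right)
  with assms(1) show ?thesis by metis
qed

text \<open>Comparison of \<open>f\<close> with the Gaussian in
  \<open>nn_integral_linear_change\<close>, where \<open>X\<close> is multiplication by
  \<open>r\<close>.\<close>

lemma nn_integral_scale:
  assumes f [measurable]: "f \<in> borel_measurable (borel_Rn n)" and c: "c \<in> Rn n" and r: "r > 0"
  shows "(\<integral>\<^sup>+x. f (c + r *\<^sub>R x) \<partial>borel_Rn n) * ennreal (r ^ n) = (\<integral>\<^sup>+x. f x \<partial>borel_Rn n)"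
proof -
  have surj: "Rn n \<subseteq> (\<lambda>x. r *\<^sub>R x) ` Rn n"
  proof
    fix x assume "x \<in> Rn n"
    thus "x \<in> (\<lambda>x. r *\<^sub>R x) ` Rn n" using r by (intro image_eqI[of _ _ "(1/r) *\<^sub>R x"]) auto
  qed
  have "(\<integral>\<^sup>+u. f (c + r *\<^sub>R u) \<partial>borel_Rn n) * (\<integral>\<^sup>+y. gauss n y \<partial>borel_Rn n)
       = (\<integral>\<^sup>+y. f y \<partial>borel_Rn n) * (\<integral>\<^sup>+u. gauss n (r *\<^sub>R u) \<partial>borel_Rn n)"
    using surj by (intro nn_integral_linear_change c gauss_minus linear_scaleR f measurable_gauss) measurable
  hence "(\<integral>\<^sup>+u. f (c + r *\<^sub>R u) \<partial>borel_Rn n) * ennreal (sqrt (2 * pi) ^ n)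
       = (\<integral>\<^sup>+y. f y \<partial>borel_Rn n) * ennreal (sqrt (2 * pi) ^ n / r ^ n)"
    using r by (simp add: nn_integral_gauss nn_integral_gauss_scale)
  hence "(\<integral>\<^sup>+u. f (c + r *\<^sub>R u) \<partial>borel_Rn n) * ennreal (sqrt (2 * pi) ^ n) * ennreal (r ^ n)
       = (\<integral>\<^sup>+y. f y \<partial>borel_Rn n) * (ennreal (sqrt (2 * pi) ^ n / r ^ n) * ennreal (r ^ n))"
    by (simp add: mult.assoc)
  also have "ennreal (sqrt (2 * pi) ^ n / r ^ n) * ennreal (r ^ n) = ennreal (sqrt (2 * pi) ^ n)"
    using r by (subst ennreal_mult[symmetric]) auto
  finally have "(\<integral>\<^sup>+u. f (c + r *\<^sub>R u) \<partial>borel_Rn n) * ennreal (r ^ n) * ennreal (sqrt (2 * pi) ^ n)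
      = (\<integral>\<^sup>+y. f y \<partial>borel_Rn n) * ennreal (sqrt (2 * pi) ^ n)"
    by (simp add: ac_simps)
  thus ?thesis by (rule ennreal_mult_cancel_pos) simp
qed

lemma emeasure_affine_image:
  assumes A [measurable]: "A \<in> sets (borel_Rn n)" and c: "c \<in> Rn n" and r: "r > 0"
  shows "(\<lambda>x. c + r *\<^sub>R x) ` A \<in> sets (borel_Rn n)"
    and "emeasure (borel_Rn n) ((\<lambda>x. c + r *\<^sub>R x) ` A) = ennreal (r ^ n) * emeasure (borel_Rn n) A"
proof -
  let ?L = "borel_Rn n" and ?S = "(\<lambda>x. c + r *\<^sub>R x) ` A"
  have AR: "A \<subseteq> Rn n" using sets.sets_into_space[OF A] by simp
  have [measurable]: "(\<lambda>_. c) \<in> ?L \<rightarrow>\<^sub>M ?L" using c by simp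
  have eq: "?S = (\<lambda>x. (1/r) *\<^sub>R (x - c)) -` A \<inter> space ?L"
  proof safe
    fix x assume "(1 / r) *\<^sub>R (x - c) \<in> A" "x \<in> space ?L"
    thus "x \<in> ?S" using r by (intro image_eqI[of _ _ "(1/r) *\<^sub>R (x - c)"]) auto
  qed (use AR r c in auto)
  show S [measurable]: "?S \<in> sets ?L"
    unfolding eq by (rule measurable_sets[OF _ A]) measurable
  have "emeasure ?L ?S = (\<integral>\<^sup>+x. indicator ?S x \<partial>?L)" by simp
  also have "\<dots> = (\<integral>\<^sup>+x. indicator ?S (c + r *\<^sub>R x) \<partial>?L) * ennreal (r ^ n)"
    by (rule nn_integral_scale[symmetric]) (use c r in auto)
  also have "(\<integral>\<^sup>+x. indicator ?S (c + r *\<^sub>R x) \<partial>?L) = (\<integral>\<^sup>+x. indicator A x \<partial>?L)"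
    by (intro nn_integral_cong) (use r in \<open>auto simp: indicator_def\<close>)
  finally show "emeasure ?L ?S = ennreal (r ^ n) * emeasure ?L A" by (simp add: mult.commute)
qed

section \<open>Orthonormal families\<close>

lemma unit_vec_in_Rn: "i < n \<Longrightarrow> Poly_Mapping.single i (1::real) \<in> Rn n"
  by (simp add: Rn_def)

lemma Rn_mono: "m \<le> n \<Longrightarrow> Rn m \<subseteq> Rn n"
  by (auto simp: Rn_def)

lemma span_unit_vecs: "span ((\<lambda>i. Poly_Mapping.single i 1) ` {..<n}) = Rn n"
proof
  show "span ((\<lambda>i. Poly_Mapping.single i 1) ` {..<n}) \<subseteq> Rn n"
    by (rule span_minimal[OF _ subspace_Rn]) (auto simp: unit_vec_in_Rn)
  show "Rn n \<subseteq> span ((\<lambda>i. Poly_Mapping.single i 1) ` {..<n})"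
  proof
    fix x assume "x \<in> Rn n"
    have "of_coords n (lk x) \<in> span ((\<lambda>i. Poly_Mapping.single i 1) ` {..<n})"
      unfolding of_coords_def by (intro span_sum span_scale span_base) auto
    thus "x \<in> span ((\<lambda>i. Poly_Mapping.single i 1) ` {..<n})"
      using \<open>x \<in> Rn n\<close> by (simp add: of_coords_lookup)
  qed
qed

text \<open>Dimension count: a vector of \<open>Rn n\<close> outside the span would give
  \<open>n + 1\<close> independent vectors in the span of \<open>n\<close> unit vectors.\<close>

lemma span_eq_Rn:
  assumes "B \<subseteq> Rn n" "independent B" "card B = n" "finite B"
  shows "span B = Rn n"
proof
  show "span B \<subseteq> Rn n" using assms(1) by (rule span_minimal[OF _ subspace_Rn])
  show "Rn n \<subseteq> span B"
  proof (rule ccontr)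
    assume "\<not> Rn n \<subseteq> span B"
    then obtain x where x: "x \<in> Rn n" "x \<notin> span B" by auto
    have "independent (insert x B)" using x(2) assms(2) by (rule independent_insertI)
    moreover have "insert x B \<subseteq> span ((\<lambda>i. Poly_Mapping.single i 1) ` {..<n})"
      using x(1) assms(1) by (simp add: span_unit_vecs)
    ultimately have "card (insert x B) \<le> card ((\<lambda>i. Poly_Mapping.single i (1::real)) ` {..<n})"
      using independent_span_bound[of "(\<lambda>i. Poly_Mapping.single i (1::real)) ` {..<n}"] by blast
    also have "\<dots> \<le> n" using card_image_le[of "{..<n}"] by simp
    finally have "card (insert x B) \<le> n" .
    moreover have "x \<notin> B" using x(2) by (auto intro: span_base)
    ultimately show False using assms(3,4) by simp
  qed
qed

text \<open>The linear map taking the \<open>i\<close>-th unit vector to \<open>x i\<close>. The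
  coefficients are packed into a \<open>seq\<close> so that the map acts between the spaces
  \<open>borel_Rn\<close>.\<close>

definition lincomb :: "nat \<Rightarrow> (nat \<Rightarrow> seq) \<Rightarrow> seq \<Rightarrow> seq" where
  "lincomb k x u = (\<Sum>i<k. lk u i *\<^sub>R x i)"

lemma linear_lincomb: "linear (lincomb k x)"
  by (rule linearI) (simp_all add: lincomb_def lookup_add lookup_scaleR_seq scaleR_add_left
    sum.distrib scaleR_sum_right)

lemma lincomb_in_Rn [simp]: "(\<And>i. i < k \<Longrightarrow> x i \<in> Rn n) \<Longrightarrow> lincomb k x u \<in> Rn n"
  by (auto simp: lincomb_def)

lemma measurable_lincomb:
  assumes "\<And>i. i < k \<Longrightarrow> x i \<in> Rn n"
  shows "lincomb k x \<in> borel_Rn k \<rightarrow>\<^sub>M borel_Rn n"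
  unfolding lincomb_def by (intro measurable_sum_Rn measurable_scaleR_Rn measurable_lookup) (use assms in auto)

text \<open>Independence of the indexed family also excludes repetitions, so the \<open>x i\<close>
  are \<open>m\<close> distinct independent vectors and span \<open>Rn m\<close>. This provides the
  surjectivity that \<open>nn_integral_linear_change\<close> asks for.\<close>

lemma lincomb_surj:
  assumes x: "\<And>i. i < m \<Longrightarrow> x i \<in> Rn m"
    and ind: "\<And>c. (\<Sum>i<m. c i *\<^sub>R x i) = 0 \<Longrightarrow> \<forall>i<m. c i = (0::real)"
  shows "Rn m \<subseteq> lincomb m x ` Rn m"
proof
  have inj: "inj_on x {..<m}"
  proof (rule inj_onI, rule ccontr)
    fix i j assume ij: "i \<in> {..<m}" "j \<in> {..<m}" "x i = x j" "i \<noteq> j"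
    define c where "c = (\<lambda>l. if l = i then 1 else if l = j then - 1 else (0::real))"
    have "(\<Sum>l<m. c l *\<^sub>R x l) = (\<Sum>l\<in>{i, j}. c l *\<^sub>R x l)"
      using ij by (intro sum.mono_neutral_right) (auto simp: c_def)
    also have "\<dots> = 0" using ij by (simp add: c_def)
    finally have "c i = 0" using ind[of c] ij(1) by auto
    thus False by (simp add: c_def)
  qed
  have indep: "independent (x ` {..<m})"
  proof (rule independent_if_scalars_zero)
    fix c v assume z: "(\<Sum>x\<in>x ` {..<m}. c x *\<^sub>R x) = 0" and "v \<in> x ` {..<m}"
    then show "c v = 0" using ind[of "\<lambda>i. c (x i)"] by (auto simp: sum.reindex[OF inj])
  qed simp
  fix w assume w: "w \<in> Rn m"
  have "span (x ` {..<m}) = Rn m"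
    using x inj indep by (intro span_eq_Rn) (auto simp: card_image)
  then obtain c where "w = (\<Sum>v\<in>x ` {..<m}. c v *\<^sub>R v)"
    using w by (auto simp: span_finite)
  hence "w = lincomb m x (of_coords m (\<lambda>i. c (x i)))"
    by (simp add: sum.reindex[OF inj] lincomb_def lookup_of_coords)
  thus "w \<in> lincomb m x ` Rn m" by (rule image_eqI) simp
qed

section \<open>Gram-Schmidt for symmetric bilinear forms\<close>

definition orthonormal_wrt :: "(seq \<Rightarrow> seq \<Rightarrow> real) \<Rightarrow> nat \<Rightarrow> (nat \<Rightarrow> seq) \<Rightarrow> bool" where
  "orthonormal_wrt B k q \<longleftrightarrow> (\<forall>i<k. \<forall>j<k. B (q i) (q j) = (if i = j then 1 else 0))"

text \<open>Orthonormalisation is used for two forms: \<open>dotp n\<close>, and the second moment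
  form of a uniform distribution. Positivity stays outside the locale because \<open>dotp n\<close>
  vanishes on sequences supported outside \<open>{..<n}\<close>.\<close>

locale sym_bilinear =
  fixes B :: "seq \<Rightarrow> seq \<Rightarrow> real"
  assumes sym: "B x y = B y x" and linear_left: "linear (\<lambda>x. B x y)"
begin

lemmas simps_left = linear_add[OF linear_left] linear_diff[OF linear_left]
  linear_scale[OF linear_left] linear_sum[OF linear_left] linear_0[OF linear_left]

lemma simps_right:
  "B y (a + b) = B y a + B y b" "B y (a - b) = B y a - B y b" "B y (c *\<^sub>R a) = c * B y a"
  "B y (\<Sum>i\<in>S. g i) = (\<Sum>i\<in>S. B y (g i))"
  by (simp_all add: sym[of y a] sym[of y b] sym[of y "_ + _"] sym[of y "_ - _"] sym[of y "_ *\<^sub>R _"]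
      sym[of y "sum _ _"] sym[of y "g _"] simps_left)

lemma orthonormal_comb:
  assumes "orthonormal_wrt B k q" "S \<subseteq> {..<k}" "finite S"
  shows "B (\<Sum>j\<in>S. c j *\<^sub>R q j) (\<Sum>j\<in>S. d j *\<^sub>R q j) = (\<Sum>j\<in>S. c j * d j)"
    and "i < k \<Longrightarrow> B (\<Sum>j\<in>S. c j *\<^sub>R q j) (q i) = (if i \<in> S then c i else 0)"
proof -
  show *: "B (\<Sum>j\<in>S. c j *\<^sub>R q j) (q i) = (if i \<in> S then c i else 0)" if i: "i < k" for i
  proof -
    have "B (\<Sum>j\<in>S. c j *\<^sub>R q j) (q i) = (\<Sum>j\<in>S. if j = i then c j else 0)"
      unfolding simps_left using assms(1,2) i
      by (intro sum.cong refl) (auto simp: orthonormal_wrt_def)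
    also have "\<dots> = (if i \<in> S then c i else 0)" using assms(3) by simp
    finally show ?thesis .
  qed
  have "B (\<Sum>j\<in>S. c j *\<^sub>R q j) (\<Sum>j\<in>S. d j *\<^sub>R q j) = (\<Sum>i\<in>S. d i * B (\<Sum>j\<in>S. c j *\<^sub>R q j) (q i))"
    by (simp only: simps_right)
  also have "\<dots> = (\<Sum>j\<in>S. c j * d j)"
    using assms(2) by (intro sum.cong) (auto simp: * subset_eq)
  finally show "B (\<Sum>j\<in>S. c j *\<^sub>R q j) (\<Sum>j\<in>S. d j *\<^sub>R q j) = (\<Sum>j\<in>S. c j * d j)" .
qed

text \<open>The residual \<open>r\<close> is orthogonal to all \<open>q j\<close>, so
  \<open>B r r = B v r\<close>; this is the theorem of Pythagoras.\<close>

lemma gram_schmidt_residual: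
  fixes k :: nat and v :: seq
  assumes on: "orthonormal_wrt B k q"
  defines "r \<equiv> v - (\<Sum>j<k. B v (q j) *\<^sub>R q j)"
  shows "i < k \<Longrightarrow> B r (q i) = 0"
    and "B r r = B v v - (\<Sum>j<k. (B v (q j))\<^sup>2)"
proof -
  show *: "B r (q i) = 0" if "i < k" for i
    using orthonormal_comb(2)[OF on, of "{..<k}"] that by (simp add: r_def simps_left(2))
  have "B r r = B r v - (\<Sum>j<k. B v (q j) * B r (q j))"
    unfolding r_def simps_right by simp
  also have "\<dots> = B v r" using * by (simp add: sym)
  also have "\<dots> = B v v - (\<Sum>j<k. (B v (q j))\<^sup>2)"
    by (simp add: r_def simps_right power2_eq_square)
  finally show "B r r = B v v - (\<Sum>j<k. (B v (q j))\<^sup>2)" .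
qed

lemma gram_schmidt_step:
  fixes k :: nat and v :: seq
  assumes on: "orthonormal_wrt B k q" and pos: "B v v - (\<Sum>j<k. (B v (q j))\<^sup>2) > 0"
  defines "r \<equiv> v - (\<Sum>j<k. B v (q j) *\<^sub>R q j)"
  shows "orthonormal_wrt B (Suc k) (q(k := (1 / sqrt (B r r)) *\<^sub>R r))"
proof -
  note res = gram_schmidt_residual[OF on, where v=v, folded r_def]
  have rr: "B r r > 0" using pos res(2) by simp
  have "B ((1 / sqrt (B r r)) *\<^sub>R r) ((1 / sqrt (B r r)) *\<^sub>R r) = 1"
    using rr by (simp add: simps_left simps_right)
  moreover have "B ((1 / sqrt (B r r)) *\<^sub>R r) (q i) = 0" if "i < k" for i
    using res(1)[OF that] by (simp add: simps_left)
  ultimately show ?thesis using on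
    by (auto simp: orthonormal_wrt_def less_Suc_eq sym[of "q _" "_ *\<^sub>R r"])
qed

text \<open>The unit vectors are orthonormalised in order. The first \<open>k\<close> results lie in
  \<open>Rn k\<close>, so the next residual has coordinate 1 at index \<open>k\<close>; it is
  therefore nonzero and \<open>pos\<close> applies.\<close>

lemma gram_schmidt_Rn:
  assumes pos: "\<And>v. v \<in> Rn m \<Longrightarrow> v \<noteq> 0 \<Longrightarrow> B v v > 0"
  shows "\<exists>a. (\<forall>i<m. a i \<in> Rn m) \<and> orthonormal_wrt B m a"
proof -
  have "\<exists>a. (\<forall>i<k. a i \<in> Rn k) \<and> orthonormal_wrt B k a" if "k \<le> m" for k
    using that
  proof (induction k)
    case 0
    show ?case by (simp add: orthonormal_wrt_def)
  next
    case (Suc k)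
    then obtain a where a: "\<forall>i<k. a i \<in> Rn k" and on: "orthonormal_wrt B k a" by auto
    let ?v = "Poly_Mapping.single k (1::real)"
    define r where "r = ?v - (\<Sum>j<k. B ?v (a j) *\<^sub>R a j)"
    have s: "(\<Sum>j<k. B ?v (a j) *\<^sub>R a j) \<in> Rn k" using a by auto
    hence s': "(\<Sum>j<k. B ?v (a j) *\<^sub>R a j) \<in> Rn (Suc k)" using Rn_mono[of k "Suc k"] by auto
    hence r: "r \<in> Rn (Suc k)" unfolding r_def by (intro Rn_closed(2) unit_vec_in_Rn) auto
    have "lk r k = 1" using lookup_Rn[OF s, of k] by (simp add: r_def lookup_minus)
    hence "r \<noteq> 0" by auto
    hence "B r r > 0" using r Rn_mono[OF Suc.prems] by (intro pos) auto
    hence "orthonormal_wrt B (Suc k) (a(k := (1 / sqrt (B r r)) *\<^sub>R r))"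
      unfolding r_def by (intro gram_schmidt_step on) (simp add: gram_schmidt_residual[OF on])
    moreover have "\<forall>i<Suc k. (a(k := (1 / sqrt (B r r)) *\<^sub>R r)) i \<in> Rn (Suc k)"
      using a r Rn_mono[of k "Suc k"] by (auto simp: less_Suc_eq)
    ultimately show ?case by blast
  qed
  thus ?thesis by blast
qed

end

interpretation dotp: sym_bilinear "dotp n"
proof (rule sym_bilinear.intro)
  show "dotp n x y = dotp n y x" for x y by (rule dotp_commute)
  show "linear (\<lambda>x. dotp n x y)" for y
    by (rule linearI) (simp_all add: dotp_add_left dotp_scaleR_left)
qed

text \<open>The quantity in \<open>greedy\<close> is the squared distance of \<open>\<Phi> x\<close>
  from the span of the vectors \<open>q j\<close> found so far. Normalising the residual of a
  distant point adds the next \<open>q\<close>, and its length becomes the diagonal entry of a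
  triangular coefficient matrix.\<close>

lemma greedy_triangular_family:
  fixes \<Phi> :: "seq \<Rightarrow> seq"
  assumes \<Phi>: "\<And>x. x \<in> E \<Longrightarrow> \<Phi> x \<in> Rn m"
    and greedy: "\<And>k q. k < m \<Longrightarrow> (\<forall>i<k. q i \<in> Rn m) \<Longrightarrow> orthonormal_wrt (dotp m) k q \<Longrightarrow>
      \<exists>x\<in>E. dotp m (\<Phi> x) (\<Phi> x) - (\<Sum>j<k. (dotp m (\<Phi> x) (q j))\<^sup>2) \<ge> real (m - k)"
  shows "\<exists>x q r. (\<forall>i<m. x i \<in> E \<and> q i \<in> Rn m \<and> r i i \<ge> sqrt (real (m - i)) \<and>
      \<Phi> (x i) = (\<Sum>j\<le>i. r i j *\<^sub>R q j)) \<and> orthonormal_wrt (dotp m) m q"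
proof -
  have "\<exists>x q r. (\<forall>i<k. x i \<in> E \<and> q i \<in> Rn m \<and> r i i \<ge> sqrt (real (m - i)) \<and>
      \<Phi> (x i) = (\<Sum>j\<le>i. r i j *\<^sub>R q j)) \<and> orthonormal_wrt (dotp m) k q" if "k \<le> m" for k
    using that
  proof (induction k)
    case 0
    show ?case by (simp add: orthonormal_wrt_def)
  next
    case (Suc k)
    then obtain x q r where IH: "\<forall>i<k. x i \<in> E \<and> q i \<in> Rn m \<and> r i i \<ge> sqrt (real (m - i)) \<and>
      \<Phi> (x i) = (\<Sum>j\<le>i. r i j *\<^sub>R q j)" and on: "orthonormal_wrt (dotp m) k q" by auto
    obtain y where y: "y \<in> E"
      "dotp m (\<Phi> y) (\<Phi> y) - (\<Sum>j<k. (dotp m (\<Phi> y) (q j))\<^sup>2) \<ge> real (m - k)"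
      using greedy[OF _ _ on] IH Suc.prems by auto
    define w where "w = \<Phi> y - (\<Sum>j<k. dotp m (\<Phi> y) (q j) *\<^sub>R q j)"
    have ww: "dotp m w w \<ge> real (m - k)"
      unfolding w_def dotp.gram_schmidt_residual(2)[OF on] by (rule y(2))
    hence w0: "dotp m w w > 0" using Suc.prems by linarith
    define p where "p = (1 / sqrt (dotp m w w)) *\<^sub>R w"
    have wR: "w \<in> Rn m" using IH \<Phi> y(1) by (auto simp: w_def)
    have on': "orthonormal_wrt (dotp m) (Suc k) (q(k := p))"
      unfolding p_def w_def
      by (rule dotp.gram_schmidt_step[OF on]) (use y(2) Suc.prems in linarith)
    define x' q' r' where "x' = x(k := y)" and "q' = q(k := p)"
      and "r' = r(k := (\<lambda>j. if j = k then sqrt (dotp m w w) else dotp m (\<Phi> y) (q j)))"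
    have "x' i \<in> E \<and> q' i \<in> Rn m \<and> r' i i \<ge> sqrt (real (m - i)) \<and>
      \<Phi> (x' i) = (\<Sum>j\<le>i. r' i j *\<^sub>R q' j)" if "i < Suc k" for i
    proof (cases "i = k")
      case True
      have "(\<Sum>j\<le>k. r' k j *\<^sub>R q' j) = (\<Sum>j<k. r' k j *\<^sub>R q' j) + r' k k *\<^sub>R q' k"
        by (simp add: lessThan_Suc_atMost[symmetric])
      also have "\<dots> = (\<Sum>j<k. dotp m (\<Phi> y) (q j) *\<^sub>R q j) + w"
        using w0 by (simp add: r'_def q'_def p_def)
      also have "\<dots> = \<Phi> y" by (simp add: w_def)
      finally show ?thesis using True y(1) wR ww by (simp add: x'_def q'_def r'_def p_def Rn_closed(3))
    next
      case False
      with that have i: "i < k" by simp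
      hence "(\<Sum>j\<le>i. r' i j *\<^sub>R q' j) = (\<Sum>j\<le>i. r i j *\<^sub>R q j)"
        by (intro sum.cong) (auto simp: r'_def q'_def)
      thus ?thesis using i IH by (simp add: x'_def q'_def r'_def)
    qed
    thus ?case using on' unfolding q'_def[symmetric] by blast
  qed
  thus ?thesis by blast
qed

section \<open>Isotropic position\<close>

lemma measurable_dotp_const [measurable]: "(\<lambda>x. dotp n x a) \<in> borel_measurable (borel_Rn n)"
  unfolding dotp_def by measurable

lemma hyperplane_measurable: "{x \<in> Rn n. dotp n x a = 0} \<in> sets (borel_Rn n)"
proof -
  have "(\<lambda>x. dotp n x a) -` {0} \<inter> space (borel_Rn n) \<in> sets (borel_Rn n)"
    by (rule measurable_sets[OF measurable_dotp_const]) simp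
  also have "(\<lambda>x. dotp n x a) -` {0} \<inter> space (borel_Rn n) = {x \<in> Rn n. dotp n x a = 0}"
    by auto
  finally show ?thesis .
qed

text \<open>The translates of the hyperplane along \<open>a\<close> all have the same measure. By
  Fubini their integral over the shift \<open>t\<close> vanishes, since each line in direction
  \<open>a\<close> meets the hyperplane only once.\<close>

lemma hyperplane_null:
  assumes a: "a \<in> Rn m" "a \<noteq> 0"
  shows "emeasure (borel_Rn m) {x \<in> Rn m. dotp m x a = 0} = 0"
proof -
  let ?L = "borel_Rn m" and ?Z = "{x \<in> Rn m. dotp m x a = 0}"
  interpret L: sigma_finite_measure ?L by (rule sigma_finite_borel_Rn)
  interpret pair_sigma_finite "lborel :: real measure" ?L by standard
  have aa: "dotp m a a > 0" using a by (rule dotp_pos)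
  have [measurable]: "(\<lambda>_. a) \<in> (lborel :: real measure) \<Otimes>\<^sub>M ?L \<rightarrow>\<^sub>M ?L" "(\<lambda>_. a) \<in> ?L \<rightarrow>\<^sub>M ?L"
    using a(1) by simp_all
  note Z [measurable] = hyperplane_measurable[of m a]
  have "(\<integral>\<^sup>+t. emeasure ?L ?Z \<partial>(lborel :: real measure))
      = (\<integral>\<^sup>+t. (\<integral>\<^sup>+x. indicator ?Z (t *\<^sub>R a + x) \<partial>?L) \<partial>(lborel :: real measure))"
  proof (rule nn_integral_cong)
    fix t :: real
    have "(\<integral>\<^sup>+x. indicator ?Z (t *\<^sub>R a + x) \<partial>?L) = (\<integral>\<^sup>+x. indicator ?Z x \<partial>?L)"
      by (rule nn_integral_translate) (use a(1) in simp_all)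
    thus "emeasure ?L ?Z = (\<integral>\<^sup>+x. indicator ?Z (t *\<^sub>R a + x) \<partial>?L)"
      by (simp add: Z)
  qed
  also have "\<dots> = (\<integral>\<^sup>+x. (\<integral>\<^sup>+t. indicator ?Z (t *\<^sub>R a + x) \<partial>(lborel :: real measure)) \<partial>?L)"
    by (rule Fubini'[symmetric]) measurable
  also have "\<dots> = (\<integral>\<^sup>+x. 0 \<partial>?L)"
  proof (rule nn_integral_cong)
    fix x
    let ?t = "- dotp m x a / dotp m a a"
    have "(\<integral>\<^sup>+t. indicator ?Z (t *\<^sub>R a + x) \<partial>(lborel :: real measure)) \<le> (\<integral>\<^sup>+t. indicator {?t} t \<partial>lborel)"
      using aa by (intro nn_integral_mono)
        (auto simp: indicator_def dotp_add_left dotp_scaleR_left field_simps)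
    thus "(\<integral>\<^sup>+t. indicator ?Z (t *\<^sub>R a + x) \<partial>(lborel :: real measure)) = 0" by simp
  qed
  \<comment> \<open>A constant with zero integral over the whole real line is zero.\<close>
  finally show ?thesis by (auto simp: ennreal_mult_eq_top_iff ennreal_top_mult split: if_splits)
qed

lemma box_Rn:
  fixes a b :: real
  assumes "a \<le> b"
  shows "{x \<in> Rn m. \<forall>i<m. lk x i \<in> {a..b}} \<in> sets (borel_Rn m)"
    and "emeasure (borel_Rn m) {x \<in> Rn m. \<forall>i<m. lk x i \<in> {a..b}} = ennreal ((b - a) ^ m)"
proof -
  let ?B = "{x \<in> Rn m. \<forall>i<m. lk x i \<in> {a..b}}" and ?P = "Pi\<^sub>M {..<m} (\<lambda>_. lborel :: real measure)"
  have "?B = {x \<in> space (borel_Rn m). \<forall>i\<in>{..<m}. lk x i \<in> {a..b}}" by auto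
  also have "\<dots> \<in> sets (borel_Rn m)" by measurable
  finally show B: "?B \<in> sets (borel_Rn m)" .
  have "emeasure (borel_Rn m) ?B = emeasure ?P (of_coords m -` ?B \<inter> space ?P)"
    by (rule emeasure_borel_Rn[OF B])
  also have "of_coords m -` ?B \<inter> space ?P = Pi\<^sub>E {..<m} (\<lambda>_. {a..b})"
    by (auto simp: space_PiM PiE_def Pi_def lookup_of_coords)
  also have "emeasure ?P \<dots> = (\<Prod>i<m. emeasure lborel {a..b})"
    by (rule lborel_prod.emeasure_PiM) auto
  also have "\<dots> = ennreal ((b - a) ^ m)"
    using assms by (simp add: ennreal_power)
  finally show "emeasure (borel_Rn m) ?B = ennreal ((b - a) ^ m)" .
qed

lemma prod_sqrt_fact: "(\<Prod>j<m. sqrt (real (m - j))) = sqrt (fact m)"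
proof -
  have "(\<Prod>j<m. real (m - j)) = real (\<Prod>i<m. Suc i)"
    unfolding of_nat_prod by (rule prod.reindex_bij_witness[of _ "\<lambda>i. m - Suc i" "\<lambda>i. m - Suc i"]) auto
  also have "\<dots> = fact m" by (simp add: fact_prod_Suc atLeast0LessThan)
  finally have "sqrt (\<Prod>j<m. real (m - j)) = sqrt (fact m)" by simp
  moreover have "sqrt (prod f A) = (\<Prod>j\<in>A. sqrt (f j))" for f :: "nat \<Rightarrow> real" and A
    by (induction A rule: infinite_finite_induct) (simp_all add: real_sqrt_mult)
  ultimately show ?thesis by simp
qed

text \<open>
  The linear map \<open>\<Phi>\<close> puts \<open>E\<close> into isotropic position. Jensen's inequality for the Gaussian
  integral on the isotropic set bounds the volume of \<open>E\<close> in terms of the determinant of \<open>\<Phi>\<close>.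
\<close>

lemma isotropic_position:
  assumes E: "E \<in> sets (borel_Rn m)" "emeasure (borel_Rn m) E \<noteq> 0" "emeasure (borel_Rn m) E \<noteq> \<infinity>"
    and bdd: "\<And>x i. x \<in> E \<Longrightarrow> i < m \<Longrightarrow> \<bar>lk x i\<bar> \<le> R"
  obtains \<Phi> where "linear \<Phi>" "\<Phi> \<in> borel_Rn m \<rightarrow>\<^sub>M borel_Rn m"
    "\<And>k q. k < m \<Longrightarrow> (\<forall>i<k. q i \<in> Rn m) \<Longrightarrow> orthonormal_wrt (dotp m) k q \<Longrightarrow>
      \<exists>x\<in>E. dotp m (\<Phi> x) (\<Phi> x) - (\<Sum>j<k. (dotp m (\<Phi> x) (q j))\<^sup>2) \<ge> real (m - k)"
    "emeasure (borel_Rn m) E * ennreal (exp (- real m / 2)) \<le> (\<integral>\<^sup>+x. gauss m (\<Phi> x) \<partial>borel_Rn m)"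
proof -
  let ?L = "borel_Rn m"
  define P where "P = uniform_measure ?L E"
  interpret P: prob_space P unfolding P_def by (rule prob_space_uniform_measure) (use E in auto)
  have sets_P [measurable_cong]: "sets P = sets ?L" by (simp add: P_def)
  have ER: "E \<subseteq> Rn m" using sets.sets_into_space[OF E(1)] by simp
  have AE_E: "AE x in P. x \<in> E" unfolding P_def by (rule AE_uniform_measureI[OF E(1)]) simp
  have bound: "\<bar>dotp m x a\<bar> \<le> \<bar>R\<bar> * (\<Sum>i<m. \<bar>lk a i\<bar>)" if "x \<in> E" for x a
  proof -
    have "\<bar>dotp m x a\<bar> \<le> (\<Sum>i<m. \<bar>R\<bar> * \<bar>lk a i\<bar>)"
      unfolding dotp_def
    proof (rule order_trans[OF sum_abs], rule sum_mono)
      fix i assume "i \<in> {..<m}"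
      hence "\<bar>lk x i\<bar> \<le> \<bar>R\<bar>" using bdd[OF that, of i] by simp
      thus "\<bar>lk x i * lk a i\<bar> \<le> \<bar>R\<bar> * \<bar>lk a i\<bar>" by (simp add: abs_mult mult_right_mono)
    qed
    thus ?thesis by (simp add: sum_distrib_left)
  qed
  have int: "integrable P (\<lambda>x. dotp m x a * dotp m x b)" for a b
  proof (rule P.integrable_const_bound)
    show "AE x in P. norm (dotp m x a * dotp m x b)
        \<le> (\<bar>R\<bar> * (\<Sum>i<m. \<bar>lk a i\<bar>)) * (\<bar>R\<bar> * (\<Sum>i<m. \<bar>lk b i\<bar>))"
      using AE_E by eventually_elim
        (simp only: real_norm_def abs_mult, intro mult_mono bound, auto intro!: mult_nonneg_nonneg sum_nonneg)
  qed measurable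
  \<comment> \<open>The second moment form of the uniform distribution on \<open>E\<close>. A basis
    orthonormal for it yields the isotropic coordinates.\<close>
  define B where "B = (\<lambda>a b. \<integral>x. dotp m x a * dotp m x b \<partial>P)"
  interpret B: sym_bilinear B
  proof (rule sym_bilinear.intro)
    show "B a b = B b a" for a b by (simp add: B_def mult.commute)
    show "linear (\<lambda>a. B a b)" for b
      by (rule linearI) (simp_all add: B_def dotp.simps_right distrib_right mult.assoc
        Bochner_Integration.integral_add int)
  qed
  \<comment> \<open>If the form vanished at \<open>a\<close>, almost all of \<open>E\<close> would
    lie in the hyperplane orthogonal to \<open>a\<close>, which is null.\<close>
  have pos: "B a a > 0" if a: "a \<in> Rn m" "a \<noteq> 0" for a
  proof (rule ccontr)
    assume "\<not> B a a > 0"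
    moreover have "B a a \<ge> 0" unfolding B_def by (rule integral_nonneg_AE) simp
    ultimately have "B a a = 0" by linarith
    hence "(\<integral>x. dotp m x a * dotp m x a \<partial>P) = 0" unfolding B_def .
    hence "AE x in P. dotp m x a * dotp m x a = 0"
      by (subst (asm) integral_nonneg_eq_0_iff_AE) (use int in auto)
    hence "AE x in P. x \<in> {x \<in> Rn m. dotp m x a = 0}"
      using AE_E by eventually_elim (use ER in auto)
    moreover note Z = hyperplane_measurable[of m a]
    ultimately have "emeasure P {x \<in> Rn m. dotp m x a = 0} = 1"
      by (intro P.emeasure_eq_1_AE) (simp_all add: sets_P)
    hence "emeasure ?L (E \<inter> {x \<in> Rn m. dotp m x a = 0}) / emeasure ?L E = 1"
      unfolding P_def using E Z by simp
    moreover have "emeasure ?L (E \<inter> {x \<in> Rn m. dotp m x a = 0}) \<le> 0"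
      unfolding hyperplane_null[OF a, symmetric] using Z by (intro emeasure_mono) auto
    ultimately show False by simp
  qed
  obtain a where a: "\<forall>i<m. a i \<in> Rn m" and on: "orthonormal_wrt B m a"
    using B.gram_schmidt_Rn[of m] pos by blast
  \<comment> \<open>The second moments of these coordinates are \<open>B (a i) (a j)\<close>, so
    under \<open>P\<close> the image has the identity as its second moment matrix.\<close>
  define \<Phi> where "\<Phi> = (\<lambda>x. of_coords m (\<lambda>i. dotp m x (a i)))"
  have lk\<Phi>: "lk (\<Phi> x) i = (if i < m then dotp m x (a i) else 0)" for x i
    by (simp add: \<Phi>_def lookup_of_coords)
  have lin: "linear \<Phi>"
    by (rule linearI; rule Rn_eqI[of _ m])
       (auto simp: \<Phi>_def lookup_of_coords lookup_add lookup_scaleR_seq dotp_add_left dotp_scaleR_left)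
  have meas [measurable]: "\<Phi> \<in> ?L \<rightarrow>\<^sub>M ?L"
    by (rule measurable_borel_RnI) (simp add: \<Phi>_def, simp add: lk\<Phi>)
  have d\<Phi>: "dotp m (\<Phi> x) q = dotp m x (\<Sum>i<m. lk q i *\<^sub>R a i)" for x q
    by (simp only: dotp.simps_right) (simp add: dotp_def[of m "\<Phi> x"] lk\<Phi> mult.commute)
  have sq: "has_bochner_integral P (\<lambda>x. (dotp m (\<Phi> x) q)\<^sup>2) (dotp m q q)" for q
  proof -
    have "(\<integral>x. (dotp m (\<Phi> x) q)\<^sup>2 \<partial>P) = B (\<Sum>i<m. lk q i *\<^sub>R a i) (\<Sum>i<m. lk q i *\<^sub>R a i)"
      by (simp add: d\<Phi> B_def power2_eq_square)
    also have "\<dots> = dotp m q q"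
      unfolding dotp_def by (rule B.orthonormal_comb(1)[OF on]) auto
    finally show ?thesis using int by (simp add: has_bochner_integral_iff d\<Phi> power2_eq_square)
  qed
  \<comment> \<open>The mean squared length is the trace of the identity matrix.\<close>
  have total: "has_bochner_integral P (\<lambda>x. dotp m (\<Phi> x) (\<Phi> x)) (real m)"
  proof -
    have "(\<integral>x. dotp m (\<Phi> x) (\<Phi> x) \<partial>P) = (\<Sum>i<m. B (a i) (a i))"
      unfolding dotp_def[of m "\<Phi> _"] B_def by (subst Bochner_Integration.integral_sum[symmetric]) (auto simp: lk\<Phi> int)
    also have "\<dots> = real m" using on by (simp add: orthonormal_wrt_def)
    finally show ?thesis
      by (auto simp: has_bochner_integral_iff dotp_def[of m "\<Phi> _"] lk\<Phi> int intro!: Bochner_Integration.integrable_sum)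
  qed
  show thesis
  proof (rule that[OF lin meas])
    fix k q assume k: "k < m" and q: "\<forall>i<k. q i \<in> Rn m" and onq: "orthonormal_wrt (dotp m) k q"
    let ?h = "\<lambda>x. dotp m (\<Phi> x) (\<Phi> x) - (\<Sum>j<k. (dotp m (\<Phi> x) (q j))\<^sup>2)"
    \<comment> \<open>The squared distance of \<open>\<Phi> x\<close> from the span of the
      \<open>q j\<close> has mean \<open>m - k\<close>, so some point of \<open>E\<close> reaches
      this value.\<close>
    have "has_bochner_integral P ?h (real m - (\<Sum>j<k. dotp m (q j) (q j)))"
      by (intro has_bochner_integral_diff has_bochner_integral_sum total sq)
    also have "(\<Sum>j<k. dotp m (q j) (q j)) = real k" using onq by (simp add: orthonormal_wrt_def)
    finally have h: "has_bochner_integral P ?h (real (m - k))" using k by (simp add: of_nat_diff)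
    show "\<exists>x\<in>E. ?h x \<ge> real (m - k)"
    proof (rule ccontr)
      assume "\<not> ?thesis"
      hence "AE x in P. ?h x < real (m - k)" using AE_E by (auto simp: not_le elim!: eventually_mono)
      with h have "(\<integral>x. ?h x \<partial>P) < real (m - k)"
        by (intro P.expectation_less) (simp_all add: has_bochner_integral_iff)
      thus False using h by (simp add: has_bochner_integral_iff)
    qed
  next
    let ?q = "\<lambda>x. dotp m (\<Phi> x) (\<Phi> x)"
    \<comment> \<open>The tangent line at \<open>y = m\<close> to the convex function
      \<open>exp (- y / 2)\<close>. Integrating it at \<open>y = ?q x\<close>, whose mean is
      \<open>m\<close>, gives Jensen's inequality.\<close>
    have tangent: "exp (- real m / 2) * (1 + (real m - y) / 2) \<le> exp (- y / 2)" for y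
    proof -
      have "exp (- real m / 2) * (1 + (real m - y) / 2) \<le> exp (- real m / 2) * exp ((real m - y) / 2)"
        by (intro mult_left_mono exp_ge_add_one_self) simp
      also have "\<dots> = exp (- y / 2)" by (simp add: exp_add[symmetric] field_simps)
      finally show ?thesis .
    qed
    have i1: "integrable P ?q" "(\<integral>x. ?q x \<partial>P) = real m" using total by (simp_all add: has_bochner_integral_iff)
    have i2: "integrable P (\<lambda>x. exp (- ?q x / 2))"
      by (rule P.integrable_const_bound[of _ 1]) (auto simp: dotp_def intro!: sum_nonneg)
    have "exp (- real m / 2) = (\<integral>x. exp (- real m / 2) * (1 + (real m - ?q x) / 2) \<partial>P)"
      using i1 by (simp add: P.prob_space)
    also have "\<dots> \<le> (\<integral>x. exp (- ?q x / 2) \<partial>P)"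
      by (intro integral_mono tangent i2) (use i1 in auto)
    finally have "ennreal (exp (- real m / 2)) \<le> ennreal (\<integral>x. exp (- ?q x / 2) \<partial>P)"
      by (rule ennreal_leI)
    also have "\<dots> = (\<integral>\<^sup>+x. gauss m (\<Phi> x) \<partial>P)"
      unfolding gauss_def by (rule nn_integral_eq_integral[OF i2, symmetric]) simp
    also have "\<dots> = (\<integral>\<^sup>+x. gauss m (\<Phi> x) * indicator E x \<partial>?L) / emeasure ?L E"
      unfolding P_def by (rule nn_integral_uniform_measure) (use E in auto)
    also have "\<dots> \<le> (\<integral>\<^sup>+x. gauss m (\<Phi> x) \<partial>?L) / emeasure ?L E"
      by (intro divide_right_mono_ennreal nn_integral_mono) (auto simp: indicator_def)
    finally have "ennreal (exp (- real m / 2)) * emeasure ?L E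
        \<le> (\<integral>\<^sup>+x. gauss m (\<Phi> x) \<partial>?L) / emeasure ?L E * emeasure ?L E"
      by (rule mult_right_mono) simp
    also have "\<dots> = (\<integral>\<^sup>+x. gauss m (\<Phi> x) \<partial>?L)"
    proof -
      have "emeasure ?L E / emeasure ?L E = 1"
        using E by (intro ennreal_divide_self) (auto simp: less_top)
      thus ?thesis by (simp add: ennreal_divide_times)
    qed
    finally show "emeasure ?L E * ennreal (exp (- real m / 2)) \<le> (\<integral>\<^sup>+x. gauss m (\<Phi> x) \<partial>?L)"
      by (simp add: mult.commute)
  qed
qed

text \<open>\<open>sqrt (fact m)\<close> bounds the product of the greedy diagonal entries from
  below, \<open>exp (- real m / 2)\<close> comes from Jensen's inequality, and the denominator is
  the Gaussian integral.\<close>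

definition parallelepiped_const :: "nat \<Rightarrow> real" where
  "parallelepiped_const m = sqrt (fact m) * exp (- real m / 2) / sqrt (2 * pi) ^ m"

text \<open>Here \<open>F\<close> and \<open>G\<close> stand for the Gaussian integrals of
  \<open>\<Phi>\<close> and of \<open>lincomb m x\<close>. Only their product is known, so the
  inequalities 1 and 3 are multiplied to eliminate both.\<close>

lemma ennreal_combine:
  fixes a F G V :: ennreal
  assumes 1: "ennreal k * ennreal p \<le> a * G" and 2: "F * G = ennreal (p / \<rho>) * ennreal p"
    and 3: "V * ennreal e \<le> F" and pos: "k \<ge> 0" "p > 0" "e \<ge> 0" "s > 0" and \<rho>: "\<rho> \<ge> s"
  shows "ennreal (k * (s * e / p)) * V \<le> a"
proof -
  have "ennreal k * ennreal p * (V * ennreal e) \<le> a * G * F"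
    by (rule mult_mono[OF 1 3]) simp_all
  also have "\<dots> = a * ennreal (p / \<rho> * p)"
  proof -
    have "F * G = ennreal (p / \<rho> * p)" unfolding 2 using pos \<rho> by (intro ennreal_mult[symmetric]) auto
    thus ?thesis by (simp add: mult.assoc mult.commute[of G])
  qed
  also have "\<dots> \<le> a * ennreal (p * p / s)"
    using pos \<rho> by (intro mult_left_mono ennreal_leI) (auto simp: field_simps)
  finally have "ennreal k * ennreal p * (V * ennreal e) * ennreal (s / (p * p))
      \<le> a * ennreal (p * p / s) * ennreal (s / (p * p))"
    by (rule mult_right_mono) simp
  also have "a * ennreal (p * p / s) * ennreal (s / (p * p)) = a"
    using pos by (simp add: mult.assoc ennreal_mult[symmetric])
  also have "ennreal k * ennreal p * (V * ennreal e) * ennreal (s / (p * p))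
      = V * (ennreal k * (ennreal p * (ennreal e * ennreal (s / (p * p)))))"
    by (simp only: ac_simps)
  also have "ennreal k * (ennreal p * (ennreal e * ennreal (s / (p * p)))) = ennreal (k * (s * e / p))"
    using pos by (simp add: ennreal_mult[symmetric] field_simps)
  finally show ?thesis by (simp add: mult.commute)
qed

definition cube :: "nat \<Rightarrow> real \<Rightarrow> seq set" where
  "cube m \<kappa> = {u \<in> Rn m. \<forall>i<m. lk u i \<in> {0..\<kappa>}}"

text \<open>The parallelepiped spanned by the \<open>x i\<close> has volume at least
  \<open>parallelepiped_const m\<close> times that of \<open>E\<close>. Measurable supersets of its
  scaled translates express this without determinants and without measurability of a linear
  image.\<close>

definition fat_family :: "nat \<Rightarrow> seq set \<Rightarrow> (nat \<Rightarrow> seq) \<Rightarrow> bool" where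
  "fat_family m E x \<longleftrightarrow> (\<forall>A\<in>sets (borel_Rn m). \<forall>c\<in>Rn m. \<forall>\<kappa>\<ge>0.
     (\<lambda>u. c + lincomb m x u) ` cube m \<kappa> \<subseteq> A \<longrightarrow>
     ennreal (\<kappa> ^ m * parallelepiped_const m) * emeasure (borel_Rn m) E \<le> emeasure (borel_Rn m) A)"

text \<open>For the greedy points \<open>x\<close>, the composition of \<open>\<Phi>\<close> with
  \<open>lincomb m x\<close> is triangular, so its Gaussian integral is explicit. With the lower
  bound for the Gaussian integral of \<open>\<Phi>\<close> this bounds that of
  \<open>lincomb m x\<close> from above, which amounts to a lower bound for its determinant.\<close>

lemma large_parallelepiped_bounded:
  assumes E: "E \<in> sets (borel_Rn m)" "emeasure (borel_Rn m) E \<noteq> 0" "emeasure (borel_Rn m) E \<noteq> \<infinity>"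
    and bdd: "\<And>x i. x \<in> E \<Longrightarrow> i < m \<Longrightarrow> \<bar>lk x i\<bar> \<le> R"
  obtains x where "\<And>i. i < m \<Longrightarrow> x i \<in> E"
    "fat_family m E x"
proof -
  let ?L = "borel_Rn m"
  have ER: "E \<subseteq> Rn m" using sets.sets_into_space[OF E(1)] by simp
  obtain \<Phi> where lin: "linear \<Phi>" and meas [measurable]: "\<Phi> \<in> ?L \<rightarrow>\<^sub>M ?L"
    and greedy: "\<And>k q. k < m \<Longrightarrow> (\<forall>i<k. q i \<in> Rn m) \<Longrightarrow> orthonormal_wrt (dotp m) k q \<Longrightarrow>
      \<exists>x\<in>E. dotp m (\<Phi> x) (\<Phi> x) - (\<Sum>j<k. (dotp m (\<Phi> x) (q j))\<^sup>2) \<ge> real (m - k)"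
    and jensen: "emeasure ?L E * ennreal (exp (- real m / 2)) \<le> (\<integral>\<^sup>+x. gauss m (\<Phi> x) \<partial>?L)"
    using isotropic_position[OF E bdd] by blast
  have \<Phi>R: "\<Phi> x \<in> Rn m" if "x \<in> E" for x
    using measurable_space[OF meas, of x] that ER by auto
  obtain x q r where x: "\<forall>i<m. x i \<in> E \<and> q i \<in> Rn m \<and> r i i \<ge> sqrt (real (m - i)) \<and>
      \<Phi> (x i) = (\<Sum>j\<le>i. r i j *\<^sub>R q j)" and on: "orthonormal_wrt (dotp m) m q"
    using greedy_triangular_family[of E \<Phi> m] \<Phi>R greedy by blast
  have xR: "x i \<in> Rn m" if "i < m" for i using x ER that by auto
  have rpos: "r i i > 0" if "i < m" for i
  proof -
    have "0 < sqrt (real (m - i))" using that by simp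
    also have "\<dots> \<le> r i i" using x that by simp
    finally show ?thesis .
  qed
  have \<Phi>X: "\<Phi> (\<Sum>i<m. c i *\<^sub>R x i) = (\<Sum>j<m. (\<Sum>i\<in>{j..<m}. r i j * c i) *\<^sub>R q j)" for c
  proof -
    have "\<Phi> (\<Sum>i<m. c i *\<^sub>R x i) = (\<Sum>i<m. \<Sum>j\<le>i. (c i * r i j) *\<^sub>R q j)"
      using x by (simp add: linear_sum[OF lin] linear_scale[OF lin] scaleR_sum_right)
    also have "\<dots> = (\<Sum>i<m. \<Sum>j\<in>{j. j < m \<and> j \<le> i}. (c i * r i j) *\<^sub>R q j)"
      by (intro sum.cong) auto
    also have "\<dots> = (\<Sum>j<m. \<Sum>i\<in>{i. i < m \<and> j \<le> i}. (c i * r i j) *\<^sub>R q j)"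
      using sum.swap_restrict[of "{..<m}" "{..<m}" "\<lambda>i j. (c i * r i j) *\<^sub>R q j" "\<lambda>i j. j \<le> i"] by simp
    also have "\<dots> = (\<Sum>j<m. (\<Sum>i\<in>{j..<m}. r i j * c i) *\<^sub>R q j)"
      unfolding scaleR_sum_left by (intro sum.cong) (auto simp: mult.commute)
    finally show ?thesis .
  qed
  have ind: "\<forall>i<m. c i = 0" if c: "(\<Sum>i<m. c i *\<^sub>R x i) = 0" for c
  proof (rule ccontr)
    assume "\<not> ?thesis"
    hence ne: "{i. i < m \<and> c i \<noteq> 0} \<noteq> {}" (is "?S \<noteq> {}") by auto
    \<comment> \<open>The largest index with a nonzero coefficient. Pairing with \<open>q k\<close>
      removes all smaller indices, because \<open>\<Phi> (x i)\<close> involves \<open>q j\<close>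
      only for \<open>j \<le> i\<close>.\<close>
    define k where "k = Max ?S"
    have fin: "finite ?S" by simp
    have k: "k < m" "c k \<noteq> 0" using Max_in[OF fin ne] by (auto simp: k_def)
    have top: "c i = 0" if "i < m" "k < i" for i
    proof (rule ccontr)
      assume "c i \<noteq> 0"
      hence "i \<le> k" unfolding k_def using that(1) by (intro Max_ge[OF fin]) simp
      with that(2) show False by simp
    qed
    have "0 = dotp m (\<Phi> (\<Sum>i<m. c i *\<^sub>R x i)) (q k)"
      unfolding c linear_0[OF lin] by (simp add: dotp_zero_left)
    also have "\<dots> = (\<Sum>i\<in>{k..<m}. r i k * c i)"
      unfolding \<Phi>X using k(1) by (subst dotp.orthonormal_comb(2)[OF on]) auto
    also have "\<dots> = (\<Sum>i\<in>{k}. r i k * c i)"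
      using k(1) top by (intro sum.mono_neutral_right) auto
    finally show False using k rpos[of k] by simp
  qed
  let ?X = "lincomb m x" and ?p = "sqrt (2 * pi) ^ m"
  have Xlin: "linear ?X" by (rule linear_lincomb)
  have Xm [measurable]: "?X \<in> ?L \<rightarrow>\<^sub>M ?L" using xR by (rule measurable_lincomb)
  have Xs: "Rn m \<subseteq> ?X ` Rn m" by (rule lincomb_surj[OF xR ind])
  have "(\<integral>\<^sup>+u. gauss m (\<Phi> (?X u)) \<partial>?L)
      = (\<integral>\<^sup>+u. ennreal (exp (- (\<Sum>j<m. ((\<Sum>i\<in>{j..<m}. r i j * lk u i) + 0)\<^sup>2) / 2)) \<partial>?L)"
  proof (rule nn_integral_cong)
    fix u
    have "dotp m (\<Phi> (?X u)) (\<Phi> (?X u)) = (\<Sum>j<m. (\<Sum>i\<in>{j..<m}. r i j * lk u i)\<^sup>2)"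
      unfolding lincomb_def \<Phi>X power2_eq_square by (rule dotp.orthonormal_comb(1)[OF on]) auto
    thus "gauss m (\<Phi> (?X u)) = ennreal (exp (- (\<Sum>j<m. ((\<Sum>i\<in>{j..<m}. r i j * lk u i) + 0)\<^sup>2) / 2))"
      by (simp add: gauss_def)
  qed
  also have "\<dots> = (\<integral>\<^sup>+u. ennreal (exp (- (\<Sum>j<m. ((\<Sum>i\<in>{j..<m}. r i j * lk (of_coords m u) i) + 0)\<^sup>2) / 2))
      \<partial>Pi\<^sub>M {..<m} (\<lambda>_. lborel))"
    by (rule nn_integral_borel_Rn) measurable
  also have "\<dots> = (\<integral>\<^sup>+u. ennreal (exp (- (\<Sum>j<m. ((\<Sum>i\<in>{j..<m}. r i j * u i) + 0)\<^sup>2) / 2))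
      \<partial>Pi\<^sub>M {..<m} (\<lambda>_. lborel))"
  proof -
    have "(\<Sum>i\<in>{j..<m}. r i j * lk (of_coords m u) i) = (\<Sum>i\<in>{j..<m}. r i j * u i)" for j u
      by (intro sum.cong) (auto simp: lookup_of_coords)
    thus ?thesis by simp
  qed
  also have "\<dots> = ennreal (?p / (\<Prod>j<m. r j j))"
    by (rule nn_integral_gauss_triangular[OF rpos])
  finally have G1: "(\<integral>\<^sup>+u. gauss m (\<Phi> (?X u)) \<partial>?L) = ennreal (?p / (\<Prod>j<m. r j j))" .
  \<comment> \<open>With the Gaussian composed with \<open>\<Phi>\<close> as \<open>f\<close>, this
    is the multiplicativity of the determinant.\<close>
  have "(\<integral>\<^sup>+u. gauss m (\<Phi> (0 + ?X u)) \<partial>?L) * (\<integral>\<^sup>+y. gauss m y \<partial>?L)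
       = (\<integral>\<^sup>+y. gauss m (\<Phi> y) \<partial>?L) * (\<integral>\<^sup>+u. gauss m (?X u) \<partial>?L)"
    by (rule nn_integral_linear_change[OF Xlin Xm Xs]) (auto simp: gauss_minus)
  hence G2: "(\<integral>\<^sup>+y. gauss m (\<Phi> y) \<partial>?L) * (\<integral>\<^sup>+u. gauss m (?X u) \<partial>?L)
      = ennreal (?p / (\<Prod>j<m. r j j)) * ennreal ?p"
    by (simp add: G1 nn_integral_gauss)
  have \<rho>: "(\<Prod>j<m. r j j) \<ge> sqrt (fact m)"
    unfolding prod_sqrt_fact[symmetric] using x by (intro prod_mono) auto
  show thesis
  proof (rule that[of x])
    show "x i \<in> E" if "i < m" for i using x that by simp
    show "fat_family m E x" unfolding fat_family_def
    proof (intro ballI allI impI)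
    fix A c and \<kappa> :: real
    assume A [measurable]: "A \<in> sets ?L" and c: "c \<in> Rn m" and \<kappa>: "\<kappa> \<ge> 0"
      and sub: "(\<lambda>u. c + lincomb m x u) ` cube m \<kappa> \<subseteq> A"
    \<comment> \<open>With the indicator of \<open>A\<close> as \<open>f\<close>, the volume of
      \<open>A\<close> is compared with the volume of the parameters \<open>u\<close> that are
      mapped into \<open>A\<close>.\<close>
    have "(\<integral>\<^sup>+u. indicator A (c + ?X u) \<partial>?L) * (\<integral>\<^sup>+y. gauss m y \<partial>?L)
         = (\<integral>\<^sup>+y. indicator A y \<partial>?L) * (\<integral>\<^sup>+u. gauss m (?X u) \<partial>?L)"
      by (rule nn_integral_linear_change[OF Xlin Xm Xs c borel_measurable_indicator[OF A]
            measurable_gauss gauss_minus])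
    hence eq: "(\<integral>\<^sup>+u. indicator A (c + ?X u) \<partial>?L) * ennreal ?p
         = emeasure ?L A * (\<integral>\<^sup>+u. gauss m (?X u) \<partial>?L)"
      unfolding nn_integral_gauss nn_integral_indicator[OF A] .
    have "ennreal (\<kappa> ^ m) = (\<integral>\<^sup>+u. indicator (cube m \<kappa>) u \<partial>?L)"
      unfolding cube_def nn_integral_indicator[OF box_Rn(1)[OF \<kappa>]] box_Rn(2)[OF \<kappa>] by simp
    also have "\<dots> \<le> (\<integral>\<^sup>+u. indicator A (c + ?X u) \<partial>?L)"
    proof (rule nn_integral_mono)
      fix u show "indicator (cube m \<kappa>) u \<le> (indicator A (c + ?X u) :: ennreal)"
        using sub by (cases "u \<in> cube m \<kappa>") auto
    qed
    finally have "ennreal (\<kappa> ^ m) * ennreal ?p \<le> emeasure ?L A * (\<integral>\<^sup>+u. gauss m (?X u) \<partial>?L)"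
      unfolding eq[symmetric] by (rule mult_right_mono) simp
    from ennreal_combine[OF this G2 jensen _ _ _ _ \<rho>] \<kappa>
    show "ennreal (\<kappa> ^ m * parallelepiped_const m) * emeasure ?L E \<le> emeasure ?L A"
      by (simp add: parallelepiped_const_def)
    qed
  qed
qed

section \<open>Sections by flats\<close>

text \<open>A set of the completion is \<open>S \<union> N\<close> with \<open>N\<close> inside a
  null set \<open>N'\<close>; the two Borel sets come from \<open>S\<close> and
  \<open>S \<union> N'\<close>. Fubini arguments about \<open>K\<close> are run on them.\<close>

lemma Lebesgue_sandwich:
  assumes "K \<in> sets (lebesgue_Rn n)"
  obtains A A' where "A \<in> sets (borel_Rn n)" "A' \<in> sets (borel_Rn n)" "A \<subseteq> K" "K \<subseteq> A'"
    "emeasure (borel_Rn n) (A' - A) = 0"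
    "emeasure (lebesgue_Rn n) K = emeasure (borel_Rn n) A"
    "emeasure (lebesgue_Rn n) K = emeasure (borel_Rn n) A'"
proof -
  let ?P = "Pi\<^sub>M {..<n} (\<lambda>_. lborel :: real measure)"
  have L: "lebesgue_Rn n = embed_measure (completion ?P) (of_coords n)"
    by (simp add: lebesgue_Rn_def of_coords_def[abs_def])
  have inj: "inj_on (of_coords n) (space (completion ?P))" using inj_on_of_coords by simp
  obtain K0 where K0: "K0 \<in> sets (completion ?P)" "K = of_coords n ` K0"
    using assms unfolding L sets_embed_measure'[OF inj] by auto
  obtain S N N' where SN: "K0 = S \<union> N" "N \<subseteq> N'" "N' \<in> null_sets ?P" "S \<in> sets ?P"
    using K0(1) by (rule sets_completionE)
  define A A' where "A = of_coords n ` S" and "A' = of_coords n ` (S \<union> N')"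
  have S': "S \<union> N' \<in> sets ?P" using SN by auto
  have A: "A \<in> sets (borel_Rn n)" "emeasure (borel_Rn n) A = emeasure ?P S"
    using SN(4) by (simp_all add: A_def borel_Rn_def in_sets_embed_measure
      emeasure_embed_measure_image'[OF inj_on_of_coords])
  have A': "A' \<in> sets (borel_Rn n)" "emeasure (borel_Rn n) A' = emeasure ?P (S \<union> N')"
    using S' by (simp_all add: A'_def borel_Rn_def in_sets_embed_measure
      emeasure_embed_measure_image'[OF inj_on_of_coords])
  have SN': "emeasure ?P (S \<union> N') = emeasure ?P S" using SN by (simp add: emeasure_Un_null_set)
  have "A' - A \<subseteq> of_coords n ` N'" by (auto simp: A_def A'_def)
  moreover have "emeasure (borel_Rn n) (of_coords n ` N') = 0" "of_coords n ` N' \<in> sets (borel_Rn n)"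
    using null_setsD1[OF SN(3)] null_setsD2[OF SN(3)]
    by (simp_all add: borel_Rn_def in_sets_embed_measure
      emeasure_embed_measure_image'[OF inj_on_of_coords])
  ultimately have "emeasure (borel_Rn n) (A' - A) \<le> 0"
    using emeasure_mono[of "A' - A" "of_coords n ` N'" "borel_Rn n"] by simp
  moreover have "emeasure (lebesgue_Rn n) K = emeasure ?P S"
  proof -
    have "emeasure (lebesgue_Rn n) K = emeasure (completion ?P) K0"
      unfolding L K0(2) by (rule emeasure_embed_measure_image'[OF inj K0(1)])
    also have "\<dots> = emeasure ?P S"
    proof (rule antisym)
      have "emeasure (completion ?P) K0 \<le> emeasure (completion ?P) (S \<union> N')"
        using SN S' by (intro emeasure_mono) auto
      thus "emeasure (completion ?P) K0 \<le> emeasure ?P S" using S' SN' by simp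
      have "emeasure (completion ?P) S \<le> emeasure (completion ?P) K0"
        using SN K0(1) by (intro emeasure_mono) auto
      thus "emeasure ?P S \<le> emeasure (completion ?P) K0" using SN(4) by simp
    qed
    finally show ?thesis .
  qed
  ultimately show thesis
    using A A' SN SN' K0(2) by (intro that[of A A']) (auto simp: A_def A'_def)
qed

lemma slice_measurable:
  assumes T: "T \<in> borel_Rn m \<rightarrow>\<^sub>M borel_Rn n" and A: "A \<in> sets (borel_Rn n)" and y: "y \<in> Rn n"
  shows "{u \<in> Rn m. y + T u \<in> A} \<in> sets (borel_Rn m)"
proof -
  have "(\<lambda>_. y) \<in> borel_Rn m \<rightarrow>\<^sub>M borel_Rn n" using y by simp
  hence "(\<lambda>u. y + T u) -` A \<inter> space (borel_Rn m) \<in> sets (borel_Rn m)"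
    by (intro measurable_sets[OF measurable_add_Rn[OF _ T] A])
  also have "(\<lambda>u. y + T u) -` A \<inter> space (borel_Rn m) = {u \<in> Rn m. y + T u \<in> A}" by auto
  finally show ?thesis .
qed

text \<open>Fubini and translation invariance replace a decomposition of the space along a subspace.\<close>

lemma nn_integral_slices:
  assumes T [measurable]: "T \<in> borel_Rn m \<rightarrow>\<^sub>M borel_Rn n"
    and A [measurable]: "A \<in> sets (borel_Rn n)" and h [measurable]: "h \<in> borel_measurable (borel_Rn n)"
  shows "(\<lambda>y. emeasure (borel_Rn m) {u \<in> Rn m. y + T u \<in> A}) \<in> borel_measurable (borel_Rn n)"
    and "(\<integral>\<^sup>+y. h y * emeasure (borel_Rn m) {u \<in> Rn m. y + T u \<in> A} \<partial>borel_Rn n)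
       = (\<integral>\<^sup>+u. (\<integral>\<^sup>+y. h y * indicator A (y + T u) \<partial>borel_Rn n) \<partial>borel_Rn m)"
proof -
  let ?Ln = "borel_Rn n" and ?Lm = "borel_Rn m"
  interpret n: sigma_finite_measure ?Ln by (rule sigma_finite_borel_Rn)
  interpret m: sigma_finite_measure ?Lm by (rule sigma_finite_borel_Rn)
  interpret pair_sigma_finite ?Lm ?Ln by standard
  have ind: "emeasure ?Lm {u \<in> Rn m. y + T u \<in> A} = (\<integral>\<^sup>+u. indicator A (y + T u) \<partial>?Lm)"
    if "y \<in> Rn n" for y
  proof -
    have "(\<integral>\<^sup>+u. indicator A (y + T u) \<partial>?Lm) = (\<integral>\<^sup>+u. indicator {u \<in> Rn m. y + T u \<in> A} u \<partial>?Lm)"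
      by (rule nn_integral_cong) (simp add: indicator_def)
    thus ?thesis using nn_integral_indicator[OF slice_measurable[OF T A that]] by simp
  qed
  have [measurable]: "(\<lambda>(y, u). indicator A (y + T u) :: ennreal) \<in> borel_measurable (?Ln \<Otimes>\<^sub>M ?Lm)"
    by measurable
  have "(\<lambda>y. \<integral>\<^sup>+u. indicator A (y + T u) \<partial>?Lm) \<in> borel_measurable ?Ln" by measurable
  thus "(\<lambda>y. emeasure ?Lm {u \<in> Rn m. y + T u \<in> A}) \<in> borel_measurable ?Ln"
    using ind by (subst measurable_cong[where g="\<lambda>y. \<integral>\<^sup>+u. indicator A (y + T u) \<partial>?Lm"]) auto
  have "(\<integral>\<^sup>+y. h y * emeasure ?Lm {u \<in> Rn m. y + T u \<in> A} \<partial>?Ln)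
      = (\<integral>\<^sup>+y. (\<integral>\<^sup>+u. h y * indicator A (y + T u) \<partial>?Lm) \<partial>?Ln)"
  proof (rule nn_integral_cong)
    fix y assume y: "y \<in> space ?Ln"
    hence "(\<lambda>_. y) \<in> ?Lm \<rightarrow>\<^sub>M ?Ln" by simp
    note [measurable] = measurable_add_Rn[OF this T]
    show "h y * emeasure ?Lm {u \<in> Rn m. y + T u \<in> A} = (\<integral>\<^sup>+u. h y * indicator A (y + T u) \<partial>?Lm)"
      using y ind[of y] by (subst nn_integral_cmult) auto
  qed
  also have "\<dots> = (\<integral>\<^sup>+u. (\<integral>\<^sup>+y. h y * indicator A (y + T u) \<partial>?Ln) \<partial>?Lm)"
    by (rule Fubini') measurable
  finally show "(\<integral>\<^sup>+y. h y * emeasure ?Lm {u \<in> Rn m. y + T u \<in> A} \<partial>?Ln)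
       = (\<integral>\<^sup>+u. (\<integral>\<^sup>+y. h y * indicator A (y + T u) \<partial>?Ln) \<partial>?Lm)" .
qed

text \<open>By \<open>nn_integral_slices\<close> the slice measures integrate to the integral over
  \<open>u\<close> of translates of \<open>N\<close>, each of measure zero. Applied to
  \<open>A' - A\<close>, it makes slices of sandwiched sets measurable for almost every
  translate.\<close>

lemma AE_slice_null:
  assumes T: "T \<in> borel_Rn m \<rightarrow>\<^sub>M borel_Rn n"
    and N: "N \<in> sets (borel_Rn n)" "emeasure (borel_Rn n) N = 0"
  shows "AE y in borel_Rn n. emeasure (borel_Rn m) {u \<in> Rn m. y + T u \<in> N} = 0"
proof -
  have "(\<integral>\<^sup>+y. emeasure (borel_Rn m) {u \<in> Rn m. y + T u \<in> N} \<partial>borel_Rn n)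
     = (\<integral>\<^sup>+u. (\<integral>\<^sup>+y. indicator N (y + T u) \<partial>borel_Rn n) \<partial>borel_Rn m)"
    using nn_integral_slices(2)[OF T N(1), of "\<lambda>_. 1"] by simp
  also have "\<dots> = (\<integral>\<^sup>+u. 0 \<partial>borel_Rn m)"
  proof (rule nn_integral_cong)
    fix u assume "u \<in> space (borel_Rn m)"
    hence "T u \<in> Rn n" using measurable_space[OF T] by simp
    from nn_integral_translate[OF borel_measurable_indicator[OF N(1)] this]
    show "(\<integral>\<^sup>+y. indicator N (y + T u) \<partial>borel_Rn n) = 0" using N by (simp add: add.commute)
  qed
  finally have "(\<integral>\<^sup>+y. emeasure (borel_Rn m) {u \<in> Rn m. y + T u \<in> N} \<partial>borel_Rn n) = 0" by simp
  thus ?thesis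
    by (subst (asm) nn_integral_0_iff_AE[OF nn_integral_slices(1)[OF T N(1) borel_measurable_const]]) simp
qed

section \<open>Charts for the flats parallel to a subspace\<close>

context
  fixes n :: nat and H :: "seq set"
  assumes H: "H \<subseteq> Rn n" "subspace H"
begin

text \<open>The basis is the one chosen in \<open>flat_lebesgue\<close>, so this is the chart of
  that measure in coordinates of type \<open>seq\<close>.\<close>

definition "flat_param = lincomb (dim H) (SOME b. orthonormal_basis n H b)"

lemma some_basis:
  defines "b \<equiv> SOME b. orthonormal_basis n H b"
  shows "orthonormal_wrt (dotp n) (dim H) b" "span (b ` {..<dim H}) = H" "i < dim H \<Longrightarrow> b i \<in> H"
proof -
  have "orthonormal_basis n H b"
    unfolding b_def by (rule someI_ex[OF orthonormal_basis_exists[OF H]])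
  thus "orthonormal_wrt (dotp n) (dim H) b" "span (b ` {..<dim H}) = H"
    by (auto simp: orthonormal_basis_def orthonormal_wrt_def)
  thus "i < dim H \<Longrightarrow> b i \<in> H" by (auto intro: span_base)
qed

lemma linear_flat_param: "linear flat_param"
  unfolding flat_param_def by (rule linear_lincomb)

lemma measurable_flat_param: "flat_param \<in> borel_Rn (dim H) \<rightarrow>\<^sub>M borel_Rn n"
  unfolding flat_param_def by (rule measurable_lincomb) (use some_basis(3) H in auto)

lemma inj_on_flat_param: "inj_on flat_param (Rn (dim H))"
proof (rule inj_onI)
  let ?b = "SOME b. orthonormal_basis n H b"
  fix u v assume uv: "u \<in> Rn (dim H)" "v \<in> Rn (dim H)" and eq: "flat_param u = flat_param v"
  have "dotp n (flat_param w) (?b i) = lk w i" if "i < dim H" for i w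
    using dotp.orthonormal_comb(2)[OF some_basis(1), of "{..<dim H}" i "lk w"] that
    by (simp add: flat_param_def lincomb_def)
  with eq have "lk u i = lk v i" if "i < dim H" for i using that by metis
  with uv show "u = v" by (rule Rn_eqI)
qed

lemma flat_param_image: "flat_param ` Rn (dim H) = H"
proof
  let ?b = "SOME b. orthonormal_basis n H b"
  show "flat_param ` Rn (dim H) \<subseteq> H"
    unfolding flat_param_def lincomb_def using some_basis(3)
    by (auto intro!: subspace_sum[OF H(2)] subspace_scale[OF H(2)])
  show "H \<subseteq> flat_param ` Rn (dim H)"
  proof
    fix x assume x: "x \<in> H"
    have inj: "inj_on ?b {..<dim H}"
      by (rule orthonormal_independent(2)[of _ n]) (use some_basis(1) in \<open>simp add: orthonormal_wrt_def\<close>)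
    obtain c where "x = (\<Sum>v\<in>?b ` {..<dim H}. c v *\<^sub>R v)"
      using x some_basis(2) by (auto simp: span_finite)
    hence "x = flat_param (of_coords (dim H) (\<lambda>i. c (?b i)))"
      by (simp add: sum.reindex[OF inj] flat_param_def lincomb_def lookup_of_coords)
    thus "x \<in> flat_param ` Rn (dim H)" by (rule image_eqI) simp
  qed
qed

lemma flat_param_in: "u \<in> Rn (dim H) \<Longrightarrow> flat_param u \<in> H"
  using imageI[of u "Rn (dim H)" flat_param] by (simp only: flat_param_image)

lemma flat_lebesgue_eq:
  "flat_lebesgue n H y = embed_measure (completion (Pi\<^sub>M {..<dim H} (\<lambda>_. lborel)))
     (\<lambda>u. y + flat_param (of_coords (dim H) u))"
  by (simp add: flat_lebesgue_def Let_def flat_param_def lincomb_def lookup_of_coords)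

lemma inj_on_flat_chart:
  "inj_on (\<lambda>u. y + flat_param (of_coords (dim H) u)) (space (Pi\<^sub>M {..<dim H} (\<lambda>_. lborel)))"
  using inj_on_of_coords[of "dim H"] inj_on_flat_param by (auto simp: inj_on_def)

text \<open>The preimage of \<open>K\<close> under the chart need not be Borel. The sandwich puts it
  into the completion, where its measure is that of either bound.\<close>

lemma emeasure_flat_lebesgue:
  assumes C: "C \<in> sets (borel_Rn (dim H))" "C' \<in> sets (borel_Rn (dim H))"
      "C \<subseteq> {u \<in> Rn (dim H). y + flat_param u \<in> K}" "{u \<in> Rn (dim H). y + flat_param u \<in> K} \<subseteq> C'"
    and null: "emeasure (borel_Rn (dim H)) (C' - C) = 0"
  shows "emeasure (flat_lebesgue n H y) (K \<inter> ((\<lambda>h. h + y) ` H)) = emeasure (borel_Rn (dim H)) C'"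
proof -
  let ?P = "Pi\<^sub>M {..<dim H} (\<lambda>_. lborel :: real measure)" and ?L = "borel_Rn (dim H)"
  let ?pre = "\<lambda>C. of_coords (dim H) -` C \<inter> space ?P"
  let ?\<phi> = "\<lambda>u. y + flat_param (of_coords (dim H) u)"
  define W where "W = {u \<in> space ?P. ?\<phi> u \<in> K}"
  have inj: "inj_on ?\<phi> (space (completion ?P))" using inj_on_flat_chart by simp
  have pre: "?pre D \<in> sets ?P" "emeasure ?P (?pre D) = emeasure ?L D" if "D \<in> sets ?L" for D
    using that by (auto intro: measurable_sets[OF measurable_of_coords] simp: emeasure_borel_Rn)
  have sub: "?pre C \<subseteq> W" "W \<subseteq> ?pre C'"
  proof -
    show "?pre C \<subseteq> W" using C(3) by (auto simp: W_def)
    show "W \<subseteq> ?pre C'"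
    proof
      fix u assume u: "u \<in> W"
      hence "of_coords (dim H) u \<in> C'" by (intro subsetD[OF C(4)]) (simp add: W_def)
      thus "u \<in> ?pre C'" using u by (simp add: W_def)
    qed
  qed
  have N: "?pre C' - ?pre C \<in> null_sets ?P"
  proof -
    have "?pre C' - ?pre C = ?pre (C' - C)" by auto
    thus ?thesis using pre[of "C' - C"] C null by (auto simp: null_sets_def)
  qed
  have W: "W \<in> sets (completion ?P)"
    by (rule sets_completionI[OF _ _ N pre(1)[OF C(1)], where N="W - ?pre C"]) (use sub in auto)
  have "K \<inter> ((\<lambda>h. h + y) ` H) = ?\<phi> ` W"
  proof
    show "?\<phi> ` W \<subseteq> K \<inter> ((\<lambda>h. h + y) ` H)"
    proof (clarify, intro IntI)
      fix u assume u: "u \<in> W"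
      have "flat_param (of_coords (dim H) u) \<in> H" by (simp add: flat_param_in)
      thus "?\<phi> u \<in> (\<lambda>h. h + y) ` H" by (rule image_eqI[rotated]) (simp add: add.commute)
    qed (simp add: W_def)
    show "K \<inter> ((\<lambda>h. h + y) ` H) \<subseteq> ?\<phi> ` W"
    proof safe
      fix h assume h: "h + y \<in> K" "h \<in> H"
      have "h \<in> flat_param ` Rn (dim H)" using h(2) by (simp only: flat_param_image)
      then obtain u where u: "u \<in> Rn (dim H)" "h = flat_param u" by (elim imageE)
      have "u \<in> of_coords (dim H) ` space ?P" using u(1) by (simp only: of_coords_image)
      then obtain v where v: "v \<in> space ?P" "u = of_coords (dim H) v" by (elim imageE)
      show "h + y \<in> ?\<phi> ` W"
        using u v h by (intro image_eqI[of _ _ v]) (auto simp: W_def add.commute)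
    qed
  qed
  hence "emeasure (flat_lebesgue n H y) (K \<inter> ((\<lambda>h. h + y) ` H)) = emeasure (completion ?P) W"
    unfolding flat_lebesgue_eq by (simp add: emeasure_embed_measure_image'[OF inj W])
  also have "\<dots> = emeasure ?L C'"
  proof (rule antisym)
    have "emeasure (completion ?P) W \<le> emeasure (completion ?P) (?pre C')"
      using sub pre(1)[OF C(2)] by (intro emeasure_mono) auto
    thus "emeasure (completion ?P) W \<le> emeasure ?L C'" using pre[OF C(2)] by simp
    have "emeasure ?L C' \<le> emeasure ?L (C \<union> (C' - C))" using C by (intro emeasure_mono) auto
    also have "\<dots> = emeasure ?L C" using C null by (subst emeasure_Un_null_set) (auto simp: null_sets_def)
    also have "\<dots> = emeasure (completion ?P) (?pre C)" using pre[OF C(1)] by simp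
    also have "\<dots> \<le> emeasure (completion ?P) W" using sub W by (intro emeasure_mono)
    finally show "emeasure ?L C' \<le> emeasure (completion ?P) W" .
  qed
  finally show ?thesis .
qed

text \<open>The slices of \<open>A\<close> and \<open>A'\<close> sandwich the slice of
  \<open>K\<close>, and they differ by a null set for almost every \<open>y\<close>. Nothing is
  claimed about the exceptional translates.\<close>

lemma AE_emeasure_flat_lebesgue:
  assumes A: "A \<in> sets (borel_Rn n)" "A' \<in> sets (borel_Rn n)" "A \<subseteq> K" "K \<subseteq> A'"
    "emeasure (borel_Rn n) (A' - A) = 0"
  shows "AE y in borel_Rn n. emeasure (flat_lebesgue n H y) (K \<inter> ((\<lambda>h. h + y) ` H))
      = emeasure (borel_Rn (dim H)) {u \<in> Rn (dim H). y + flat_param u \<in> A'}"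
proof -
  note T = measurable_flat_param
  have "AE y in borel_Rn n. y \<in> Rn n" using AE_space[of "borel_Rn n"] by simp
  moreover have "A' - A \<in> sets (borel_Rn n)" using A by simp
  note AE_slice_null[OF T this A(5)]
  ultimately show ?thesis
  proof eventually_elim
    case (elim y)
    let ?s = "\<lambda>A. {u \<in> Rn (dim H). y + flat_param u \<in> A}"
    have "?s A' - ?s A = ?s (A' - A)" by auto
    with elim A show ?case
      by (intro emeasure_flat_lebesgue[of "?s A"] slice_measurable[OF T]) auto
  qed
qed

text \<open>The difference function is a supremum over uncountably many pairs, so \<open>F\<close>
  is not assumed measurable. Its integral is a supremum over simple minorants, hence a bound for all
  Borel minorants in coordinates is enough.\<close>

lemma nn_integral_flat_le:
  assumes le: "\<And>g. g \<in> borel_measurable (borel_Rn (dim H)) \<Longrightarrow>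
     (\<And>u. u \<in> Rn (dim H) \<Longrightarrow> g u \<le> F (flat_param u)) \<Longrightarrow> (\<integral>\<^sup>+u. g u \<partial>borel_Rn (dim H)) \<le> Z"
  shows "(\<integral>\<^sup>+x. F x \<partial>flat_lebesgue n H 0) \<le> Z"
proof -
  let ?P = "Pi\<^sub>M {..<dim H} (\<lambda>_. lborel :: real measure)" and ?L = "borel_Rn (dim H)"
  let ?\<phi> = "\<lambda>u. 0 + flat_param (of_coords (dim H) u)"
  have inj: "inj_on ?\<phi> (space (completion ?P))" using inj_on_flat_chart[of 0] by simp
  have "integral\<^sup>S (flat_lebesgue n H 0) g \<le> Z"
    if g: "simple_function (flat_lebesgue n H 0) g" "g \<le> F" for g
  proof -
    have "integral\<^sup>S (flat_lebesgue n H 0) g = (\<integral>\<^sup>+x. g x \<partial>flat_lebesgue n H 0)"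
      by (rule nn_integral_eq_simple_integral[OF g(1), symmetric])
    also have "\<dots> = (\<integral>\<^sup>+u. g (?\<phi> u) \<partial>completion ?P)"
      unfolding flat_lebesgue_eq
      by (rule nn_integral_embed_measure'[OF inj])
         (use borel_measurable_simple_function[OF g(1)] in \<open>simp add: flat_lebesgue_eq\<close>)
    \<comment> \<open>The integrand on the right need not be \<open>?P\<close>-measurable, which is
      why simple minorants are taken a second time.\<close>
    also have "\<dots> = (\<integral>\<^sup>+u. g (?\<phi> u) \<partial>?P)" by (rule nn_integral_completion)
    also have "\<dots> \<le> Z"
      unfolding nn_integral_def[of ?P]
    proof (rule SUP_least, clarify)
      fix h assume h: "simple_function ?P h" "h \<le> (\<lambda>u. g (?\<phi> u))"
      let ?r = "\<lambda>x. \<lambda>i\<in>{..<dim H}. lk x i"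
      have hm: "h \<in> borel_measurable ?P" using h(1) by (rule borel_measurable_simple_function)
      have "?r \<in> ?L \<rightarrow>\<^sub>M ?P" by (intro measurable_restrict) simp
      hence hr: "(\<lambda>x. h (?r x)) \<in> borel_measurable ?L" using hm by (rule measurable_compose)
      have "integral\<^sup>S ?P h = (\<integral>\<^sup>+u. h u \<partial>?P)" by (rule nn_integral_eq_simple_integral[OF h(1), symmetric])
      also have "\<dots> = (\<integral>\<^sup>+u. h (?r (of_coords (dim H) u)) \<partial>?P)"
      proof (rule nn_integral_cong)
        fix u assume "u \<in> space ?P"
        hence "?r (of_coords (dim H) u) = u"
          by (auto simp: space_PiM PiE_def extensional_def lookup_of_coords)
        thus "h u = h (?r (of_coords (dim H) u))" by simp
      qed
      also have "\<dots> = (\<integral>\<^sup>+x. h (?r x) \<partial>?L)" by (rule nn_integral_borel_Rn[OF hr, symmetric])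
      also have "\<dots> \<le> Z"
      proof (rule le[OF hr])
        fix u assume u: "u \<in> Rn (dim H)"
        have "of_coords (dim H) (?r u) = u" using u by (intro Rn_eqI) (auto simp: lookup_of_coords)
        thus "h (?r u) \<le> F (flat_param u)"
          using order_trans[OF le_funD[OF h(2), of "?r u"] le_funD[OF g(2)]] by simp
      qed
      finally show "integral\<^sup>S ?P h \<le> Z" .
    qed
    finally show ?thesis .
  qed
  thus ?thesis unfolding nn_integral_def[of "flat_lebesgue n H 0"] by (intro SUP_least) auto
qed

end

section \<open>Rudelson's estimate for convex sets\<close>

lemma parallelepiped_const_pos: "parallelepiped_const m > 0"
  by (simp add: parallelepiped_const_def)

text \<open>Continuity from below along cubes of integer size. It reduces the estimates to bounded
  sets, where the second moments of the isotropic position exist.\<close>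

lemma emeasure_le_of_bounded_parts:
  assumes E: "E \<in> sets (borel_Rn m)"
    and le: "\<And>R. emeasure (borel_Rn m) {x \<in> E. \<forall>i<m. \<bar>lk x i\<bar> \<le> R} \<le> Z"
  shows "emeasure (borel_Rn m) E \<le> Z"
proof -
  let ?F = "\<lambda>k::nat. {x \<in> E. \<forall>i<m. \<bar>lk x i\<bar> \<le> real k}"
  have ER: "E \<subseteq> Rn m" using sets.sets_into_space[OF E] by simp
  have F: "?F k \<in> sets (borel_Rn m)" for k
  proof -
    have "{x \<in> space (borel_Rn m). \<forall>i\<in>{..<m}. \<bar>lk x i\<bar> \<le> real k} \<in> sets (borel_Rn m)"
      by measurable
    moreover have "?F k = E \<inter> {x \<in> space (borel_Rn m). \<forall>i\<in>{..<m}. \<bar>lk x i\<bar> \<le> real k}"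
      using ER by auto
    ultimately show ?thesis using E by auto
  qed
  have un: "E = (\<Union>k. ?F k)"
  proof
    show "E \<subseteq> (\<Union>k. ?F k)"
    proof
      fix x assume x: "x \<in> E"
      obtain k :: nat where k: "(\<Sum>i<m. \<bar>lk x i\<bar>) \<le> real k" using real_arch_simple by blast
      have "\<bar>lk x i\<bar> \<le> real k" if "i < m" for i
      proof -
        have "\<bar>lk x i\<bar> \<le> (\<Sum>i<m. \<bar>lk x i\<bar>)"
          using that by (intro member_le_sum) auto
        with k show ?thesis by simp
      qed
      with x show "x \<in> (\<Union>k. ?F k)" by auto
    qed
  qed auto
  have inc: "incseq ?F"
    by (rule monoI) (auto intro: order_trans)
  have "(SUP k. emeasure (borel_Rn m) (?F k)) = emeasure (borel_Rn m) (\<Union>k. ?F k)"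
    by (rule SUP_emeasure_incseq[OF _ inc]) (use F in blast)
  hence "emeasure (borel_Rn m) E = (SUP k. emeasure (borel_Rn m) (?F k))"
    using un by argo
  also have "\<dots> \<le> Z" by (intro SUP_least le)
  finally show ?thesis .
qed

lemma bounded_part_measurable:
  assumes E: "E \<in> sets (borel_Rn m)"
  shows "{x \<in> E. \<forall>i<m. \<bar>lk x i\<bar> \<le> R} \<in> sets (borel_Rn m)"
    and "emeasure (borel_Rn m) {x \<in> E. \<forall>i<m. \<bar>lk x i\<bar> \<le> R} \<noteq> \<infinity>"
proof -
  let ?B = "{x \<in> Rn m. \<forall>i<m. lk x i \<in> {- \<bar>R\<bar>..\<bar>R\<bar>}}"
  let ?D = "{x \<in> Rn m. \<forall>i\<in>{..<m}. \<bar>lk x i\<bar> \<le> R}"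
  have ER: "E \<subseteq> Rn m" using sets.sets_into_space[OF E] by simp
  have "{x \<in> space (borel_Rn m). \<forall>i\<in>{..<m}. \<bar>lk x i\<bar> \<le> R} \<in> sets (borel_Rn m)"
    by measurable
  moreover have "{x \<in> E. \<forall>i<m. \<bar>lk x i\<bar> \<le> R} = E \<inter> ?D" using ER by auto
  ultimately show *: "{x \<in> E. \<forall>i<m. \<bar>lk x i\<bar> \<le> R} \<in> sets (borel_Rn m)"
    using E by auto
  have neg: "- \<bar>R\<bar> \<le> \<bar>R\<bar>" by simp
  have "{x \<in> E. \<forall>i<m. \<bar>lk x i\<bar> \<le> R} \<subseteq> ?B"
  proof (intro subsetI CollectI conjI allI impI)
    fix x i assume x: "x \<in> {x \<in> E. \<forall>i<m. \<bar>lk x i\<bar> \<le> R}"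
    thus "x \<in> Rn m" using ER by auto
    assume "i < m"
    with x have "\<bar>lk x i\<bar> \<le> R" by simp
    thus "lk x i \<in> {- \<bar>R\<bar>..\<bar>R\<bar>}" by auto
  qed
  hence "emeasure (borel_Rn m) {x \<in> E. \<forall>i<m. \<bar>lk x i\<bar> \<le> R} \<le> emeasure (borel_Rn m) ?B"
    by (rule emeasure_mono[OF _ box_Rn(1)[OF neg]])
  also have "\<dots> < \<infinity>" unfolding box_Rn(2)[OF neg] by simp
  finally show "emeasure (borel_Rn m) {x \<in> E. \<forall>i<m. \<bar>lk x i\<bar> \<le> R} \<noteq> \<infinity>" by simp
qed

text \<open>
  If \<open>T (x i) = a i - b i\<close>, then the segments from \<open>b i\<close> to \<open>a i\<close>, averaged with weight \<open>1 / m\<close>,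
  form a parallelepiped inside \<open>K\<close> that is parallel to the image of \<open>T\<close>.
\<close>

lemma parallelepiped_in_convex:
  assumes K: "convex K" "K \<subseteq> Rn n" and T: "linear T" and m: "m \<ge> 1"
    and x: "\<And>i. i < m \<Longrightarrow> \<exists>a\<in>K. \<exists>b\<in>K. T (x i) = a - b"
  obtains y where "y \<in> Rn n"
    "(\<lambda>u. y + T (lincomb m x u)) ` cube m (1 / real m) \<subseteq> K"
proof -
  obtain a b where ab: "\<And>i. i < m \<Longrightarrow> a i \<in> K \<and> b i \<in> K \<and> T (x i) = a i - b i"
    using x by metis
  define y where "y = (\<Sum>i<m. (1 / real m) *\<^sub>R b i)"
  have "y \<in> Rn n" using ab K(2) by (auto simp: y_def)
  moreover have "y + T (lincomb m x u) \<in> K" if u: "u \<in> cube m (1 / real m)" for u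
  proof -
    \<comment> \<open>The relative position on the \<open>i\<close>-th segment, from
      \<open>b i\<close> at 0 to \<open>a i\<close> at 1. The averaging weight \<open>1 / m\<close>
      explains the edge of the cube.\<close>
    let ?s = "\<lambda>i. real m * lk u i"
    have s: "0 \<le> ?s i" "?s i \<le> 1" if "i < m" for i
    proof -
      have "0 \<le> lk u i" "lk u i \<le> 1 / real m" using u that by (auto simp: cube_def)
      thus "0 \<le> ?s i" "?s i \<le> 1" using m by (simp_all add: field_simps)
    qed
    have "y + T (lincomb m x u) = (\<Sum>i<m. (1 / real m) *\<^sub>R ((1 - ?s i) *\<^sub>R b i + ?s i *\<^sub>R a i))"
      unfolding y_def lincomb_def linear_sum[OF T] linear_scale[OF T] sum.distrib[symmetric]
    proof (rule sum.cong)
      fix i assume "i \<in> {..<m}"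
      with ab have eq: "T (x i) = a i - b i" by simp
      show "(1 / real m) *\<^sub>R b i + lk u i *\<^sub>R T (x i)
          = (1 / real m) *\<^sub>R ((1 - ?s i) *\<^sub>R b i + ?s i *\<^sub>R a i)"
        unfolding eq using m by (simp add: algebra_simps)
    qed simp
    also have "\<dots> \<in> K"
    proof (rule convex_sum[OF _ K(1)])
      show "(1 - ?s i) *\<^sub>R b i + ?s i *\<^sub>R a i \<in> K" if "i \<in> {..<m}" for i
        using that ab[of i] s[of i] by (intro convexD_alt[OF K(1)]) auto
    qed (use m in auto)
    finally show ?thesis .
  qed
  ultimately show thesis by (intro that) auto
qed

text \<open>The left side compares one term of the exponential series at \<open>m\<close> with the
  whole sum.\<close>

lemma fact_lower_bound: "real m ^ m * exp (- real m) \<le> fact m"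
proof -
  have s: "(\<lambda>k. real m ^ k /\<^sub>R fact k) sums exp (real m)" by (rule exp_converges)
  have "(\<Sum>k\<in>{m}. real m ^ k /\<^sub>R fact k) \<le> suminf (\<lambda>k. real m ^ k /\<^sub>R fact k)"
    by (rule sum_le_suminf[OF sums_summable[OF s]]) simp_all
  hence "real m ^ m / fact m \<le> exp (real m)"
    unfolding sums_unique[OF s, symmetric] by (simp add: divide_inverse mult.commute)
  hence "real m ^ m \<le> exp (real m) * fact m" by (simp add: pos_divide_le_eq)
  hence "real m ^ m * exp (- real m) \<le> exp (real m) * fact m * exp (- real m)"
    by (rule mult_right_mono) simp
  also have "\<dots> = fact m" by (simp add: exp_minus)
  finally show ?thesis .
qed

text \<open>The factor 2 pays for halving the parallelepiped, \<open>sqrt (2 * pi)\<close> is the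
  Gaussian normalisation, and \<open>exp 1\<close> collects two factors \<open>exp (1/2)\<close>,
  from Jensen's inequality and from the factorial bound. The ratio estimate needs only
  \<open>2 * exp 1\<close>.\<close>

definition section_const :: real where "section_const = 2 * exp 1 * sqrt (2 * pi)"

lemma sqrt_const_bound:
  assumes m: "m \<ge> 1"
  shows "1 / ((1 / (2 * real m)) ^ m * parallelepiped_const m) \<le> (section_const * sqrt (real m)) ^ m"
proof -
  have pos: "0 < (1 / (2 * real m)) ^ m * parallelepiped_const m"
    using m parallelepiped_const_pos by (intro mult_pos_pos zero_less_power) auto
  have e: "sqrt (exp (- real m)) = exp (- real m / 2)"
    by (rule real_sqrt_unique) (simp_all add: power2_eq_square exp_add[symmetric])
  have "sqrt (real m) ^ m * exp (- real m / 2) = sqrt (real m ^ m * exp (- real m))"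
    by (simp add: real_sqrt_mult real_sqrt_power e)
  also have "\<dots> \<le> sqrt (fact m)" by (rule real_sqrt_le_mono[OF fact_lower_bound])
  finally have f: "sqrt (real m) ^ m * exp (- real m / 2) \<le> sqrt (fact m)" .
  have ee: "exp (1::real) ^ m * (exp (- real m / 2) * exp (- real m / 2)) = 1"
    by (simp add: exp_of_nat_mult[symmetric] exp_add[symmetric])
  have mm: "real m ^ m > 0" using m by simp
  have sm: "sqrt (real m) ^ m * sqrt (real m) ^ m = real m ^ m"
    by (simp add: power_mult_distrib[symmetric])
  \<comment> \<open>The number 1 is written with two factors \<open>exp (- real m / 2)\<close>: one
    is absorbed by the factorial bound \<open>f\<close>, the other belongs to
    \<open>parallelepiped_const\<close>.\<close>
  have "1 = (exp 1 ^ m * (exp (- real m / 2) * exp (- real m / 2))) * (sqrt (real m) ^ m * sqrt (real m) ^ m) / real m ^ m"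
    unfolding ee sm using mm by simp
  also have "\<dots> = exp 1 ^ m * sqrt (real m) ^ m * (sqrt (real m) ^ m * exp (- real m / 2)) * exp (- real m / 2) / real m ^ m"
    by (simp only: ac_simps)
  also have "\<dots> \<le> exp 1 ^ m * sqrt (real m) ^ m * sqrt (fact m) * exp (- real m / 2) / real m ^ m"
    using f mm by (intro divide_right_mono mult_right_mono mult_left_mono) simp_all
  also have "\<dots> = (2 ^ m * exp 1 ^ m * sqrt (2 * pi) ^ m * sqrt (real m) ^ m) *
        (1 / (2 ^ m * real m ^ m) * (sqrt (fact m) * exp (- real m / 2) / sqrt (2 * pi) ^ m))"
    by simp
  also have "\<dots> = (section_const * sqrt (real m)) ^ m * ((1 / (2 * real m)) ^ m * parallelepiped_const m)"
    by (simp add: section_const_def parallelepiped_const_def power_mult_distrib power_divide)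
  finally show ?thesis by (simp only: pos_divide_le_eq[OF pos])
qed

text \<open>This \<open>r\<close> maximises \<open>r ^ m * (1 - r) ^ n\<close>. As
  \<open>m \<le> n\<close>, \<open>1 / r\<close> is at most \<open>2 * n / m\<close>, and
  \<open>1 / (1 - r) = 1 + m / n\<close> has \<open>n\<close>-th power at most
  \<open>exp m\<close>.\<close>

lemma ratio_const_bound:
  assumes m: "1 \<le> m" "m \<le> n"
  defines "r \<equiv> real m / (real n + real m)"
  shows "0 < r" "r < 1" "1 / (r ^ m * (1 - r) ^ n) \<le> (section_const * (real n / real m)) ^ m"
proof -
  have n: "n > 0" using m by simp
  show r: "0 < r" "r < 1" using m by (auto simp: r_def field_simps)
  have "1 / r = (real n + real m) / real m" by (simp add: r_def)
  also have "\<dots> \<le> 2 * real n / real m" using m by (intro divide_right_mono) auto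
  finally have 1: "(1 / r) ^ m \<le> (2 * real n / real m) ^ m" using r by (intro power_mono) auto
  have "1 - r = real n / (real n + real m)" using m by (simp add: r_def field_simps)
  hence "1 / (1 - r) = (real n + real m) / real n" by simp
  hence "1 / (1 - r) = 1 + real m / real n" using n by (simp add: add_divide_distrib)
  hence 2: "(1 / (1 - r)) ^ n \<le> exp (real m)"
    using exp_ge_one_plus_x_over_n_power_n[of n "real m"] n by simp
  have "1 / (r ^ m * (1 - r) ^ n) = (1 / r) ^ m * (1 / (1 - r)) ^ n"
    by (simp add: power_divide)
  also have "\<dots> \<le> (2 * real n / real m) ^ m * exp (real m)"
    using 1 2 r by (intro mult_mono) auto
  also have "\<dots> = (2 * exp 1 * (real n / real m)) ^ m"
    by (simp add: power_mult_distrib power_divide exp_of_nat_mult[symmetric])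
  also have "\<dots> \<le> (section_const * (real n / real m)) ^ m"
  proof (intro power_mono mult_right_mono)
    have "1 \<le> sqrt (2 * pi)" using pi_gt3 by simp
    thus "2 * exp 1 \<le> section_const" by (simp add: section_const_def)
  qed auto
  finally show "1 / (r ^ m * (1 - r) ^ n) \<le> (section_const * (real n / real m)) ^ m" .
qed

lemma ennreal_le_of_mult:
  assumes "ennreal c * x \<le> S" "c > 0" "1 / c \<le> d"
  shows "x \<le> ennreal d * S"
proof -
  have "x = ennreal (1 / c) * (ennreal c * x)"
    using assms(2) by (simp add: mult.assoc[symmetric] ennreal_mult[symmetric])
  also have "\<dots> \<le> ennreal d * S"
    using assms(1,3) by (intro mult_mono ennreal_leI) auto
  finally show ?thesis .
qed

lemma AE_pos_measure_ex:
  assumes "AE y in M. P y" "A \<in> sets M" "emeasure M A \<noteq> 0"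
  shows "\<exists>y\<in>A. P y"
proof (rule ccontr)
  assume "\<not> ?thesis"
  hence "AE y in M. y \<notin> A" using assms(1) by (auto elim!: eventually_mono)
  hence "A \<in> null_sets M" using assms(2) by (simp add: AE_iff_null_sets)
  hence "emeasure M A = 0" by (rule null_setsD1)
  with assms(3) show False by simp
qed

section \<open>Differences of a convex set against its largest section\<close>

context
  fixes n :: nat and H K E :: "seq set"
  assumes H: "H \<subseteq> Rn n" "subspace H" and K: "K \<in> sets (lebesgue_Rn n)" "convex K" "K \<subseteq> Rn n"
    and E: "E \<in> sets (borel_Rn (dim H))"
      "\<And>u. u \<in> E \<Longrightarrow> \<exists>a\<in>K. \<exists>b\<in>K. flat_param n H u = a - b"
begin

abbreviation (input) max_section :: ennreal where
  "max_section \<equiv> (SUP y\<in>Rn n. emeasure (flat_lebesgue n H y) (K \<inter> ((\<lambda>h. h + y) ` H)))"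

lemma AE_slice_le_max_section:
  assumes A: "A \<in> sets (borel_Rn n)" "A' \<in> sets (borel_Rn n)" "A \<subseteq> K" "K \<subseteq> A'"
    "emeasure (borel_Rn n) (A' - A) = 0"
  shows "AE y in borel_Rn n. emeasure (borel_Rn (dim H)) {u \<in> Rn (dim H). y + flat_param n H u \<in> A'} \<le> max_section"
proof -
  have "AE y in borel_Rn n. y \<in> Rn n" using AE_space[of "borel_Rn n"] by simp
  with AE_emeasure_flat_lebesgue[OF H A] show ?thesis
  proof eventually_elim
    case (elim y)
    show ?case unfolding elim(1)[symmetric] by (rule SUP_upper) (rule elim(2))
  qed
qed

text \<open>The argument of Rogers and Shephard, with the volume of \<open>K \<inter> (K - x)\<close> as a function of \<open>x \<in> H\<close>.\<close>

lemma section_bound_ratio: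
  assumes V: "emeasure (lebesgue_Rn n) K \<noteq> 0" "emeasure (lebesgue_Rn n) K \<noteq> \<infinity>"
    and r: "0 < r" "r < 1"
  shows "ennreal (r ^ dim H * (1 - r) ^ n) * emeasure (borel_Rn (dim H)) E \<le> max_section"
proof -
  let ?m = "dim H" and ?T = "flat_param n H"
  let ?Ln = "borel_Rn n" and ?Lm = "borel_Rn (dim H)"
  obtain A A' where A: "A \<in> sets ?Ln" "A' \<in> sets ?Ln" "A \<subseteq> K" "K \<subseteq> A'" "emeasure ?Ln (A' - A) = 0"
    and VA: "emeasure (lebesgue_Rn n) K = emeasure ?Ln A" "emeasure (lebesgue_Rn n) K = emeasure ?Ln A'"
    by (rule Lebesgue_sandwich[OF K(1)])
  define v where "v = emeasure (lebesgue_Rn n) K"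
  note T = measurable_flat_param[OF H]
  let ?rE = "(\<lambda>x. 0 + r *\<^sub>R x) ` E"
  have rE: "?rE \<in> sets ?Lm" "emeasure ?Lm ?rE = ennreal (r ^ ?m) * emeasure ?Lm E"
    using r by (intro emeasure_affine_image[OF E(1)]; simp)+
  have "ennreal (r ^ ?m) * emeasure ?Lm E * (ennreal ((1 - r) ^ n) * v)
      = (\<integral>\<^sup>+u. (ennreal ((1 - r) ^ n) * v) * indicator ?rE u \<partial>?Lm)"
    unfolding nn_integral_cmult_indicator[OF rE(1)] rE(2) by (simp only: mult.commute)
  also have "\<dots> \<le> (\<integral>\<^sup>+u. (\<integral>\<^sup>+y. indicator A' y * indicator A' (y + ?T u) \<partial>?Ln) \<partial>?Lm)"
  proof (rule nn_integral_mono)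
    fix u assume u: "u \<in> space ?Lm"
    show "(ennreal ((1 - r) ^ n) * v) * indicator ?rE u \<le> (\<integral>\<^sup>+y. indicator A' y * indicator A' (y + ?T u) \<partial>?Ln)"
    proof (cases "u \<in> ?rE")
      case True
      then obtain e where e: "e \<in> E" "u = r *\<^sub>R e" by auto
      obtain a b where ab: "a \<in> K" "b \<in> K" "?T e = a - b" using E(2)[OF e(1)] by blast
      have Tu: "?T u = r *\<^sub>R (a - b)"
        using linear_scale[OF linear_flat_param[OF H]] e ab by simp
      \<comment> \<open>A translated copy of \<open>A\<close> contracted by \<open>1 - r\<close>. By
        convexity its points lie in \<open>K\<close>, and adding
        \<open>?T u = r *\<^sub>R (a - b)\<close> replaces \<open>b\<close> by \<open>a\<close>, so
        they stay in \<open>K\<close>.\<close>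
      let ?C = "(\<lambda>k. r *\<^sub>R b + (1 - r) *\<^sub>R k) ` A"
      have rb: "r *\<^sub>R b \<in> Rn n" using ab K(3) by auto
      have C: "?C \<in> sets ?Ln" "emeasure ?Ln ?C = ennreal ((1 - r) ^ n) * v"
        using emeasure_affine_image[OF A(1) rb, of "1 - r"] r by (simp_all add: v_def VA(1))
      have conv: "r *\<^sub>R z + (1 - r) *\<^sub>R k \<in> A'" if "z \<in> K" "k \<in> A" for z k
        using convexD_alt[OF K(2), of k z r] that A r by (auto simp: add.commute)
      have "(ennreal ((1 - r) ^ n) * v) * indicator ?rE u = (\<integral>\<^sup>+y. indicator ?C y \<partial>?Ln)"
        unfolding nn_integral_indicator[OF C(1)] C(2) using True by simp
      also have "\<dots> \<le> (\<integral>\<^sup>+y. indicator A' y * indicator A' (y + ?T u) \<partial>?Ln)"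
      proof (rule nn_integral_mono)
        fix y
        show "indicator ?C y \<le> (indicator A' y * indicator A' (y + ?T u) :: ennreal)"
        proof (cases "y \<in> ?C")
          case True
          then obtain k where k: "k \<in> A" "y = r *\<^sub>R b + (1 - r) *\<^sub>R k" by auto
          have "y + ?T u = r *\<^sub>R a + (1 - r) *\<^sub>R k" by (simp add: k Tu algebra_simps)
          hence "y + ?T u \<in> A'" using conv[OF ab(1) k(1)] by (simp only:)
          moreover have "y \<in> A'" using conv[OF ab(2) k(1)] k(2) by (simp only:)
          ultimately show ?thesis by (simp add: indicator_def)
        qed simp
      qed
      finally show ?thesis .
    qed simp
  qed
  also have "\<dots> = (\<integral>\<^sup>+y. indicator A' y * emeasure ?Lm {u \<in> Rn ?m. y + ?T u \<in> A'} \<partial>?Ln)"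
    by (rule nn_integral_slices(2)[OF T A(2) borel_measurable_indicator[OF A(2)], symmetric])
  \<comment> \<open>The integral over \<open>y\<close> ignores the exceptional translates, so the
    almost everywhere bound for slices suffices.\<close>
  also have "\<dots> \<le> (\<integral>\<^sup>+y. max_section * indicator A' y \<partial>?Ln)"
    by (rule nn_integral_mono_AE, rule eventually_mono[OF AE_slice_le_max_section[OF A]])
       (simp add: indicator_def)
  also have "\<dots> = max_section * v"
    using A(2) by (simp add: nn_integral_cmult_indicator v_def VA(2))
  finally have "v * (ennreal (r ^ ?m * (1 - r) ^ n) * emeasure ?Lm E) \<le> v * max_section"
    using r by (simp add: ennreal_mult ac_simps)
  thus ?thesis using V by (subst (asm) ennreal_mult_le_mult_iff) (auto simp: v_def)
qed

text \<open>The points of a fat family in \<open>E\<close> are differences of points of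
  \<open>K\<close>, so the averaged segments put a translate of their parallelepiped into
  \<open>K\<close>.\<close>

lemma section_parallelepiped:
  assumes m: "dim H \<ge> 1" and E_bdd: "emeasure (borel_Rn (dim H)) E \<noteq> 0" "emeasure (borel_Rn (dim H)) E \<noteq> \<infinity>"
     "\<And>x i. x \<in> E \<Longrightarrow> i < dim H \<Longrightarrow> \<bar>lk x i\<bar> \<le> R"
  obtains y x where "y \<in> Rn n" "\<And>i. i < dim H \<Longrightarrow> x i \<in> Rn (dim H)"
    "(\<lambda>u. y + flat_param n H (lincomb (dim H) x u)) ` cube (dim H) (1 / real (dim H)) \<subseteq> K"
    "fat_family (dim H) E x"
proof -
  obtain x where x: "\<And>i. i < dim H \<Longrightarrow> x i \<in> E"
    and vol: "fat_family (dim H) E x"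
    using large_parallelepiped_bounded[OF E(1) E_bdd] by blast
  obtain y where y: "y \<in> Rn n"
    "(\<lambda>u. y + flat_param n H (lincomb (dim H) x u)) ` cube (dim H) (1 / real (dim H)) \<subseteq> K"
    using parallelepiped_in_convex[OF K(2,3) linear_flat_param[OF H] m, of x] x E(2) by blast
  have "x i \<in> Rn (dim H)" if "i < dim H" for i
    using sets.sets_into_space[OF E(1)] x[OF that] by auto
  thus thesis by (rule that[OF y(1) _ y(2) vol])
qed

text \<open>
  A given section of \<open>K\<close> need not be covered by the statement about almost all sections, so
  the parallelepiped is contracted towards a generic point of \<open>K\<close>.
\<close>

lemma section_bound_sqrt_bounded:
  assumes m: "dim H \<ge> 1" and E_bdd: "emeasure (borel_Rn (dim H)) E \<noteq> \<infinity>"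
     "\<And>x i. x \<in> E \<Longrightarrow> i < dim H \<Longrightarrow> \<bar>lk x i\<bar> \<le> R"
    and V: "emeasure (lebesgue_Rn n) K \<noteq> 0"
  shows "ennreal ((1 / (2 * real (dim H))) ^ dim H * parallelepiped_const (dim H)) * emeasure (borel_Rn (dim H)) E
    \<le> max_section"
proof (cases "emeasure (borel_Rn (dim H)) E = 0")
  case False
  let ?m = "dim H" and ?T = "flat_param n H"
  let ?Ln = "borel_Rn n" and ?Lm = "borel_Rn (dim H)"
  obtain y0 x where y0: "y0 \<in> Rn n"
    and x: "\<And>i. i < dim H \<Longrightarrow> x i \<in> Rn (dim H)"
    and par: "(\<lambda>u. y0 + ?T (lincomb ?m x u)) ` cube ?m (1 / real ?m) \<subseteq> K"
    and vol: "fat_family ?m E x"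
    using section_parallelepiped[OF m False E_bdd] by blast
  obtain A A' where A: "A \<in> sets ?Ln" "A' \<in> sets ?Ln" "A \<subseteq> K" "K \<subseteq> A'" "emeasure ?Ln (A' - A) = 0"
    and VA: "emeasure (lebesgue_Rn n) K = emeasure ?Ln A"
    by (rule Lebesgue_sandwich[OF K(1)])
  \<comment> \<open>The midpoints between \<open>y0\<close> and points of \<open>A\<close> form a
    set of positive measure, so one of them is generic for the slice bound. This contraction halves
    the edge of the cube.\<close>
  let ?Y = "(\<lambda>w. (1/2) *\<^sub>R y0 + (1/2) *\<^sub>R w) ` A"
  have y0': "(1/2) *\<^sub>R y0 \<in> Rn n" using y0 by auto
  have Y: "?Y \<in> sets ?Ln" "emeasure ?Ln ?Y \<noteq> 0"
    using emeasure_affine_image[OF A(1) y0', of "1/2"] V VA by simp_all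
  obtain y where "y \<in> ?Y" and le: "emeasure ?Lm {u \<in> Rn ?m. y + ?T u \<in> A'} \<le> max_section"
    using AE_pos_measure_ex[OF AE_slice_le_max_section[OF A] Y] by blast
  then obtain w where w: "w \<in> A" "y = (1/2) *\<^sub>R y0 + (1/2) *\<^sub>R w" by auto
  have "w \<in> K" using w A by auto
  have yR: "y \<in> Rn n" unfolding w(2) using y0 \<open>w \<in> K\<close> K(3) by auto
  have "ennreal ((1 / (2 * real ?m)) ^ ?m * parallelepiped_const ?m) * emeasure ?Lm E
      \<le> emeasure ?Lm {u \<in> Rn ?m. y + ?T u \<in> A'}"
  proof (rule vol[unfolded fat_family_def, rule_format, OF slice_measurable[OF measurable_flat_param[OF H] A(2) yR], where c=0])
    show "(\<lambda>u. 0 + lincomb ?m x u) ` cube ?m (1 / (2 * real ?m)) \<subseteq> {u \<in> Rn ?m. y + ?T u \<in> A'}"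
    proof (rule image_subsetI)
      fix u assume u: "u \<in> cube ?m (1 / (2 * real ?m))"
      have "2 *\<^sub>R u \<in> cube ?m (1 / real ?m)"
        using u by (auto simp: cube_def lookup_scaleR_seq field_simps)
      hence "y0 + ?T (lincomb ?m x (2 *\<^sub>R u)) \<in> K" using par by blast
      hence "(1 - 1/2) *\<^sub>R (y0 + ?T (lincomb ?m x (2 *\<^sub>R u))) + (1/2) *\<^sub>R w \<in> K"
        using \<open>w \<in> K\<close> by (intro convexD_alt[OF K(2)]) auto
      also have "(1 - 1/2) *\<^sub>R (y0 + ?T (lincomb ?m x (2 *\<^sub>R u))) + (1/2) *\<^sub>R w = y + ?T (lincomb ?m x u)"
        by (simp add: w(2) linear_scale[OF linear_lincomb] linear_scale[OF linear_flat_param[OF H]] algebra_simps)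
      finally have "y + ?T (lincomb ?m x u) \<in> A'" using A(4) by blast
      thus "0 + lincomb ?m x u \<in> {u \<in> Rn ?m. y + ?T u \<in> A'}" using x by simp
    qed
  qed simp_all
  with le show ?thesis by (rule order_trans[rotated])
qed simp

text \<open>If \<open>H\<close> is the whole space, every translate of \<open>H\<close> is the same
  flat. A generic slice of \<open>K\<close> is null, yet after a change of base point it contains
  the parallelepiped. This serves the levels above the norm when \<open>s = 0\<close> and
  \<open>dim H = n\<close>.\<close>

lemma difference_null_bounded:
  assumes m: "dim H \<ge> 1" and full: "H = Rn n" and V: "emeasure (lebesgue_Rn n) K = 0"
    and E_bdd: "emeasure (borel_Rn (dim H)) E \<noteq> \<infinity>"
     "\<And>x i. x \<in> E \<Longrightarrow> i < dim H \<Longrightarrow> \<bar>lk x i\<bar> \<le> R"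
  shows "emeasure (borel_Rn (dim H)) E = 0"
proof (rule ccontr)
  assume E0: "emeasure (borel_Rn (dim H)) E \<noteq> 0"
  let ?m = "dim H" and ?T = "flat_param n H"
  let ?Ln = "borel_Rn n" and ?Lm = "borel_Rn (dim H)"
  obtain y0 x where y0: "y0 \<in> Rn n"
    and x: "\<And>i. i < dim H \<Longrightarrow> x i \<in> Rn (dim H)"
    and par: "(\<lambda>u. y0 + ?T (lincomb ?m x u)) ` cube ?m (1 / real ?m) \<subseteq> K"
    and vol: "fat_family ?m E x"
    using section_parallelepiped[OF m E0 E_bdd] by blast
  obtain A A' where A: "A' \<in> sets ?Ln" "K \<subseteq> A'"
    and VA: "emeasure (lebesgue_Rn n) K = emeasure ?Ln A'"
    by (rule Lebesgue_sandwich[OF K(1)])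
  \<comment> \<open>Positive measure of the whole space turns the almost everywhere statement into
    the existence of a point \<open>y\<close>.\<close>
  have "emeasure ?Ln (Rn n) \<noteq> 0"
  proof
    assume "emeasure ?Ln (Rn n) = 0"
    moreover have "emeasure ?Ln {x \<in> Rn n. \<forall>i<n. lk x i \<in> {0..1}} \<le> emeasure ?Ln (Rn n)"
      using sets.top[of ?Ln] by (intro emeasure_mono) auto
    ultimately show False using box_Rn(2)[of 0 1 n] by simp
  qed
  then obtain y where y: "y \<in> Rn n" "emeasure ?Lm {u \<in> Rn ?m. y + ?T u \<in> A'} = 0"
    using AE_pos_measure_ex[OF AE_slice_null[OF measurable_flat_param[OF H] A(1)], of "Rn n"] VA V
      sets.top[of ?Ln] by auto
  \<comment> \<open>The parameter \<open>c\<close> of this difference moves the base point of the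
    parallelepiped from \<open>y0\<close> to the generic point \<open>y\<close>.\<close>
  have "y0 - y \<in> H" using y0 y(1) full by auto
  then obtain c where c: "c \<in> Rn ?m" "?T c = y0 - y"
    using flat_param_image[OF H] by (metis imageE)
  have "ennreal ((1 / real ?m) ^ ?m * parallelepiped_const ?m) * emeasure ?Lm E
      \<le> emeasure ?Lm {u \<in> Rn ?m. y + ?T u \<in> A'}"
  proof (rule vol[unfolded fat_family_def, rule_format, OF slice_measurable[OF measurable_flat_param[OF H] A(1) y(1)] c(1)])
    show "(\<lambda>u. c + lincomb ?m x u) ` cube ?m (1 / real ?m) \<subseteq> {u \<in> Rn ?m. y + ?T u \<in> A'}"
    proof (rule image_subsetI)
      fix u assume u: "u \<in> cube ?m (1 / real ?m)"
      have "y + ?T (c + lincomb ?m x u) = y0 + ?T (lincomb ?m x u)"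
        by (simp add: linear_add[OF linear_flat_param[OF H]] c)
      also have "\<dots> \<in> A'" using par u A(2) by blast
      finally show "c + lincomb ?m x u \<in> {u \<in> Rn ?m. y + ?T u \<in> A'}" using c(1) x by simp
    qed
  qed simp
  hence "ennreal ((1 / real ?m) ^ ?m * parallelepiped_const ?m) * emeasure ?Lm E = 0" using y(2) by simp
  moreover have "(1 / real ?m) ^ ?m * parallelepiped_const ?m > 0"
    using m parallelepiped_const_pos by (intro mult_pos_pos zero_less_power) auto
  ultimately show False using E0 by auto
qed

end

text \<open>The two cases are the two values of the minimum in \<open>psi\<close>; each uses its own
  estimate, and the second one passes to bounded parts of \<open>E\<close>.\<close>

lemma convex_section_bound:
  assumes H: "H \<subseteq> Rn n" "subspace H" and m: "1 \<le> dim H" "dim H \<le> n"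
    and K: "K \<in> sets (lebesgue_Rn n)" "convex K" "K \<subseteq> Rn n"
    and V: "emeasure (lebesgue_Rn n) K \<noteq> 0" "emeasure (lebesgue_Rn n) K \<noteq> \<infinity>"
    and E: "E \<in> sets (borel_Rn (dim H))"
      "\<And>u. u \<in> E \<Longrightarrow> \<exists>a\<in>K. \<exists>b\<in>K. flat_param n H u = a - b"
  shows "emeasure (borel_Rn (dim H)) E \<le> ennreal ((section_const * psi n (dim H)) ^ dim H) *
    (SUP y\<in>Rn n. emeasure (flat_lebesgue n H y) (K \<inter> ((\<lambda>h. h + y) ` H)))"
proof (cases "real n / real (dim H) \<le> sqrt (real (dim H))")
  case True
  note r = ratio_const_bound[OF m]
  let ?r = "real (dim H) / (real n + real (dim H))"
  have "0 < ?r ^ dim H * (1 - ?r) ^ n" using r(1,2) by simp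
  moreover have "psi n (dim H) = real n / real (dim H)" using True by (simp add: psi_def)
  ultimately show ?thesis
    using ennreal_le_of_mult[OF section_bound_ratio[OF H K E V r(1,2)]] r(3) by simp
next
  case False
  hence psi: "psi n (dim H) = sqrt (real (dim H))" by (simp add: psi_def)
  have pos: "(1 / (2 * real (dim H))) ^ dim H * parallelepiped_const (dim H) > 0"
    using m parallelepiped_const_pos by (intro mult_pos_pos zero_less_power) auto
  show ?thesis unfolding psi
  proof (rule emeasure_le_of_bounded_parts[OF E(1)])
    fix R
    let ?E = "{x \<in> E. \<forall>i<dim H. \<bar>lk x i\<bar> \<le> R}"
    have E': "\<exists>a\<in>K. \<exists>b\<in>K. flat_param n H u = a - b" if "u \<in> ?E" for u using that E(2) by blast
    have bd: "\<bar>lk x i\<bar> \<le> R" if "x \<in> ?E" "i < dim H" for x i using that by blast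
    from ennreal_le_of_mult[OF section_bound_sqrt_bounded[OF H K bounded_part_measurable(1)[OF E(1)] E' m(1)
      bounded_part_measurable(2)[OF E(1)] bd V(1)] pos sqrt_const_bound[OF m(1)]]
    show "emeasure (borel_Rn (dim H)) ?E \<le> ennreal ((section_const * sqrt (real (dim H))) ^ dim H) *
      (SUP y\<in>Rn n. emeasure (flat_lebesgue n H y) (K \<inter> ((\<lambda>h. h + y) ` H)))" by blast
  qed
qed

text \<open>Since \<open>dim H = n\<close> the chosen basis spans \<open>Rn n\<close>, so
  \<open>H\<close> is the whole space and \<open>difference_null_bounded\<close> applies to the
  bounded parts.\<close>

lemma difference_null:
  assumes H: "H \<subseteq> Rn n" "subspace H" and m: "1 \<le> dim H" "dim H = n"
    and K: "K \<in> sets (lebesgue_Rn n)" "convex K" "K \<subseteq> Rn n"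
    and V: "emeasure (lebesgue_Rn n) K = 0"
    and E: "E \<in> sets (borel_Rn (dim H))"
      "\<And>u. u \<in> E \<Longrightarrow> \<exists>a\<in>K. \<exists>b\<in>K. flat_param n H u = a - b"
  shows "emeasure (borel_Rn (dim H)) E = 0"
proof -
  let ?b = "SOME b. orthonormal_basis n H b"
  note b = some_basis[OF H]
  have on: "\<forall>i<dim H. \<forall>j<dim H. dotp n (?b i) (?b j) = (if i = j then 1 else 0)"
    using b(1) by (simp add: orthonormal_wrt_def)
  have "span (?b ` {..<dim H}) = Rn n"
    using b(3) H(1) orthonormal_independent[OF on] m(2)
    by (intro span_eq_Rn) (auto simp: card_image)
  hence full: "H = Rn n" using b(2) by simp
  have "emeasure (borel_Rn (dim H)) E \<le> 0"
  proof (rule emeasure_le_of_bounded_parts[OF E(1)])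
    fix R
    let ?E = "{x \<in> E. \<forall>i<dim H. \<bar>lk x i\<bar> \<le> R}"
    have E': "\<exists>a\<in>K. \<exists>b\<in>K. flat_param n H u = a - b" if "u \<in> ?E" for u using that E(2) by blast
    have bd: "\<bar>lk x i\<bar> \<le> R" if "x \<in> ?E" "i < dim H" for x i using that by blast
    from difference_null_bounded[OF H K bounded_part_measurable(1)[OF E(1)] E' m(1) full V
      bounded_part_measurable(2)[OF E(1)] bd]
    show "emeasure (borel_Rn (dim H)) ?E \<le> 0" by simp
  qed
  thus ?thesis by simp
qed

section \<open>From level sets to functions\<close>

lemma emeasure_lborel_greaterThan: "emeasure lborel {a::real<..} = \<infinity>"
proof (rule ccontr)
  assume "emeasure lborel {a<..} \<noteq> \<infinity>"
  then obtain r where r: "r \<ge> 0" "emeasure lborel {a<..} = ennreal r"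
    by (cases "emeasure lborel {a<..}") auto
  have "emeasure lborel {a<..<a + (r + 1)} \<le> emeasure lborel {a<..}"
    by (rule emeasure_mono) auto
  with r have "ennreal (r + 1) \<le> ennreal r" by simp
  thus False using r(1) by (simp add: ennreal_le_iff)
qed

text \<open>Each value \<open>g x\<close> is the length of the set of \<open>t > 0\<close> below it;
  Fubini exchanges the two integrals.\<close>

lemma nn_integral_layer_cake:
  fixes g :: "'a \<Rightarrow> ennreal"
  assumes "sigma_finite_measure M" and g [measurable]: "g \<in> borel_measurable M"
  shows "(\<integral>\<^sup>+x. g x \<partial>M) = (\<integral>\<^sup>+t. indicator {0<..} t * emeasure M {x \<in> space M. ennreal t < g x} \<partial>lborel)"
proof -
  interpret M: sigma_finite_measure M by fact
  interpret pair_sigma_finite "lborel :: real measure" M by standard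
  have "(\<integral>\<^sup>+x. g x \<partial>M) = (\<integral>\<^sup>+x. (\<integral>\<^sup>+t. indicator {t. 0 < t \<and> ennreal t < g x} t \<partial>lborel) \<partial>M)"
  proof (rule nn_integral_cong)
    fix x
    show "g x = (\<integral>\<^sup>+t. indicator {t. 0 < t \<and> ennreal t < g x} t \<partial>lborel)"
    proof (cases "g x")
      case (real r)
      hence "{t. 0 < t \<and> ennreal t < g x} = {0<..<r}" by (auto simp: ennreal_less_iff)
      thus ?thesis using real by simp
    next
      case top
      hence "{t. 0 < t \<and> ennreal t < g x} = {0<..}" by (auto simp: top.not_eq_extremum)
      thus ?thesis using top emeasure_lborel_greaterThan[of 0] by simp
    qed
  qed
  also have "\<dots> = (\<integral>\<^sup>+t. (\<integral>\<^sup>+x. indicator {t. 0 < t \<and> ennreal t < g x} t \<partial>M) \<partial>lborel)"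
    by (rule Fubini') measurable
  also have "\<dots> = (\<integral>\<^sup>+t. indicator {0<..} t * emeasure M {x \<in> space M. ennreal t < g x} \<partial>lborel)"
  proof (rule nn_integral_cong)
    fix t :: real
    have "(\<integral>\<^sup>+x. indicator {t. 0 < t \<and> ennreal t < g x} t \<partial>M)
        = (\<integral>\<^sup>+x. indicator {0<..} t * indicator {x \<in> space M. ennreal t < g x} x \<partial>M)"
      by (rule nn_integral_cong) (auto simp: indicator_def)
    also have "\<dots> = indicator {0<..} t * emeasure M {x \<in> space M. ennreal t < g x}"
      by (rule nn_integral_cmult_indicator) measurable
    finally show "(\<integral>\<^sup>+x. indicator {t. 0 < t \<and> ennreal t < g x} t \<partial>M)
      = indicator {0<..} t * emeasure M {x \<in> space M. ennreal t < g x}" .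
  qed
  finally show ?thesis .
qed

section \<open>Means with exponent \<open>1 / s\<close>\<close>

lemma wmean_recip:
  assumes "s < 0" "a > 0" "b > 0"
  shows "wmean (recip_exponent s) l a b = ((1 - l) * a powr (1 / s) + l * b powr (1 / s)) powr s"
  using assms by (simp add: wmean_def recip_exponent_def)

lemma powr_mean_pos:
  fixes a b l :: real
  assumes "a > 0" "b > 0" "0 \<le> l" "l \<le> 1"
  shows "(1 - l) * a + l * b > 0"
  using assms by (cases "l = 0") (auto intro!: add_nonneg_pos)

text \<open>For \<open>s < 0\<close> the powers with exponents \<open>1 / s\<close> and
  \<open>s\<close> are both decreasing, so replacing both arguments by their minimum can only lower
  the mean. For \<open>s = 0\<close> the mean is the minimum.\<close>

lemma wmean_ge_min:
  assumes s: "s \<le> 0" and ab: "a > 0" "b > 0" and l: "0 \<le> l" "l \<le> 1"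
  shows "min a b \<le> wmean (recip_exponent s) l a b"
proof (cases "s = 0")
  case True
  thus ?thesis using ab by (simp add: wmean_def recip_exponent_def)
next
  case False
  with s have s0: "s < 0" by simp
  let ?X = "(1 - l) * a powr (1 / s) + l * b powr (1 / s)" and ?c = "min a b"
  have c: "?c > 0" using ab by simp
  have "a powr (1 / s) \<le> ?c powr (1 / s)" "b powr (1 / s) \<le> ?c powr (1 / s)"
    using s0 c by (auto intro!: powr_mono2')
  hence "?X \<le> (1 - l) * ?c powr (1 / s) + l * ?c powr (1 / s)"
    using l by (intro add_mono mult_left_mono) auto
  also have "\<dots> = ?c powr (1 / s)" by (simp add: algebra_simps)
  finally have X: "?X \<le> ?c powr (1 / s)" .
  have "?X > 0" using ab l by (intro powr_mean_pos) auto
  with X s0 have "(?c powr (1 / s)) powr s \<le> ?X powr s" by (intro powr_mono2') auto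
  thus ?thesis using s0 ab c by (simp add: wmean_recip powr_powr)
qed

text \<open>For \<open>s < 0\<close> the outer power is decreasing, so dropping one summand can only
  increase the value; the remaining term is the argument itself.\<close>

lemma umean_le:
  assumes s: "s \<le> 0" and ab: "a \<ge> 0" "b \<ge> 0"
  shows "umean (recip_exponent s) a b \<le> a" "umean (recip_exponent s) a b \<le> b"
proof -
  have *: "(x powr (1 / s) + y powr (1 / s)) powr s \<le> x" if "s < 0" "x > 0" "y > 0" for x y
  proof -
    have "(x powr (1 / s) + y powr (1 / s)) powr s \<le> (x powr (1 / s)) powr s"
      using that by (intro powr_mono2') auto
    thus ?thesis using that by (simp add: powr_powr)
  qed
  show "umean (recip_exponent s) a b \<le> a" "umean (recip_exponent s) a b \<le> b"
    using s ab *[of a b] *[of b a] by (auto simp: umean_def recip_exponent_def add.commute)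
qed

section \<open>Superlevel sets of an \<open>\<alpha>\<close>-concave function\<close>

context
  fixes n :: nat and s :: real and f :: "seq \<Rightarrow> real"
  assumes s: "s \<le> 0" and f0: "\<forall>x\<in>Rn n. 0 \<le> f x" and int: "integrable (lebesgue_Rn n) f"
    and conc: "alpha_concave n (recip_exponent s) f" and N: "sup_norm n f > 0"
begin

lemma space_lebesgue_Rn: "space (lebesgue_Rn n) = Rn n"
  using of_coords_image[of n]
  by (simp add: lebesgue_Rn_def space_embed_measure of_coords_def[abs_def])

lemma f_measurable: "f \<in> borel_measurable (lebesgue_Rn n)"
  using int by (rule borel_measurable_integrable)

lemma superlevel_measurable: "{x \<in> Rn n. f x \<ge> t} \<in> sets (lebesgue_Rn n)"
    "{x \<in> Rn n. f x > t} \<in> sets (lebesgue_Rn n)"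
proof -
  note [measurable] = f_measurable
  have "{x \<in> space (lebesgue_Rn n). f x \<ge> t} \<in> sets (lebesgue_Rn n)" by measurable
  thus "{x \<in> Rn n. f x \<ge> t} \<in> sets (lebesgue_Rn n)" by (simp add: space_lebesgue_Rn)
  have "{x \<in> space (lebesgue_Rn n). f x > t} \<in> sets (lebesgue_Rn n)" by measurable
  thus "{x \<in> Rn n. f x > t} \<in> sets (lebesgue_Rn n)" by (simp add: space_lebesgue_Rn)
qed

text \<open>\<open>real_of_ereal\<close> sends both infinities to 0, so a positive
  \<open>sup_norm\<close> forces the essential supremum to be finite.\<close>

lemma esssup_eq_sup_norm: "esssup (lebesgue_Rn n) (\<lambda>x. ereal (f x)) = ereal (sup_norm n f)"
  using N unfolding sup_norm_def by (cases "esssup (lebesgue_Rn n) (\<lambda>x. ereal (f x))") auto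

lemma superlevel_null: "emeasure (lebesgue_Rn n) {x \<in> Rn n. f x > sup_norm n f} = 0"
  using esssup_zero_measure[of "lebesgue_Rn n" "\<lambda>x. ereal (f x)"]
  by (simp add: esssup_eq_sup_norm space_lebesgue_Rn)

lemma superlevel_pos:
  assumes "t < sup_norm n f"
  shows "emeasure (lebesgue_Rn n) {x \<in> Rn n. f x > t} \<noteq> 0"
  using esssup_pos_measure[of "\<lambda>x. ereal (f x)" "lebesgue_Rn n" "ereal t"] assms f_measurable
  by (simp add: esssup_eq_sup_norm space_lebesgue_Rn)

text \<open>Markov's inequality.\<close>

lemma superlevel_finite:
  assumes t: "t > 0"
  shows "emeasure (lebesgue_Rn n) {x \<in> Rn n. f x \<ge> t} \<noteq> \<infinity>"
proof
  let ?L = "lebesgue_Rn n" and ?K = "{x \<in> Rn n. f x \<ge> t}"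
  assume top: "emeasure ?L ?K = \<infinity>"
  have "ennreal t * emeasure ?L ?K = (\<integral>\<^sup>+x. ennreal t * indicator ?K x \<partial>?L)"
    by (rule nn_integral_cmult_indicator[OF superlevel_measurable(1), symmetric])
  also have "\<dots> \<le> (\<integral>\<^sup>+x. ennreal (norm (f x)) \<partial>?L)"
    by (rule nn_integral_mono) (auto simp: indicator_def space_lebesgue_Rn intro!: ennreal_leI)
  also have "\<dots> < \<infinity>" using int by (simp add: integrable_iff_bounded)
  finally show False using t by (simp add: top ennreal_mult_top)
qed

lemma concave_ge_min:
  assumes "x \<in> Rn n" "y \<in> Rn n" "0 \<le> l" "l \<le> 1" "f x > 0" "f y > 0"
  shows "min (f x) (f y) \<le> f ((1 - l) *\<^sub>R x + l *\<^sub>R y)"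
proof -
  have "min (f x) (f y) \<le> wmean (recip_exponent s) l (f x) (f y)"
    using s assms by (intro wmean_ge_min)
  also have "\<dots> \<le> f ((1 - l) *\<^sub>R x + l *\<^sub>R y)"
    using conc assms by (auto simp: alpha_concave_def)
  finally show ?thesis .
qed

text \<open>\<open>concave_ge_min\<close> asks for positive values at both points, since
  \<open>wmean\<close> is 0 otherwise. Membership gives this for \<open>t > 0\<close>, and with the
  strict inequality already for \<open>t \<ge> 0\<close>.\<close>

lemma convex_superlevel: "t > 0 \<Longrightarrow> convex {x \<in> Rn n. f x \<ge> t}" "t \<ge> 0 \<Longrightarrow> convex {x \<in> Rn n. f x > t}"
proof -
  have R: "(1 - l) *\<^sub>R x + l *\<^sub>R y \<in> Rn n" if "x \<in> Rn n" "y \<in> Rn n" for l x y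
    using that by (intro Rn_closed)
  show "convex {x \<in> Rn n. f x \<ge> t}" if "t > 0"
    unfolding convex_alt
  proof (intro ballI allI impI)
    fix x y l assume xy: "x \<in> {x \<in> Rn n. f x \<ge> t}" "y \<in> {x \<in> Rn n. f x \<ge> t}" "0 \<le> l \<and> l \<le> (1::real)"
    hence "min (f x) (f y) \<le> f ((1 - l) *\<^sub>R x + l *\<^sub>R y)" using that by (intro concave_ge_min) auto
    with xy R show "(1 - l) *\<^sub>R x + l *\<^sub>R y \<in> {x \<in> Rn n. f x \<ge> t}" by auto
  qed
  show "convex {x \<in> Rn n. f x > t}" if "t \<ge> 0"
    unfolding convex_alt
  proof (intro ballI allI impI)
    fix x y l assume xy: "x \<in> {x \<in> Rn n. f x > t}" "y \<in> {x \<in> Rn n. f x > t}" "0 \<le> l \<and> l \<le> (1::real)"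
    hence "min (f x) (f y) \<le> f ((1 - l) *\<^sub>R x + l *\<^sub>R y)" using that by (intro concave_ge_min) auto
    with xy R show "(1 - l) *\<^sub>R x + l *\<^sub>R y \<in> {x \<in> Rn n. f x > t}" by auto
  qed
qed

text \<open>
  A point where \<open>f\<close> exceeds its norm would, by concavity, make \<open>f\<close> exceed its norm on a small
  homothetic copy of a superlevel set of positive measure.
\<close>

lemma le_sup_norm:
  assumes s0: "s < 0" and x0: "x0 \<in> Rn n"
  shows "f x0 \<le> sup_norm n f"
proof (rule ccontr)
  let ?N = "sup_norm n f"
  assume "\<not> f x0 \<le> ?N"
  hence gt: "f x0 > ?N" by simp
  \<comment> \<open>The power \<open>1 / s\<close> reverses the order and makes the weighted mean
    affine. The numbers \<open>A < C < B\<close> represent the values \<open>f x0\<close>,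
    \<open>?N\<close> and \<open>?N / 2\<close>.\<close>
  define A B C where "A = f x0 powr (1 / s)" and "B = (?N / 2) powr (1 / s)" and "C = ?N powr (1 / s)"
  have neg: "1 / s < 0" using s0 by simp
  have AC: "A < C" unfolding A_def C_def using gt N neg by (intro powr_less_mono2_neg) auto
  have CB: "C < B" unfolding B_def C_def using N neg by (intro powr_less_mono2_neg) auto
  define d where "d = B - A"
  \<comment> \<open>This weight makes \<open>(1 - l) * A + l * B\<close> the midpoint of
    \<open>A\<close> and \<open>C\<close>, hence less than \<open>C\<close>.\<close>
  define l where "l = (C - A) / (2 * d)"
  have d: "C - A < d" "0 < d" using AC CB by (simp_all add: d_def)
  have l: "0 < l" "l < 1" using AC d by (simp_all add: l_def field_simps)
  have "l * d = (C - A) / 2" using d by (simp add: l_def)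
  hence "l * B - l * A = (C - A) / 2" by (simp add: d_def right_diff_distrib)
  hence mid: "(1 - l) * A + l * B < C" using AC by (simp add: algebra_simps)
  have big: "f ((1 - l) *\<^sub>R x0 + l *\<^sub>R z) > ?N" if z: "z \<in> Rn n" "f z > ?N / 2" for z
  proof -
    let ?X = "(1 - l) * A + l * f z powr (1 / s)"
    have fz: "f z > 0" using z N by simp
    have "f z powr (1 / s) \<le> B" unfolding B_def using z N neg by (intro powr_mono2') auto
    hence "?X < C" using mid l by (smt (verit) mult_left_mono)
    moreover have "?X > 0" using l fz gt N by (intro powr_mean_pos) (auto simp: A_def)
    ultimately have "C powr s < ?X powr s" using s0 by (intro powr_less_mono2_neg) auto
    moreover have "C powr s = ?N" using s0 N by (simp add: C_def powr_powr)
    moreover have "?X powr s = wmean (recip_exponent s) l (f x0) (f z)"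
      using s0 fz gt N by (simp add: wmean_recip A_def)
    moreover have "\<dots> \<le> f ((1 - l) *\<^sub>R x0 + l *\<^sub>R z)"
      using conc z x0 l by (auto simp: alpha_concave_def)
    ultimately show ?thesis by linarith
  qed
  obtain S where S: "S \<in> sets (borel_Rn n)" "S \<subseteq> {x \<in> Rn n. f x > ?N / 2}"
      "emeasure (lebesgue_Rn n) {x \<in> Rn n. f x > ?N / 2} = emeasure (borel_Rn n) S"
    by (rule Lebesgue_sandwich[OF superlevel_measurable(2)])
  obtain Z where Z: "Z \<in> sets (borel_Rn n)" "{x \<in> Rn n. f x > ?N} \<subseteq> Z"
      "emeasure (lebesgue_Rn n) {x \<in> Rn n. f x > ?N} = emeasure (borel_Rn n) Z"
    by (rule Lebesgue_sandwich[OF superlevel_measurable(2)])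
  have c: "(1 - l) *\<^sub>R x0 \<in> Rn n" using x0 by (rule Rn_closed)
  have "(\<lambda>z. (1 - l) *\<^sub>R x0 + l *\<^sub>R z) ` S \<subseteq> Z"
  proof (rule image_subsetI)
    fix z assume "z \<in> S"
    hence z: "z \<in> Rn n" "f z > ?N / 2" using S(2) by auto
    hence "(1 - l) *\<^sub>R x0 + l *\<^sub>R z \<in> Rn n" using x0 by (intro Rn_closed)
    thus "(1 - l) *\<^sub>R x0 + l *\<^sub>R z \<in> Z" using big[OF z] Z(2) by auto
  qed
  \<comment> \<open>The homothetic copy of \<open>S\<close> has positive measure, but
    \<open>Z\<close> covers the null set where \<open>f\<close> exceeds its norm.\<close>
  hence "emeasure (borel_Rn n) ((\<lambda>z. (1 - l) *\<^sub>R x0 + l *\<^sub>R z) ` S) \<le> emeasure (borel_Rn n) Z"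
    by (rule emeasure_mono[OF _ Z(1)])
  hence "ennreal (l ^ n) * emeasure (borel_Rn n) S = 0"
    using emeasure_affine_image(2)[OF S(1) c l(1)] Z(3) superlevel_null by simp
  thus False using superlevel_pos[of "?N / 2"] S(3) N l by auto
qed

end

text \<open>A supremum above \<open>t\<close> has a member above \<open>t\<close>, and by
  \<open>umean_le\<close> both values of \<open>f\<close> in it exceed \<open>t\<close>. So
  superlevel sets of the difference function consist of differences of superlevel points of
  \<open>f\<close>.\<close>

lemma alpha_difference_level:
  assumes s: "s \<le> 0" and f0: "\<forall>x\<in>Rn n. 0 \<le> f x"
    and gt: "ennreal t < alpha_difference n (recip_exponent s) f x" and t: "t \<ge> 0"
  obtains a b where "a \<in> Rn n" "b \<in> Rn n" "x = a - b" "f a > t" "f b > t"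
proof -
  obtain a b where ab: "a \<in> Rn n" "b \<in> Rn n" "x = a - b"
    and u: "ennreal t < ennreal (umean (recip_exponent s) (f a) (f b))"
    using gt unfolding alpha_difference_def by (auto simp: less_SUP_iff)
  have "t < umean (recip_exponent s) (f a) (f b)" using u t by (simp add: ennreal_less_iff)
  with umean_le[OF s, of "f a" "f b"] f0 ab have "f a > t" "f b > t" by (auto intro: less_le_trans)
  with ab show thesis by (rule that)
qed

lemma psi_pos: "1 \<le> m \<Longrightarrow> m \<le> n \<Longrightarrow> psi n m > 0"
  by (simp add: psi_def)

lemma section_const_pos: "section_const > 0"
  by (simp add: section_const_def)

text \<open>The layer cake formula is applied to Borel minorants of the difference function, with
  levels \<open>\<tau> * ?N\<close>. For \<open>\<tau>\<close> strictly between 0 and 1,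
  \<open>low\<close> applies \<open>convex_section_bound\<close> to the level sets; by
  \<open>high\<close>, levels from the norm upwards contribute nothing.\<close>

lemma alpha_difference_section_bound:
  assumes H: "H \<subseteq> Rn n" "subspace H" and m: "1 \<le> dim H" "dim H \<le> n"
    and s: "s \<le> 0" and f0: "\<forall>x\<in>Rn n. 0 \<le> f x" and int: "integrable (lebesgue_Rn n) f"
    and conc: "alpha_concave n (recip_exponent s) f" and N: "sup_norm n f > 0"
    and bound: "s = 0 \<Longrightarrow> dim H < n \<Longrightarrow> \<forall>x\<in>Rn n. f x \<le> sup_norm n f"
  shows "(\<integral>\<^sup>+x. alpha_difference n (recip_exponent s) f x \<partial>flat_lebesgue n H 0) / ennreal (sup_norm n f)
    \<le> ennreal ((section_const * psi n (dim H)) ^ dim H) *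
       (\<integral>\<^sup>+t\<in>{0..1}. (SUP y\<in>Rn n. emeasure (flat_lebesgue n H y)
          (level_set n f t \<inter> ((\<lambda>h. h + y) ` H))) \<partial>lborel)"
proof -
  let ?N = "sup_norm n f" and ?L = "borel_Rn (dim H)"
  define C where "C = (section_const * psi n (dim H)) ^ dim H"
  define S where "S = (\<lambda>t. SUP y\<in>Rn n. emeasure (flat_lebesgue n H y) (level_set n f t \<inter> ((\<lambda>h. h + y) ` H)))"
  have C: "C > 0" using psi_pos[OF m] section_const_pos by (simp add: C_def)
  note ctx = s f0 int conc N
  have "(\<integral>\<^sup>+x. alpha_difference n (recip_exponent s) f x \<partial>flat_lebesgue n H 0)
      \<le> ennreal ?N * (ennreal C * (\<integral>\<^sup>+t\<in>{0..1}. S t \<partial>lborel))"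
  proof (rule nn_integral_flat_le[OF H])
    fix g assume g [measurable]: "g \<in> borel_measurable ?L"
      and le: "\<And>u. u \<in> Rn (dim H) \<Longrightarrow> g u \<le> alpha_difference n (recip_exponent s) f (flat_param n H u)"
    define E where "E = (\<lambda>t. {u \<in> Rn (dim H). ennreal t < g u})"
    have E_sets: "E t \<in> sets ?L" for t
    proof -
      have "{u \<in> space ?L. ennreal t < g u} \<in> sets ?L" by measurable
      thus ?thesis by (simp add: E_def)
    qed
    have E_diff: "\<exists>a\<in>Rn n. \<exists>b\<in>Rn n. flat_param n H u = a - b \<and> f a > t \<and> f b > t"
      if u: "u \<in> E t" and t: "t \<ge> 0" for t u
    proof -
      have "ennreal t < alpha_difference n (recip_exponent s) f (flat_param n H u)"
        using u le[of u] by (auto simp: E_def intro: less_le_trans)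
      thus ?thesis by (rule alpha_difference_level[OF s f0 _ t]) blast
    qed
    have low: "emeasure ?L (E (\<tau> * ?N)) \<le> ennreal C * S \<tau>" if \<tau>: "0 < \<tau>" "\<tau> < 1" for \<tau>
    proof -
      have t: "\<tau> * ?N > 0" "\<tau> * ?N < ?N" using \<tau> N by simp_all
      have K: "level_set n f \<tau> = {x \<in> Rn n. f x \<ge> \<tau> * ?N}" by (simp add: level_set_def)
      have meas: "level_set n f \<tau> \<in> sets (lebesgue_Rn n)"
        unfolding K by (rule superlevel_measurable(1)[OF ctx])
      have "emeasure (lebesgue_Rn n) {x \<in> Rn n. f x > \<tau> * ?N} \<le> emeasure (lebesgue_Rn n) (level_set n f \<tau>)"
        unfolding K using superlevel_measurable(1)[OF ctx] by (intro emeasure_mono) auto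
      hence V: "emeasure (lebesgue_Rn n) (level_set n f \<tau>) \<noteq> 0"
        using superlevel_pos[OF ctx t(2)] by auto
      show ?thesis unfolding C_def S_def
      proof (rule convex_section_bound[OF H m meas _ _ V _ E_sets])
        show "convex (level_set n f \<tau>)" unfolding K by (rule convex_superlevel(1)[OF ctx t(1)])
        show "level_set n f \<tau> \<subseteq> Rn n" by (auto simp: K)
        show "emeasure (lebesgue_Rn n) (level_set n f \<tau>) \<noteq> \<infinity>"
          unfolding K by (rule superlevel_finite[OF ctx t(1)])
        fix u assume u: "u \<in> E (\<tau> * ?N)"
        obtain a b where "a \<in> Rn n" "b \<in> Rn n" "flat_param n H u = a - b" "f a > \<tau> * ?N" "f b > \<tau> * ?N"
          using E_diff[OF u] t(1) by auto
        thus "\<exists>a\<in>level_set n f \<tau>. \<exists>b\<in>level_set n f \<tau>. flat_param n H u = a - b"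
          unfolding K by (intro bexI[of _ a] bexI[of _ b]) auto
      qed
    qed
    \<comment> \<open>For \<open>s < 0\<close> or a proper subspace no value of \<open>f\<close>
      exceeds the norm, by \<open>le_sup_norm\<close> or \<open>bound\<close>. For
      \<open>s = 0\<close> and \<open>dim H = n\<close> the superlevel set is merely null, and then
      so is every Borel set of its differences.\<close>
    have high: "emeasure ?L (E t) = 0" if t: "t \<ge> ?N" for t
    proof (cases "s < 0 \<or> dim H < n")
      case True
      have fN: "f x \<le> ?N" if "x \<in> Rn n" for x
        using True that s bound le_sup_norm[OF ctx _ that] by (cases "s < 0") auto
      have "E t = {}"
      proof (rule equals0I)
        fix u assume "u \<in> E t"
        from E_diff[OF this] t N obtain a where "a \<in> Rn n" "f a > t" by auto
        with fN[of a] t show False by simp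
      qed
      thus ?thesis by simp
    next
      case False
      let ?K = "{x \<in> Rn n. f x > t}"
      have "emeasure (lebesgue_Rn n) ?K \<le> emeasure (lebesgue_Rn n) {x \<in> Rn n. f x > ?N}"
        using superlevel_measurable(2)[OF ctx] t by (intro emeasure_mono) auto
      hence V: "emeasure (lebesgue_Rn n) ?K = 0" using superlevel_null[OF ctx] by simp
      have t0: "t \<ge> 0" using t N by simp
      have dimH: "dim H = n" using False m by simp
      show ?thesis
      proof (rule difference_null[OF H m(1) dimH superlevel_measurable(2)[OF ctx]
            convex_superlevel(2)[OF ctx t0] _ V E_sets])
        fix u assume "u \<in> E t"
        from E_diff[OF this t0] show "\<exists>a\<in>?K. \<exists>b\<in>?K. flat_param n H u = a - b" by auto
      qed auto
    qed
    let ?h = "\<lambda>t. indicator {0<..} t * emeasure ?L (E t)"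
    interpret L: sigma_finite_measure ?L by (rule sigma_finite_borel_Rn)
    have hm: "?h \<in> borel_measurable borel"
    proof -
      have "(\<lambda>t. \<integral>\<^sup>+u. indicator {u. ennreal t < g u} u \<partial>?L) \<in> borel_measurable borel"
        by measurable
      moreover have "(\<integral>\<^sup>+u. indicator {u. ennreal t < g u} u \<partial>?L) = emeasure ?L (E t)" for t
      proof -
        have "(\<integral>\<^sup>+u. indicator {u. ennreal t < g u} u \<partial>?L) = (\<integral>\<^sup>+u. indicator (E t) u \<partial>?L)"
          by (rule nn_integral_cong) (simp add: E_def indicator_def)
        thus ?thesis using E_sets by simp
      qed
      ultimately show ?thesis by simp
    qed
    have "(\<integral>\<^sup>+u. g u \<partial>?L) = (\<integral>\<^sup>+t. ?h t \<partial>lborel)"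
      using nn_integral_layer_cake[OF sigma_finite_borel_Rn g] by (simp add: E_def)
    also have "(\<integral>\<^sup>+t. ?h t \<partial>lborel) = ennreal \<bar>?N\<bar> * (\<integral>\<^sup>+\<tau>. ?h (0 + ?N * \<tau>) \<partial>lborel)"
      by (rule nn_integral_real_affine[OF hm]) (use N in simp)
    \<comment> \<open>The constant is moved as \<open>1 / C\<close> to the integrand known to be
      measurable. The comparison with \<open>S\<close> is then plain monotonicity, which does not
      involve measurability of \<open>S\<close>.\<close>
    also have "(\<integral>\<^sup>+\<tau>. ?h (0 + ?N * \<tau>) \<partial>lborel) = ennreal C * (\<integral>\<^sup>+\<tau>. ennreal (1 / C) * ?h (0 + ?N * \<tau>) \<partial>lborel)"
    proof -
      have "(\<lambda>\<tau>. ?h (0 + ?N * \<tau>)) \<in> borel_measurable borel" by (rule measurable_compose[OF _ hm]) measurable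
      hence "(\<integral>\<^sup>+\<tau>. ennreal (1 / C) * ?h (0 + ?N * \<tau>) \<partial>lborel) = ennreal (1 / C) * (\<integral>\<^sup>+\<tau>. ?h (0 + ?N * \<tau>) \<partial>lborel)"
        by (intro nn_integral_cmult) simp
      moreover have "ennreal C * ennreal (1 / C) = 1"
        using C by (subst ennreal_mult[symmetric]) auto
      ultimately show ?thesis by (simp add: mult.assoc[symmetric])
    qed
    also have "(\<integral>\<^sup>+\<tau>. ennreal (1 / C) * ?h (0 + ?N * \<tau>) \<partial>lborel) \<le> (\<integral>\<^sup>+t\<in>{0..1}. S t \<partial>lborel)"
    proof (rule nn_integral_mono)
      fix \<tau> :: real
      consider "\<tau> \<le> 0" | "0 < \<tau>" "\<tau> < 1" | "\<tau> \<ge> 1" by linarith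
      thus "ennreal (1 / C) * ?h (0 + ?N * \<tau>) \<le> S \<tau> * indicator {0..1} \<tau>"
      proof cases
        case 1
        hence "?N * \<tau> \<le> 0" using N by (simp add: mult_nonneg_nonpos)
        thus ?thesis by (simp add: indicator_def)
      next
        case 2
        have "ennreal (1 / C) * emeasure ?L (E (\<tau> * ?N)) \<le> ennreal (1 / C) * (ennreal C * S \<tau>)"
          by (intro mult_left_mono low 2) simp
        also have "\<dots> = S \<tau>"
        proof -
          have "ennreal (1 / C) * ennreal C = 1" using C by (subst ennreal_mult[symmetric]) auto
          thus ?thesis by (simp add: mult.assoc[symmetric])
        qed
        finally show ?thesis using 2 N by (simp add: mult.commute)
      next
        case 3
        hence "?N * 1 \<le> ?N * \<tau>" using N by (intro mult_left_mono) auto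
        thus ?thesis using high[of "?N * \<tau>"] by simp
      qed
    qed
    finally show "(\<integral>\<^sup>+u. g u \<partial>?L) \<le> ennreal ?N * (ennreal C * (\<integral>\<^sup>+t\<in>{0..1}. S t \<partial>lborel))"
      using N by (simp add: mult_left_mono)
  qed
  thus ?thesis using N unfolding C_def S_def by (intro divide_le_posI_ennreal) auto
qed

text \<open>For \<open>s = 0\<close> the essential supremum can lie below the pointwise one, and on
  a proper subspace a null set of \<open>Rn n\<close> can carry a positive integral; the last
  hypothesis excludes this.\<close>

theorem corollary1:
  shows "\<exists>c::real. c > 0 \<and>
    (\<forall>(n::nat) (m::nat) (H::seq set) (s::real) (f::seq \<Rightarrow> real).
       1 \<le> m \<and> m \<le> n \<and>
       H \<subseteq> Rn n \<and> subspace H \<and> dim H = m \<and>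
       s \<le> 0 \<and>
       (\<forall>x\<in>Rn n. 0 \<le> f x) \<and>
       integrable (lebesgue_Rn n) f \<and>
       bounded (f ` Rn n) \<and>
       alpha_concave n (recip_exponent s) f \<and>
       sup_norm n f > 0 \<and>
       (s = 0 \<and> m < n \<longrightarrow> (\<forall>x\<in>Rn n. f x \<le> sup_norm n f))
       \<longrightarrow>
       (\<integral>\<^sup>+x. alpha_difference n (recip_exponent s) f x \<partial>flat_lebesgue n H 0) / ennreal (sup_norm n f)
         \<le> ennreal ((c * psi n m) ^ m) *
            (\<integral>\<^sup>+t\<in>{0..1}. (SUP y\<in>Rn n. emeasure (flat_lebesgue n H y)
                                  (level_set n f t \<inter> ((\<lambda>h. h + y) ` H))) \<partial>lborel))"
proof (intro exI conjI allI impI)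
  show "section_const > 0" by (rule section_const_pos)
  fix n m :: nat and H :: "seq set" and s :: real and f :: "seq \<Rightarrow> real"
  assume *: "1 \<le> m \<and> m \<le> n \<and>
       H \<subseteq> Rn n \<and> subspace H \<and> dim H = m \<and>
       s \<le> 0 \<and>
       (\<forall>x\<in>Rn n. 0 \<le> f x) \<and>
       integrable (lebesgue_Rn n) f \<and>
       bounded (f ` Rn n) \<and>
       alpha_concave n (recip_exponent s) f \<and>
       sup_norm n f > 0 \<and>
       (s = 0 \<and> m < n \<longrightarrow> (\<forall>x\<in>Rn n. f x \<le> sup_norm n f))"
  hence m: "dim H = m" by simp
  show "(\<integral>\<^sup>+x. alpha_difference n (recip_exponent s) f x \<partial>flat_lebesgue n H 0) / ennreal (sup_norm n f)
         \<le> ennreal ((section_const * psi n m) ^ m) *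
            (\<integral>\<^sup>+t\<in>{0..1}. (SUP y\<in>Rn n. emeasure (flat_lebesgue n H y)
                                  (level_set n f t \<inter> ((\<lambda>h. h + y) ` H))) \<partial>lborel)"
    by (rule alpha_difference_section_bound[where H=H and n=n and s=s and f=f, unfolded m]) (use * in auto)
qed

end
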